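(* Let $\rho\in(1,2]$, $\lambda>0$ and $\mu>\frac{1}{2\rho}$. Let $\alpha$ be a random variable with the Gamma distribution $\Gamma(\mu,\lambda)$ on $(\bar\Omega,\bar{\mathcal F},\bar{\mathbb P})$, with expectation denoted $\bar{\mathbb E}$, let $W$ be a standard Brownian motion on $(\Omega,\mathcal F,\mathbb P)$, and let $$Y(t)=\int_0^t \bar{\mathbb E}[s_\alpha(t-\tau)]\,dW(\tau),\qquad t\ge0.$$ Then there exists a Gaussian random variable $\eta$ such that $Y(t)$ converges in law to $\eta$ as $t\to\infty$.
   Context: The distribution $\Gamma(\mu,\lambda)$ has density $f(x)=\frac{1}{\Gamma(\mu)}\lambda e^{-\lambda x}(\lambda x)^{\mu-1}$ for $x>0$. With $g_\rho(t)=t^{\rho-1}/\Gamma(\rho)$, for $\alpha\ge0$ the scalar resolvent $s_\alpha:[0,\infty)\to\mathbb R$ is the solution of $s_\alpha(t)+\alpha\int_0^t g_\rho(t-\tau)s_\alpha(\tau)\,d\tau=1$, $t\ge0$; equivalently $s_\alpha(t)=E_\rho(-\alpha t^\rho)$ with $E_\rho(z)=\sum_{k\ge0}\frac{z^k}{\Gamma(\rho k+1)}$ the Mittag-Leffler function. *)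

theory Defs
  imports "HOL-Probability.Probability"
begin

section \<open>The Gamma distribution\<close>

definition gamma_density :: "real \<Rightarrow> real \<Rightarrow> real \<Rightarrow> real" where
  "gamma_density \<mu> lam x =
     (if x > 0 then lam * exp (- lam * x) * (lam * x) powr (\<mu> - 1) / Gamma \<mu> else 0)"

section \<open>The scalar resolvent\<close>

definition frac_kernel :: "real \<Rightarrow> real \<Rightarrow> real" where
  "frac_kernel \<rho> t = t powr (\<rho> - 1) / Gamma \<rho>"

text \<open>
  Solutions of the Volterra equation are sought among continuous functions on \<open>[0, \<infinity>)\<close>;
  for \<open>\<rho> \<ge> 1\<close> the integrand below is then continuous in \<open>\<tau>\<close> up to the endpoints,
  so that the integral is a genuine one.
\<close>

definition is_scalar_resolvent :: "real \<Rightarrow> real \<Rightarrow> (real \<Rightarrow> real) \<Rightarrow> bool" where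
  "is_scalar_resolvent \<rho> \<alpha> s \<longleftrightarrow>
     continuous_on {0..} s \<and>
     (\<forall>t\<ge>0. s t + \<alpha> * (LBINT \<tau>:{0..t}. frac_kernel \<rho> (t - \<tau>) * s \<tau>) = 1)"

text \<open>
  The solution is unique only on \<open>[0, \<infinity>)\<close>, since the equation says nothing about \<open>s\<close> at
  negative times; hence the description of its value at a time \<open>t\<close>, which is meaningful for
  \<open>t \<ge> 0\<close>, instead of a description of the function. For \<open>\<rho> \<ge> 1\<close> the equation is uniquely
  solvable, by \<open>t \<mapsto> E\<^sub>\<rho>(- \<alpha> t\<^sup>\<rho>)\<close> with the Mittag-Leffler function \<open>E\<^sub>\<rho>\<close>, for every real \<open>\<alpha>\<close>.
\<close>

definition scalar_resolvent :: "real \<Rightarrow> real \<Rightarrow> real \<Rightarrow> real" where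
  "scalar_resolvent \<rho> \<alpha> t = (THE y. \<exists>s. is_scalar_resolvent \<rho> \<alpha> s \<and> s t = y)"

section \<open>Brownian motion\<close>

text \<open>Only the times \<open>t \<ge> 0\<close> matter.\<close>

locale brownian_motion = prob_space M for M :: "'a measure" +
  fixes W :: "real \<Rightarrow> 'a \<Rightarrow> real"
  assumes measurable_BM: "\<And>t. t \<ge> 0 \<Longrightarrow> W t \<in> borel_measurable M"
    and start_BM: "AE \<omega> in M. W 0 \<omega> = 0"
    and normal_increments:
      "\<And>s t. 0 \<le> s \<Longrightarrow> s < t \<Longrightarrow>
         distributed M lborel (\<lambda>\<omega>. W t \<omega> - W s \<omega>) (normal_density 0 (sqrt (t - s)))"
    and indep_increments:
      "\<And>(p :: nat \<Rightarrow> real) n. 0 \<le> p 0 \<Longrightarrow> (\<And>i. i < n \<Longrightarrow> p i < p (Suc i)) \<Longrightarrow>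
         indep_vars (\<lambda>_. borel) (\<lambda>i \<omega>. W (p (Suc i)) \<omega> - W (p i) \<omega>) {..<n}"
    and continuous_paths: "AE \<omega> in M. continuous_on {0..} (\<lambda>t. W t \<omega>)"

section \<open>The stochastic integral of a deterministic function\<close>

text \<open>
  A step function on \<open>[0, t]\<close> is given by \<open>n\<close> cells with endpoints \<open>p 0 \<le> \<dots> \<le> p n\<close> and
  values \<open>c 0, \<dots>, c (n - 1)\<close>.
\<close>

definition is_partition :: "real \<Rightarrow> nat \<Rightarrow> (nat \<Rightarrow> real) \<Rightarrow> bool" where
  "is_partition t n p \<longleftrightarrow> p 0 = 0 \<and> p n = t \<and> (\<forall>i<n. p i \<le> p (Suc i))"

definition step_fun :: "nat \<Rightarrow> (nat \<Rightarrow> real) \<Rightarrow> (nat \<Rightarrow> real) \<Rightarrow> real \<Rightarrow> real" where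
  "step_fun n p c x = (\<Sum>i<n. c i * indicator {p i<..p (Suc i)} x)"

definition step_integral ::
  "(real \<Rightarrow> 'a \<Rightarrow> real) \<Rightarrow> nat \<Rightarrow> (nat \<Rightarrow> real) \<Rightarrow> (nat \<Rightarrow> real) \<Rightarrow> 'a \<Rightarrow> real" where
  "step_integral W n p c \<omega> = (\<Sum>i<n. c i * (W (p (Suc i)) \<omega> - W (p i) \<omega>))"

text \<open>
  \<open>I\<close> is (a version of) \<open>\<integral>\<^sub>0\<^sup>t f dW\<close> if it is the limit in \<open>L\<^sup>2(M)\<close> of the integrals of step
  functions converging to \<open>f\<close> in \<open>L\<^sup>2([0, t])\<close>. By the Ito isometry such an \<open>I\<close> exists
  for every \<open>f \<in> L\<^sup>2([0, t])\<close>, is unique up to null sets, and does not depend on the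
  approximating sequence.
\<close>

definition has_wiener_integral ::
  "'a measure \<Rightarrow> (real \<Rightarrow> 'a \<Rightarrow> real) \<Rightarrow> real \<Rightarrow> (real \<Rightarrow> real) \<Rightarrow> ('a \<Rightarrow> real) \<Rightarrow> bool" where
  "has_wiener_integral M W t f I \<longleftrightarrow>
     set_borel_measurable lborel {0..t} f \<and>
     I \<in> borel_measurable M \<and>
     (\<exists>n p c. (\<forall>k::nat. is_partition t (n k) (p k)) \<and>
        (\<lambda>k. \<integral>\<^sup>+x\<in>{0..t}. ennreal ((f x - step_fun (n k) (p k) (c k) x)\<^sup>2) \<partial>lborel)
          \<longlonglongrightarrow> 0 \<and>
        (\<lambda>k. \<integral>\<^sup>+\<omega>. ennreal ((I \<omega> - step_integral W (n k) (p k) (c k) \<omega>)\<^sup>2) \<partial>M)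
          \<longlonglongrightarrow> 0)"

definition wiener_integral ::
  "'a measure \<Rightarrow> (real \<Rightarrow> 'a \<Rightarrow> real) \<Rightarrow> real \<Rightarrow> (real \<Rightarrow> real) \<Rightarrow> 'a \<Rightarrow> real" where
  "wiener_integral M W t f = (SOME I. has_wiener_integral M W t f I)"

section \<open>Convergence in law\<close>

text \<open>
  This is \<^const>\<open>weak_conv_m\<close> for the laws of real random variables, with an arbitrary filter
  in place of \<^const>\<open>sequentially\<close>.
\<close>

definition tendsto_in_law ::
  "'a measure \<Rightarrow> ('t \<Rightarrow> 'a \<Rightarrow> real) \<Rightarrow> ('a \<Rightarrow> real) \<Rightarrow> 't filter \<Rightarrow> bool" where
  "tendsto_in_law M Y \<eta> F \<longleftrightarrow>
     (\<forall>x. isCont (cdf (distr M borel \<eta>)) x \<longrightarrow>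
        ((\<lambda>t. cdf (distr M borel (Y t)) x) \<longlongrightarrow> cdf (distr M borel \<eta>) x) F)"

lemma tendsto_in_law_sequentially:
  "tendsto_in_law M Y \<eta> sequentially \<longleftrightarrow>
     weak_conv_m (\<lambda>n. distr M borel (Y n)) (distr M borel \<eta>)"
  by (simp add: tendsto_in_law_def weak_conv_m_def weak_conv_def)

end

theory Submission
  imports Defs
begin

text \<open>
  The integral \<open>Y(t)\<close> is centred Gaussian with variance \<open>\<integral>\<^sub>0\<^sup>t h\<^sup>2\<close>, where \<open>h(t)\<close> is the mean of
  \<open>s\<^sub>\<alpha>(t)\<close>, so by the continuity theorem for characteristic functions everything reduces to
  \<open>h \<in> L\<^sup>2(0, \<infinity>)\<close>.

  For \<open>\<rho> < 2\<close> the scaling \<open>s\<^sub>\<alpha>(t) = s\<^sub>1(\<alpha>\<^bsup>1/\<rho>\<^esup> t)\<close> and the Cauchy-Schwarz inequality with weight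
  \<open>\<alpha>\<^bsup>-1/(2\<rho>)\<^esup>\<close>, whose mean is finite exactly because \<open>\<mu> > 1/(2\<rho>)\<close>, reduce this to
  \<open>s\<^sub>1 \<in> L\<^sup>2(0, \<infinity>)\<close>. Now \<open>s\<^sub>1' = - g * s\<^sub>1\<close> with the kernel \<open>g(t) = t\<^bsup>\<rho>-2\<^esup> / \<Gamma>(\<rho>-1)\<close>, a mixture
  \<open>\<integral> exp(-r t) d\<nu>(r)\<close> of exponentials. With \<open>v\<^sub>r = exp(-r \<cdot>) * s\<^sub>1\<close> the energy
  \<open>s\<^sub>1\<^sup>2 + \<integral> v\<^sub>r\<^sup>2 d\<nu>(r)\<close> dissipates at rate \<open>2 \<integral> r v\<^sub>r\<^sup>2 d\<nu>(r)\<close>, and integrating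
  \<open>(s\<^sub>1 v\<^sub>p)'\<close> for one suitable rate \<open>p\<close> turns the dissipation into a bound for \<open>\<integral> s\<^sub>1\<^sup>2\<close>.

  For \<open>\<rho> = 2\<close> the functions \<open>s\<^sub>\<alpha>(t) = cos(\<alpha>\<^bsup>1/2\<^esup> t)\<close> are not square integrable. There
  \<open>\<integral>\<^sub>0\<^sup>\<infinity> exp(-\<epsilon> t) h(t)\<^sup>2 dt\<close> is a double integral of the Gamma density against a kernel dominated by
  the Poisson kernel in the variables \<open>\<alpha>\<^bsup>1/2\<^esup>\<close>, and is bounded uniformly in \<open>\<epsilon>\<close> by the arithmetic-geometric mean
  inequality.
\<close>

section \<open>Exponential averages\<close>

text \<open>The case \<rho> = 2 is not a limit of the energy argument: as \<rho> tends to 2 the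
  measure \<nu> concentrates at rate 0, the kernel becomes the constant 1 and nothing is dissipated.
  All decay must then come from averaging over \<alpha>. Below 2 the dissipation carries a factor r
  and so says little about slow rates; this is why a single rate p is singled out, bounded below so
  that 1 / (p + r) stays bounded by 1 / (1 + r) and above so that multiplying by p costs only a
  constant. No asymptotic expansion of the Mittag-Leffler function enters.

  The exponent 1 / (2 \<rho>) is a balance. By scaling, the integral of the squared resolvent is
  \<alpha> to the power -1/\<rho> times a constant; giving half of this power to each Cauchy-Schwarz
  factor turns both into the same negative moment of \<alpha>. For \<rho> = 2 the corresponding
  threshold 1/4 reappears as integrability at 0 of the squared Gamma density times the square
  root.\<close>

definition relax :: "(real \<Rightarrow> real) \<Rightarrow> real \<Rightarrow> real \<Rightarrow> real" where
  "relax s r t = (LBINT u:{0..t}. exp (- r * (t - u)) * s u)"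

lemma LBINT_eq_integral_continuous:
  fixes f :: "real \<Rightarrow> real"
  assumes "continuous_on {a..b} f"
  shows "(LBINT x:{a..b}. f x) = integral {a..b} f"
  using assms by (intro set_borel_integral_eq_integral borel_integrable_atLeastAtMost')

context
  fixes s :: "real \<Rightarrow> real"
  assumes cont: "continuous_on {0..} s"
begin

lemma cont_on: "continuous_on {a..b} s" if "a \<ge> 0"
  using cont that by (auto intro: continuous_on_subset)

text \<open>Splitting off \<open>exp (- r * t)\<close> leaves \<open>t\<close> only in the upper
  limit, so that differentiation in \<open>t\<close> is an instance of the fundamental
  theorem.\<close>

lemma relax_eq:
  "relax s r t = exp (- r * t) * integral {0..t} (\<lambda>u. exp (r * u) * s u)"
proof -
  have "relax s r t = integral {0..t} (\<lambda>u. exp (- r * (t - u)) * s u)"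
    unfolding relax_def
    by (intro LBINT_eq_integral_continuous continuous_intros cont_on) simp
  also have "(\<lambda>u. exp (- r * (t - u)) * s u) = (\<lambda>u. exp (- r * t) * (exp (r * u) * s u))"
    by (simp add: fun_eq_iff algebra_simps flip: exp_add)
  finally show ?thesis by simp
qed

lemma has_real_derivative_relax:
  assumes "0 \<le> t" "t \<le> T"
  shows "(relax s r has_real_derivative s t - r * relax s r t) (at t within {0..T})"
proof -
  have "((\<lambda>t. integral {0..t} (\<lambda>u. exp (r * u) * s u)) has_real_derivative exp (r * t) * s t)
          (at t within {0..T})"
    using assms by (intro integral_has_real_derivative continuous_intros cont_on) auto
  then have "((\<lambda>t. exp (- r * t) * integral {0..t} (\<lambda>u. exp (r * u) * s u)) has_real_derivative
     exp (- r * t) * (exp (r * t) * s t) +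
       (- r * exp (- r * t)) * integral {0..t} (\<lambda>u. exp (r * u) * s u)) (at t within {0..T})"
    by (auto intro!: derivative_eq_intros)
  then show ?thesis
    unfolding relax_eq[abs_def] by (simp add: exp_minus algebra_simps)
qed

lemma continuous_on_relax: "continuous_on {0..T} (relax s r)"
  by (rule DERIV_continuous_on[where D = "\<lambda>t. s t - r * relax s r t"])
     (auto intro: has_real_derivative_relax)

lemma relax_0 [simp]: "relax s r 0 = 0"
  by (simp add: relax_eq)

text \<open>With \<open>J\<close> the integral of the exponential alone, \<open>J\<close> is at most
  \<open>t\<close> and \<open>r * J\<close> is at most 1. Adding the two produces the factor 1 / (1
  + r), the weight against which the rates are integrated later.\<close>

lemma abs_relax_le:
  assumes r: "r \<ge> 0" and t: "0 \<le> t" "t \<le> T" and B: "\<And>u. 0 \<le> u \<Longrightarrow> u \<le> t \<Longrightarrow> \<bar>s u\<bar> \<le> B"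
  shows "\<bar>relax s r t\<bar> \<le> B * (T + 1) / (1 + r)" "r * \<bar>relax s r t\<bar> \<le> B"
proof -
  have B0: "B \<ge> 0" using B[of 0] t by auto
  define J where "J = integral {0..t} (\<lambda>u. exp (- r * (t - u)))"
  have "relax s r t = integral {0..t} (\<lambda>u. exp (- r * (t - u)) * s u)"
    unfolding relax_def
    by (intro LBINT_eq_integral_continuous continuous_intros cont_on) simp
  also have "\<bar>\<dots>\<bar> \<le> integral {0..t} (\<lambda>u. B * exp (- r * (t - u)))"
  proof -
    have "norm (exp (- r * (t - u)) * s u) \<le> B * exp (- r * (t - u))" if "u \<in> {0..t}" for u
      using B[of u] that by (simp add: abs_mult mult.commute)
    then show ?thesis
      unfolding real_norm_def[symmetric]
      by (intro integral_norm_bound_integral integrable_continuous_interval continuous_intros cont_on) auto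
  qed
  finally have le: "\<bar>relax s r t\<bar> \<le> B * J" by (simp add: J_def)
  have "J \<le> integral {0..t} (\<lambda>u. 1)"
    unfolding J_def using r t
    by (intro integral_le integrable_continuous_interval continuous_intros)
       (auto intro!: mult_nonneg_nonneg)
  then have J1: "J \<le> t" using t by simp
  have "((\<lambda>u. r * exp (- r * (t - u))) has_integral
           exp (- r * (t - t)) - exp (- r * (t - 0))) {0..t}"
    using t by (intro fundamental_theorem_of_calculus)
       (auto intro!: derivative_eq_intros simp flip: has_real_derivative_iff_has_vector_derivative)
  then have "r * J = 1 - exp (- r * t)"
    unfolding J_def by (subst integral_mult_right[symmetric]) (auto dest: integral_unique)
  then have J2: "r * J \<le> 1" by simp
  have "(1 + r) * \<bar>relax s r t\<bar> \<le> (1 + r) * (B * J)"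
    using le r by (intro mult_left_mono) auto
  also have "\<dots> = B * (J + r * J)" by (simp add: algebra_simps)
  also have "\<dots> \<le> B * (T + 1)" using J1 J2 B0 t by (intro mult_left_mono) auto
  finally show "\<bar>relax s r t\<bar> \<le> B * (T + 1) / (1 + r)"
    using r by (simp add: field_simps)
  have "r * \<bar>relax s r t\<bar> \<le> r * (B * J)" using le r by (intro mult_left_mono) auto
  also have "\<dots> = B * (r * J)" by simp
  also have "\<dots> \<le> B * 1" using J2 B0 by (intro mult_left_mono) auto
  finally show "r * \<bar>relax s r t\<bar> \<le> B" by simp
qed

text \<open>Integration by parts. Derivatives are asked for in the open interval only, because those
  of the resolvent are available only at positive times.\<close>

lemma integral_derivative_product:
  assumes T: "T \<ge> 0" and "continuous_on {0..T} f" "continuous_on {0..T} g"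
    and "continuous_on {0..T} f'" "continuous_on {0..T} g'"
    and "\<And>t. 0 < t \<Longrightarrow> t < T \<Longrightarrow> (f has_real_derivative f' t) (at t)"
    and "\<And>t. 0 < t \<Longrightarrow> t < T \<Longrightarrow> (g has_real_derivative g' t) (at t)"
  shows "integral {0..T} (\<lambda>t. f' t * g t) + integral {0..T} (\<lambda>t. f t * g' t) = f T * g T - f 0 * g 0"
proof -
  have "((\<lambda>t. f' t * g t + f t * g' t) has_integral f T * g T - f 0 * g 0) {0..T}"
    using assms
    by (intro fundamental_theorem_of_calculus_interior)
       (auto intro!: derivative_eq_intros continuous_intros
          simp flip: has_real_derivative_iff_has_vector_derivative)
  then have "integral {0..T} (\<lambda>t. f' t * g t + f t * g' t) = f T * g T - f 0 * g 0"
    by (rule integral_unique)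
  then show ?thesis
    using assms
    by (subst (asm) Henstock_Kurzweil_Integration.integral_add)
       (auto intro!: integrable_continuous_interval continuous_intros)
qed

lemma DERIV_relax:
  assumes "0 < t" shows "(relax s r has_real_derivative s t - r * relax s r t) (at t)"
proof -
  have "at t within {0..t+1} = at t" using assms by (intro at_within_interior) auto
  then show ?thesis using has_real_derivative_relax[of t "t+1" r] assms by simp
qed

text \<open>Integrate the derivative of v^2 / 2, which is s v - r v^2, starting from v(0) = 0. The
  right side splits the work done by \<open>s\<close> on v into stored and dissipated
  energy.\<close>

lemma relax_energy:
  assumes T: "T \<ge> 0"
  shows "integral {0..T} (\<lambda>t. s t * relax s r t) =
           (relax s r T)\<^sup>2 / 2 + r * integral {0..T} (\<lambda>t. (relax s r t)\<^sup>2)"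
proof -
  note [continuous_intros] = cont_on continuous_on_relax
  let ?v = "relax s r"
  have "2 * integral {0..T} (\<lambda>t. (s t - r * ?v t) * ?v t) = (?v T)\<^sup>2"
  proof -
    have "integral {0..T} (\<lambda>t. (s t - r * ?v t) * ?v t) + integral {0..T} (\<lambda>t. ?v t * (s t - r * ?v t))
            = ?v T * ?v T - ?v 0 * ?v 0"
      using T by (intro integral_derivative_product continuous_intros DERIV_relax) auto
    then show ?thesis by (simp add: power2_eq_square mult.commute)
  qed
  also have "(\<lambda>t. (s t - r * ?v t) * ?v t) = (\<lambda>t. s t * ?v t - r * (?v t)\<^sup>2)"
    by (simp add: fun_eq_iff algebra_simps power2_eq_square)
  also have "integral {0..T} \<dots> =
      integral {0..T} (\<lambda>t. s t * ?v t) - r * integral {0..T} (\<lambda>t. (?v t)\<^sup>2)"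
    by (subst Henstock_Kurzweil_Integration.integral_diff)
       (auto intro!: integrable_continuous_interval continuous_intros)
  finally show ?thesis by simp
qed

text \<open>Integrate the derivative of the product of the two averages. The factor p + q on the
  left is what later supplies decay in the free rate q.\<close>

lemma relax_cross:
  assumes T: "T \<ge> 0"
  shows "(p + q) * integral {0..T} (\<lambda>t. relax s p t * relax s q t) =
           integral {0..T} (\<lambda>t. s t * relax s q t) + integral {0..T} (\<lambda>t. s t * relax s p t)
             - relax s p T * relax s q T"
proof -
  note [continuous_intros] = cont_on continuous_on_relax
  let ?v = "relax s p" and ?w = "relax s q"
  have "integral {0..T} (\<lambda>t. (s t - p * ?v t) * ?w t) + integral {0..T} (\<lambda>t. ?v t * (s t - q * ?w t))
          = ?v T * ?w T - ?v 0 * ?w 0"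
    using T by (intro integral_derivative_product continuous_intros DERIV_relax) auto
  also have "(\<lambda>t. (s t - p * ?v t) * ?w t) = (\<lambda>t. s t * ?w t - p * (?v t * ?w t))"
    by (simp add: fun_eq_iff algebra_simps)
  also have "integral {0..T} \<dots> =
      integral {0..T} (\<lambda>t. s t * ?w t) - p * integral {0..T} (\<lambda>t. ?v t * ?w t)"
    by (subst Henstock_Kurzweil_Integration.integral_diff)
       (auto intro!: integrable_continuous_interval continuous_intros)
  also have "(\<lambda>t. ?v t * (s t - q * ?w t)) = (\<lambda>t. s t * ?v t - q * (?v t * ?w t))"
    by (simp add: fun_eq_iff algebra_simps)
  also have "integral {0..T} \<dots> =
      integral {0..T} (\<lambda>t. s t * ?v t) - q * integral {0..T} (\<lambda>t. ?v t * ?w t)"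
    by (subst Henstock_Kurzweil_Integration.integral_diff)
       (auto intro!: integrable_continuous_interval continuous_intros)
  finally show ?thesis by (simp add: algebra_simps)
qed

end

section \<open>Joint measurability and interchange of integrals\<close>

lemma borel_measurable_relax [measurable]:
  assumes [measurable]: "s \<in> borel_measurable borel"
    and [measurable]: "R \<in> borel_measurable N" "X \<in> borel_measurable N"
  shows "(\<lambda>x. relax s (R x) (X x)) \<in> borel_measurable N"
proof -
  have "(\<lambda>x. \<integral>u. (if 0 \<le> u \<and> u \<le> X x then exp (- R x * (X x - u)) * s u else 0) \<partial>lborel)
          \<in> borel_measurable N"
    by measurable
  also have "(\<lambda>x. \<integral>u. (if 0 \<le> u \<and> u \<le> X x then exp (- R x * (X x - u)) * s u else 0) \<partial>lborel)
     = (\<lambda>x. relax s (R x) (X x))"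
    unfolding relax_def set_lebesgue_integral_def
    by (intro ext Bochner_Integration.integral_cong) (auto simp: indicator_def)
  finally show ?thesis .
qed

text \<open>A majorant of product form is integrable over the product space as soon as its two
  factors are, so the hypotheses of Fubini's theorem reduce to conditions in one variable.\<close>

lemma Fubini_dominated:
  fixes f :: "'p \<Rightarrow> 'q \<Rightarrow> real" and a :: "'p \<Rightarrow> real" and k :: "'q \<Rightarrow> real"
  assumes "sigma_finite_measure \<mu>" "sigma_finite_measure \<nu>"
    and [measurable]: "(\<lambda>(q, t). f t q) \<in> borel_measurable (\<nu> \<Otimes>\<^sub>M \<mu>)"
    and a: "integrable \<mu> a" and k: "integrable \<nu> k"
    and le: "\<And>q t. t \<in> space \<mu> \<Longrightarrow> q \<in> space \<nu> \<Longrightarrow> \<bar>f t q\<bar> \<le> a t * k q"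
  shows "integrable \<nu> (\<lambda>q. \<integral>t. f t q \<partial>\<mu>)" and "integrable \<mu> (\<lambda>t. \<integral>q. f t q \<partial>\<nu>)"
    and "(\<integral>q. (\<integral>t. f t q \<partial>\<mu>) \<partial>\<nu>) = (\<integral>t. (\<integral>q. f t q \<partial>\<nu>) \<partial>\<mu>)"
proof -
  interpret P: pair_sigma_finite \<nu> \<mu>
    using assms by (simp add: pair_sigma_finite_def)
  have [measurable]: "k \<in> borel_measurable \<nu>" "a \<in> borel_measurable \<mu>" using k a by auto
  have F: "integrable (\<nu> \<Otimes>\<^sub>M \<mu>) (\<lambda>(q, t). f t q)"
  proof (rule Bochner_Integration.integrable_bound)
    show "integrable (\<nu> \<Otimes>\<^sub>M \<mu>) (\<lambda>(q, t). a t * k q)"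
    proof (rule P.Fubini_integrable)
      have "(\<lambda>q. LINT t|\<mu>. norm (a t * k q)) = (\<lambda>q. (LINT t|\<mu>. \<bar>a t\<bar>) * \<bar>k q\<bar>)"
        by (simp add: abs_mult)
      then show "integrable \<nu> (\<lambda>q. LINT t|\<mu>. norm (case (q, t) of (q, t) \<Rightarrow> a t * k q))"
        using k by simp
      show "AE q in \<nu>. integrable \<mu> (\<lambda>t. case (q, t) of (q, t) \<Rightarrow> a t * k q)"
        using a by simp
    qed measurable
    show "AE x in \<nu> \<Otimes>\<^sub>M \<mu>. norm (case x of (q, t) \<Rightarrow> f t q) \<le> norm (case x of (q, t) \<Rightarrow> a t * k q)"
      using le by (intro AE_I2) (force simp: space_pair_measure)
  qed measurable
  show "integrable \<nu> (\<lambda>q. \<integral>t. f t q \<partial>\<mu>)" "integrable \<mu> (\<lambda>t. \<integral>q. f t q \<partial>\<nu>)"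
    using P.integrable_fst[OF F] P.integrable_snd[OF F] by simp_all
  show "(\<integral>q. (\<integral>t. f t q \<partial>\<mu>) \<partial>\<nu>) = (\<integral>t. (\<integral>q. f t q \<partial>\<nu>) \<partial>\<mu>)"
    using P.Fubini_integral[OF F] by simp
qed

lemma Fubini_interval:
  fixes f :: "real \<Rightarrow> 'q \<Rightarrow> real"
  assumes \<nu>: "sigma_finite_measure \<nu>"
    and [measurable]: "(\<lambda>(q, t). f t q) \<in> borel_measurable (\<nu> \<Otimes>\<^sub>M lborel)"
    and k: "integrable \<nu> k" and le: "\<And>q t. 0 \<le> t \<Longrightarrow> t \<le> T \<Longrightarrow> q \<in> space \<nu> \<Longrightarrow> \<bar>f t q\<bar> \<le> k q"
  shows "integrable \<nu> (\<lambda>q. LBINT t:{0..T}. f t q)"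
    and "set_integrable lborel {0..T} (\<lambda>t. \<integral>q. f t q \<partial>\<nu>)"
    and "(\<integral>q. (LBINT t:{0..T}. f t q) \<partial>\<nu>) = (LBINT t:{0..T}. (\<integral>q. f t q \<partial>\<nu>))"
proof -
  have m: "(\<lambda>(q, t). indicator {0..T} t * f t q) \<in> borel_measurable (\<nu> \<Otimes>\<^sub>M lborel)" by measurable
  have a: "integrable lborel (indicat_real {0..T})" by (simp add: emeasure_lborel_Icc_eq)
  have "\<bar>indicator {0..T} t * f t q\<bar> \<le> indicator {0..T} t * k q" if "q \<in> space \<nu>" for q t
    using le that by (auto simp: indicator_def)
  note F = Fubini_dominated[OF sigma_finite_lborel \<nu> m a k this]
  show "integrable \<nu> (\<lambda>q. LBINT t:{0..T}. f t q)"
    and "set_integrable lborel {0..T} (\<lambda>t. \<integral>q. f t q \<partial>\<nu>)"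
    and "(\<integral>q. (LBINT t:{0..T}. f t q) \<partial>\<nu>) = (LBINT t:{0..T}. (\<integral>q. f t q \<partial>\<nu>))"
    using F by (simp_all add: set_lebesgue_integral_def set_integrable_def)
qed

section \<open>The energy estimate\<close>

text \<open>The equation s' = - \<integral> v_r d\<nu>(r) for a general measure of rates,
  \<open>R q\<close> being the rate at the point \<open>q\<close>. By \<open>integrable_R\<close>
  bounded rates have finite mass and the averages at a fixed time are integrable;
  \<open>R_band\<close> provides mass at rates away from 0 and infinity. The integral has a name,
  \<open>w\<close>, so that its continuity can be assumed.\<close>

locale relaxation_equation = sigma_finite_measure \<nu> for \<nu> :: "'q measure" +
  fixes R :: "'q \<Rightarrow> real" and s w :: "real \<Rightarrow> real"
  assumes R_measurable [measurable]: "R \<in> borel_measurable \<nu>"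
    and R_nonneg: "\<And>q. q \<in> space \<nu> \<Longrightarrow> R q \<ge> 0"
    and integrable_R: "integrable \<nu> (\<lambda>q. 1 / (1 + R q))"
    and R_band: "measure \<nu> {q \<in> space \<nu>. 1 \<le> R q \<and> R q \<le> 2} > 0"
    and cont_s: "continuous_on {0..} s"
    and s_measurable [measurable]: "s \<in> borel_measurable borel"
    and s_0: "s 0 = 1"
    and cont_w: "continuous_on {0..} w"
    and w_eq: "\<And>t. t \<ge> 0 \<Longrightarrow> w t = (\<integral>q. relax s (R q) t \<partial>\<nu>)"
    and DERIV_s: "\<And>t. t > 0 \<Longrightarrow> (s has_real_derivative - w t) (at t)"
begin

lemma continuous_intros_sw:
  "a \<ge> 0 \<Longrightarrow> continuous_on {a..b} s" "a \<ge> 0 \<Longrightarrow> continuous_on {a..b} w"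
  "continuous_on {0..b} (relax s r)"
  using cont_s cont_w by (auto intro: continuous_on_subset continuous_on_relax)

lemma s_bounded_on:
  obtains B where "\<And>t. 0 \<le> t \<Longrightarrow> t \<le> T \<Longrightarrow> \<bar>s t\<bar> \<le> B"
proof -
  have "bounded (s ` {0..T})"
    by (intro compact_imp_bounded compact_continuous_image continuous_intros_sw) auto
  then show ?thesis using that by (force simp: bounded_iff)
qed

lemma relax_dominated:
  assumes "T \<ge> 0"
  obtains K where "K \<ge> 0"
    "\<And>q t. q \<in> space \<nu> \<Longrightarrow> 0 \<le> t \<Longrightarrow> t \<le> T \<Longrightarrow> \<bar>relax s (R q) t\<bar> \<le> K * (1 / (1 + R q))"
    "\<And>q t. q \<in> space \<nu> \<Longrightarrow> 0 \<le> t \<Longrightarrow> t \<le> T \<Longrightarrow> R q * \<bar>relax s (R q) t\<bar> \<le> K"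
proof -
  obtain B where B: "\<And>t. 0 \<le> t \<Longrightarrow> t \<le> T \<Longrightarrow> \<bar>s t\<bar> \<le> B" using s_bounded_on[of T] by blast
  have "B \<ge> 0" using B[of 0] assms by auto
  \<comment> \<open>One constant is to serve both bounds, hence the enlargement of
    \<open>B\<close>.\<close>
  then have "B * 1 \<le> B * (T + 1)" using assms by (intro mult_left_mono) auto
  then have "R q * \<bar>relax s (R q) t\<bar> \<le> B * (T + 1)" if "q \<in> space \<nu>" "0 \<le> t" "t \<le> T" for q t
    using abs_relax_le(2)[OF cont_s R_nonneg[OF that(1)] that(2,3), of B] B that by force
  moreover have "\<bar>relax s (R q) t\<bar> \<le> B * (T + 1) * (1 / (1 + R q))"
    if "q \<in> space \<nu>" "0 \<le> t" "t \<le> T" for q t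
    using abs_relax_le(1)[OF cont_s R_nonneg[OF that(1)] that(2,3), of B] B that by force
  ultimately show ?thesis using that[of "B * (T + 1)"] \<open>B \<ge> 0\<close> assms by auto
qed

lemma integral_w_swap:
  assumes T: "T \<ge> 0" and f: "continuous_on {0..T} f" and [measurable]: "f \<in> borel_measurable borel"
  shows "integrable \<nu> (\<lambda>q. integral {0..T} (\<lambda>t. f t * relax s (R q) t))"
    and "integral {0..T} (\<lambda>t. f t * w t) =
           (\<integral>q. integral {0..T} (\<lambda>t. f t * relax s (R q) t) \<partial>\<nu>)"
proof -
  have "bounded (f ` {0..T})"
    by (intro compact_imp_bounded compact_continuous_image f) auto
  then obtain D where D: "\<And>t. 0 \<le> t \<Longrightarrow> t \<le> T \<Longrightarrow> \<bar>f t\<bar> \<le> D" by (force simp: bounded_iff)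
  then have D0: "D \<ge> 0" using T by fastforce
  obtain K where K: "K \<ge> 0"
    "\<And>q t. q \<in> space \<nu> \<Longrightarrow> 0 \<le> t \<Longrightarrow> t \<le> T \<Longrightarrow> \<bar>relax s (R q) t\<bar> \<le> K * (1 / (1 + R q))"
    using relax_dominated[OF T] by metis
  have le: "\<bar>f t * relax s (R q) t\<bar> \<le> D * K * (1 / (1 + R q))"
    if "0 \<le> t" "t \<le> T" "q \<in> space \<nu>" for q t
    unfolding abs_mult mult.assoc using D D0 K that by (intro mult_mono) auto
  have eq: "(LBINT t:{0..T}. f t * relax s (R q) t) = integral {0..T} (\<lambda>t. f t * relax s (R q) t)" for q
    by (intro LBINT_eq_integral_continuous continuous_intros f continuous_intros_sw)
  have m: "(\<lambda>(q, t). f t * relax s (R q) t) \<in> borel_measurable (\<nu> \<Otimes>\<^sub>M lborel)"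
    by measurable
  note swap = Fubini_interval[OF sigma_finite_measure_axioms m
      integrable_mult_right[OF integrable_R, of "D * K"]]
  show "integrable \<nu> (\<lambda>q. integral {0..T} (\<lambda>t. f t * relax s (R q) t))"
    unfolding eq[symmetric] by (rule swap(1)) (rule le)
  have "(\<integral>q. integral {0..T} (\<lambda>t. f t * relax s (R q) t) \<partial>\<nu>) =
          (LBINT t:{0..T}. (\<integral>q. f t * relax s (R q) t \<partial>\<nu>))"
    unfolding eq[symmetric] by (rule swap(3)) (rule le)
  also have "\<dots> = (LBINT t:{0..T}. f t * w t)"
    by (intro set_lebesgue_integral_cong) (auto simp: w_eq)
  also have "\<dots> = integral {0..T} (\<lambda>t. f t * w t)"
    by (intro LBINT_eq_integral_continuous continuous_intros f continuous_intros_sw) auto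
  finally show "integral {0..T} (\<lambda>t. f t * w t) =
           (\<integral>q. integral {0..T} (\<lambda>t. f t * relax s (R q) t) \<partial>\<nu>)" by simp
qed

definition dissipation :: "real \<Rightarrow> 'q \<Rightarrow> real" where
  "dissipation T q = R q * integral {0..T} (\<lambda>t. (relax s (R q) t)\<^sup>2)"

lemma dissipation_nonneg: "q \<in> space \<nu> \<Longrightarrow> dissipation T q \<ge> 0"
  unfolding dissipation_def
  by (intro mult_nonneg_nonneg R_nonneg integral_nonneg integrable_continuous_interval
      continuous_intros continuous_intros_sw) auto

text \<open>Integrate the derivative of s^2, which is - 2 s w, and expand \<open>w\<close> over the
  rates with \<open>relax_energy\<close>. The squared averages are integrable because 1 / (1 + R)
  bounds its own square; the dissipation is then a difference of two integrable functions.\<close>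

lemma energy_balance:
  assumes T: "T \<ge> 0"
  shows "integrable \<nu> (\<lambda>q. (relax s (R q) T)\<^sup>2)" "integrable \<nu> (dissipation T)"
    and "(s T)\<^sup>2 + (\<integral>q. (relax s (R q) T)\<^sup>2 \<partial>\<nu>) + 2 * (\<integral>q. dissipation T q \<partial>\<nu>) = 1"
proof -
  have eq: "integral {0..T} (\<lambda>t. s t * relax s (R q) t) = (relax s (R q) T)\<^sup>2 / 2 + dissipation T q" for q
    unfolding dissipation_def by (rule relax_energy[OF cont_s T])
  note sw = integral_w_swap[OF T continuous_intros_sw(1) s_measurable, simplified, unfolded eq]
  obtain K where K: "K \<ge> 0"
    "\<And>q t. q \<in> space \<nu> \<Longrightarrow> 0 \<le> t \<Longrightarrow> t \<le> T \<Longrightarrow> \<bar>relax s (R q) t\<bar> \<le> K * (1 / (1 + R q))"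
    using relax_dominated[OF T] by metis
  show I1: "integrable \<nu> (\<lambda>q. (relax s (R q) T)\<^sup>2)"
  proof (rule Bochner_Integration.integrable_bound)
    show "integrable \<nu> (\<lambda>q. K\<^sup>2 * (1 / (1 + R q)))" using integrable_R by (rule integrable_mult_right)
    show "AE q in \<nu>. norm ((relax s (R q) T)\<^sup>2) \<le> norm (K\<^sup>2 * (1 / (1 + R q)))"
    proof (rule AE_I2)
      fix q assume q: "q \<in> space \<nu>"
      note Rq = R_nonneg[OF q]
      have "(relax s (R q) T)\<^sup>2 \<le> (K * (1 / (1 + R q)))\<^sup>2"
        using power_mono[OF K(2)[OF q T order_refl], of 2] by simp
      also have "\<dots> = K\<^sup>2 * (1 / (1 + R q)) * (1 / (1 + R q))" by (simp add: power2_eq_square)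
      also have "\<dots> \<le> K\<^sup>2 * (1 / (1 + R q)) * 1"
        using Rq by (intro mult_left_mono) (auto simp: field_simps)
      finally show "norm ((relax s (R q) T)\<^sup>2) \<le> norm (K\<^sup>2 * (1 / (1 + R q)))" using Rq by simp
    qed
  qed measurable
  have "integrable \<nu> (\<lambda>q. ((relax s (R q) T)\<^sup>2 / 2 + dissipation T q) - (relax s (R q) T)\<^sup>2 / 2)"
    using sw(1) I1 by (intro Bochner_Integration.integrable_diff) auto
  then show I2: "integrable \<nu> (dissipation T)" by simp
  have "integral {0..T} (\<lambda>t. - w t * s t) + integral {0..T} (\<lambda>t. s t * - w t) = s T * s T - s 0 * s 0"
    using T by (intro integral_derivative_product DERIV_s continuous_intros continuous_intros_sw) auto
  then have "(s T)\<^sup>2 = 1 - 2 * integral {0..T} (\<lambda>t. s t * w t)"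
    by (simp add: s_0 power2_eq_square mult.commute)
  also have "integral {0..T} (\<lambda>t. s t * w t) =
      (\<integral>q. (relax s (R q) T)\<^sup>2 \<partial>\<nu>) / 2 + (\<integral>q. dissipation T q \<partial>\<nu>)"
    using sw(2) I1 I2 by simp
  finally show "(s T)\<^sup>2 + (\<integral>q. (relax s (R q) T)\<^sup>2 \<partial>\<nu>) + 2 * (\<integral>q. dissipation T q \<partial>\<nu>) = 1"
    by simp
qed

text \<open>The three terms of the energy balance are nonnegative and add up to 1, whatever
  \<open>T\<close> is.\<close>

lemma
  assumes T: "T \<ge> 0"
  shows abs_s_le_1: "\<bar>s T\<bar> \<le> 1"
    and integral_relax_le: "(\<integral>q. (relax s (R q) T)\<^sup>2 \<partial>\<nu>) \<le> 1"
    and integral_dissipation_le: "(\<integral>q. dissipation T q \<partial>\<nu>) \<le> 1 / 2"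
proof -
  have *: "(\<integral>q. (relax s (R q) T)\<^sup>2 \<partial>\<nu>) \<ge> 0" "(\<integral>q. dissipation T q \<partial>\<nu>) \<ge> 0"
    by (intro integral_nonneg_AE AE_I2 dissipation_nonneg; simp)+
  have "(s T)\<^sup>2 \<ge> 0" by simp
  note ** = energy_balance(3)[OF T]
  show "(\<integral>q. (relax s (R q) T)\<^sup>2 \<partial>\<nu>) \<le> 1" "(\<integral>q. dissipation T q \<partial>\<nu>) \<le> 1 / 2"
    using * ** \<open>(s T)\<^sup>2 \<ge> 0\<close> by linarith+
  have "(s T)\<^sup>2 \<le> 1" using * ** by linarith
  then show "\<bar>s T\<bar> \<le> 1" by (simp add: abs_square_le_1)
qed

text \<open>
  The dissipation is only controlled on average over the rates; the rate found here depends
  on \<open>T\<close>, but its bounds do not.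
\<close>
lemma exists_small_dissipation:
  assumes T: "T \<ge> 0"
  defines "Z \<equiv> {q \<in> space \<nu>. 1 \<le> R q \<and> R q \<le> 2}"
  shows "\<exists>q\<in>Z. dissipation T q \<le> 1 / measure \<nu> Z"
proof (rule ccontr)
  assume "\<not> ?thesis"
  then have gt: "dissipation T q \<ge> 1 / measure \<nu> Z" if "q \<in> Z" for q using that by force
  have [measurable]: "Z \<in> sets \<nu>" unfolding Z_def by measurable
  have "integrable \<nu> (\<lambda>q. indicator Z q :: real)"
  proof (rule Bochner_Integration.integrable_bound)
    \<comment> \<open>On \<open>Z\<close> the rate is at most 2, so 1 + R is at most 3.\<close>
    show "integrable \<nu> (\<lambda>q. 3 * (1 / (1 + R q)))"
      using integrable_R by (rule integrable_mult_right)
    show "AE q in \<nu>. norm (indicator Z q :: real) \<le> norm (3 * (1 / (1 + R q)))"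
      by (rule AE_I2) (auto simp: Z_def indicator_def field_simps dest: R_nonneg)
  qed measurable
  then have "integrable \<nu> (\<lambda>q. 1 / measure \<nu> Z * indicator Z q)" by simp
  \<comment> \<open>Dissipation of at least 1 / measure on all of \<open>Z\<close> would integrate
    to at least 1, twice what the energy balance leaves.\<close>
  then have "(\<integral>q. 1 / measure \<nu> Z * indicator Z q \<partial>\<nu>) \<le> (\<integral>q. dissipation T q \<partial>\<nu>)"
    using gt dissipation_nonneg
    by (intro Bochner_Integration.integral_mono energy_balance(2) T) (auto simp: indicator_def)
  moreover have "(\<integral>q. 1 / measure \<nu> Z * indicator Z q \<partial>\<nu>) = 1"
    using R_band by (simp add: Z_def)
  ultimately show False using integral_dissipation_le[OF T] by simp
qed

text \<open>After integrating (s v_p)' the critical term is \<integral> v_p w. It is an average over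
  the rates q of \<integral> v_p v_q, and the cross identity bounds each of these by quantities
  whose integral over q does not depend on \<open>T\<close>.\<close>

theorem square_integral_bounded: "\<exists>C. \<forall>T\<ge>0. integral {0..T} (\<lambda>t. (s t)\<^sup>2) \<le> C"
proof (intro exI allI impI)
  \<comment> \<open>The final bound is built from these numbers, which are fixed before
    \<open>T\<close>.\<close>
  define \<kappa> where "\<kappa> = (\<integral>q. 1 / (1 + R q) \<partial>\<nu>)"
  define Z where "Z = {q \<in> space \<nu>. 1 \<le> R q \<and> R q \<le> 2}"
  define L where "L = 1 / 2 + 1 / measure \<nu> Z"
  fix T :: real assume T: "T \<ge> 0"
  obtain p where p: "p \<in> space \<nu>" "1 \<le> R p" "R p \<le> 2" "dissipation T p \<le> 1 / measure \<nu> Z"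
    using exists_small_dissipation[OF T] by (auto simp: Z_def)
  let ?v = "\<lambda>q. relax s (R q)"
  note cs = continuous_intros continuous_intros_sw
  have vT: "\<bar>?v p T\<bar> \<le> 1"
  proof -
    have "1 * \<bar>?v p T\<bar> \<le> R p * \<bar>?v p T\<bar>" using p by (intro mult_right_mono) auto
    also have "\<dots> \<le> 1"
      using abs_relax_le(2)[OF cont_s, of "R p" T T 1] p T abs_s_le_1 by auto
    finally show ?thesis by simp
  qed
  then have vT2: "(?v p T)\<^sup>2 \<le> 1" by (simp add: abs_square_le_1)
  \<comment> \<open>\<open>L\<close> is the stored energy, at most 1/2, plus the dissipation at the
    chosen rate.\<close>
  have sv: "integral {0..T} (\<lambda>t. s t * ?v p t) \<le> L"
    using relax_energy[OF cont_s T, of "R p"] p vT2 by (simp add: dissipation_def L_def)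
  have cross: "integral {0..T} (\<lambda>t. ?v p t * ?v q t) \<le>
      (?v q T)\<^sup>2 + dissipation T q + (L + 1 / 2) * (1 / (1 + R q))" if q: "q \<in> space \<nu>" for q
  proof -
    have Rq: "R q \<ge> 0" using R_nonneg[OF q] .
    have "- (?v p T * ?v q T) \<le> (?v p T)\<^sup>2 / 2 + (?v q T)\<^sup>2 / 2"
      using zero_le_power2[of "?v p T + ?v q T"] by (simp add: power2_sum)
    then have "(R p + R q) * integral {0..T} (\<lambda>t. ?v p t * ?v q t) \<le>
                (?v q T)\<^sup>2 + dissipation T q + (L + 1 / 2)" (is "_ \<le> ?r")
      using relax_cross[OF cont_s T, of "R p" "R q"] relax_energy[OF cont_s T, of "R q"] sv vT2
      unfolding dissipation_def by linarith
    then have "integral {0..T} (\<lambda>t. ?v p t * ?v q t) \<le> ?r / (R p + R q)"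
      using p Rq by (simp add: field_simps)
    \<comment> \<open>Here \<open>R p\<close> being at least 1 is used: the constant part of
      \<open>?r\<close> alone is not known to be integrable over q, but becomes so after division by
      1 + R q.\<close>
    also have "\<dots> \<le> ?r / (1 + R q)"
      using p Rq dissipation_nonneg[OF q, of T] by (intro divide_left_mono) (auto simp: L_def)
    also have "\<dots> = ((?v q T)\<^sup>2 + dissipation T q) * (1 / (1 + R q)) + (L + 1 / 2) * (1 / (1 + R q))"
      by (simp add: add_divide_distrib)
    also have "\<dots> \<le> ((?v q T)\<^sup>2 + dissipation T q) * 1 + (L + 1 / 2) * (1 / (1 + R q))"
      using Rq dissipation_nonneg[OF q, of T] by (intro add_right_mono mult_left_mono) auto
    finally show ?thesis by simp
  qed
  note E = energy_balance(1,2)[OF T]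
  have [measurable]: "?v p \<in> borel_measurable borel" by measurable
  have "integral {0..T} (\<lambda>t. ?v p t * w t) = (\<integral>q. integral {0..T} (\<lambda>t. ?v p t * ?v q t) \<partial>\<nu>)"
    by (intro integral_w_swap T cs) measurable
  also have "\<dots> \<le> (\<integral>q. (?v q T)\<^sup>2 + dissipation T q + (L + 1 / 2) * (1 / (1 + R q)) \<partial>\<nu>)"
    by (intro Bochner_Integration.integral_mono integral_w_swap T cs cross
        Bochner_Integration.integrable_add E integrable_mult_right integrable_R) auto
  also have "\<dots> = (\<integral>q. (?v q T)\<^sup>2 \<partial>\<nu>) + (\<integral>q. dissipation T q \<partial>\<nu>) + (L + 1 / 2) * \<kappa>"
    unfolding \<kappa>_def using E integrable_mult_right[OF integrable_R, of "L + 1 / 2"]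
    by (simp only: Bochner_Integration.integral_add Bochner_Integration.integrable_add
        integral_mult_right_zero)
  finally have vw: "integral {0..T} (\<lambda>t. ?v p t * w t) \<le> 3 / 2 + (L + 1 / 2) * \<kappa>"
    using integral_relax_le[OF T] integral_dissipation_le[OF T] by simp
  have "integral {0..T} (\<lambda>t. - w t * ?v p t) + integral {0..T} (\<lambda>t. s t * (s t - R p * ?v p t)) =
          s T * ?v p T - s 0 * ?v p 0"
    using T by (intro integral_derivative_product DERIV_s DERIV_relax cs) (auto intro: cont_s)
  also have "(\<lambda>t. s t * (s t - R p * ?v p t)) = (\<lambda>t. (s t)\<^sup>2 - R p * (s t * ?v p t))"
    by (simp add: fun_eq_iff algebra_simps power2_eq_square)
  also have "integral {0..T} \<dots> =
      integral {0..T} (\<lambda>t. (s t)\<^sup>2) - R p * integral {0..T} (\<lambda>t. s t * ?v p t)"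
    by (subst Henstock_Kurzweil_Integration.integral_diff)
       (auto intro!: integrable_continuous_interval cs)
  finally have "integral {0..T} (\<lambda>t. (s t)\<^sup>2) = s T * ?v p T + integral {0..T} (\<lambda>t. ?v p t * w t)
      + R p * integral {0..T} (\<lambda>t. s t * ?v p t)"
    by (simp add: mult.commute relax_0[OF cont_s])
  moreover have "s T * ?v p T \<le> 1"
  proof -
    have "s T * ?v p T \<le> \<bar>s T\<bar> * \<bar>?v p T\<bar>" by (metis abs_ge_self abs_mult)
    also have "\<dots> \<le> 1 * 1" using abs_s_le_1[OF T] vT by (intro mult_mono) auto
    finally show ?thesis by simp
  qed
  moreover have "R p * integral {0..T} (\<lambda>t. s t * ?v p t) \<le> 2 * L"
  proof -
    have "R p * integral {0..T} (\<lambda>t. s t * ?v p t) \<le> R p * L" using sv p by (intro mult_left_mono) auto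
    also have "\<dots> \<le> 2 * L" using p by (intro mult_right_mono) (auto simp: L_def)
    finally show ?thesis .
  qed
  ultimately show "integral {0..T} (\<lambda>t. (s t)\<^sup>2) \<le> 1 + (3 / 2 + (L + 1 / 2) * \<kappa>) + 2 * L"
    using vw by linarith
qed

end

section \<open>The Mittag-Leffler function\<close>

text \<open>The two-parameter function. The resolvent has \<open>b = 1\<close>, its derivative has
  \<open>b = \<rho>\<close>, and fractional integration of order a moves \<open>b = 1\<close> to
  \<open>b = a + 1\<close>.\<close>

definition mittag_leffler :: "real \<Rightarrow> real \<Rightarrow> real \<Rightarrow> real" where
  "mittag_leffler \<rho> b x = (\<Sum>k. x ^ k / Gamma (\<rho> * real k + b))"

lemma Gamma_plus1_pos: "Gamma (z + 1) = z * Gamma z" if "z > 0" for z :: real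
  using that by (intro Gamma_plus1) (auto dest: nonpos_Ints_nonpos)

text \<open>Ratio test. The quotient of successive Gamma values is a Beta value divided by
  \<open>Gamma \<rho>\<close>, and since Beta decreases in its second argument, \<rho> \<ge> 1
  allows comparison with \<open>Beta c 1 = 1 / c\<close>, which tends to 0.\<close>

lemma summable_mittag_leffler:
  fixes x :: real
  assumes "\<rho> \<ge> 1" "b > 0"
  shows "summable (\<lambda>k. x ^ k / Gamma (\<rho> * real k + b))"
proof -
  have "filterlim (\<lambda>k. b + \<rho> * real k) at_top sequentially"
    using assms
    by (intro filterlim_tendsto_add_at_top[OF tendsto_const]
        filterlim_tendsto_pos_mult_at_top[OF tendsto_const _ filterlim_real_sequentially]) auto
  then have "filterlim (\<lambda>k. Gamma \<rho> * (\<rho> * real k + b)) at_top sequentially"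
    using assms Gamma_real_pos[of \<rho>]
    by (intro filterlim_tendsto_pos_mult_at_top[OF tendsto_const]) (auto simp: add.commute)
  then have "(\<lambda>k. \<bar>x\<bar> / (Gamma \<rho> * (\<rho> * real k + b))) \<longlonglongrightarrow> 0"
    by (intro tendsto_divide_0[OF tendsto_const] filterlim_at_top_imp_at_infinity)
  then have "eventually (\<lambda>k. \<bar>x\<bar> / (Gamma \<rho> * (\<rho> * real k + b)) < 1 / 2) sequentially"
    by (rule order_tendstoD) auto
  then obtain N where N: "\<And>k. k \<ge> N \<Longrightarrow> \<bar>x\<bar> / (Gamma \<rho> * (\<rho> * real k + b)) < 1 / 2"
    by (auto simp: eventually_sequentially)
  show ?thesis
  proof (rule summable_ratio_test)
    fix k assume k: "k \<ge> N"
    let ?c = "\<rho> * real k + b"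
    have c: "?c > 0" using assms by (intro add_nonneg_pos) auto
    have "Beta ?c \<rho> \<le> Beta ?c 1" using c assms by (intro Beta_real_mono) auto
    also have "\<dots> = 1 / ?c"
      using c Gamma_plus1_pos[OF c] Gamma_real_pos[OF c, THEN less_imp_neq] by (simp add: Beta_def)
    finally have B: "Beta ?c \<rho> \<le> 1 / ?c" .
    have "Gamma ?c / Gamma (?c + \<rho>) = Beta ?c \<rho> / Gamma \<rho>"
      using assms by (simp add: Beta_def less_imp_neq[OF Gamma_real_pos, symmetric])
    also have "\<dots> \<le> (1 / ?c) / Gamma \<rho>"
      using assms by (intro divide_right_mono B) (simp add: Gamma_real_nonneg)
    finally have g: "Gamma ?c / Gamma (?c + \<rho>) \<le> 1 / (Gamma \<rho> * ?c)" by (simp add: mult.commute)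
    have "1 / Gamma (?c + \<rho>) \<le> 1 / (Gamma \<rho> * ?c) * (1 / Gamma ?c)"
    proof -
      have "1 / Gamma (?c + \<rho>) = Gamma ?c / Gamma (?c + \<rho>) * (1 / Gamma ?c)"
        using Gamma_real_pos[OF c] by simp
      also have "\<dots> \<le> 1 / (Gamma \<rho> * ?c) * (1 / Gamma ?c)"
        using g Gamma_real_pos[OF c] by (intro mult_right_mono) auto
      finally show ?thesis .
    qed
    then have "\<bar>x\<bar> * \<bar>x\<bar> ^ k * (1 / Gamma (?c + \<rho>)) \<le>
        \<bar>x\<bar> * \<bar>x\<bar> ^ k * (1 / (Gamma \<rho> * ?c) * (1 / Gamma ?c))"
      by (intro mult_left_mono) auto
    also have "\<dots> = \<bar>x\<bar> / (Gamma \<rho> * ?c) * (\<bar>x\<bar> ^ k / Gamma ?c)" by simp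
    also have "\<dots> \<le> 1 / 2 * (\<bar>x\<bar> ^ k / Gamma ?c)"
      using N[OF k] c Gamma_real_pos[of ?c] by (intro mult_right_mono) auto
    finally have le: "\<bar>x\<bar> * \<bar>x\<bar> ^ k * (1 / Gamma (?c + \<rho>)) \<le> 1 / 2 * (\<bar>x\<bar> ^ k / Gamma ?c)" .
    show "norm (x ^ Suc k / Gamma (\<rho> * real (Suc k) + b)) \<le> 1 / 2 * norm (x ^ k / Gamma ?c)"
    proof -
      have "norm (x ^ Suc k / Gamma (\<rho> * real (Suc k) + b)) = \<bar>x\<bar> * \<bar>x\<bar> ^ k * (1 / Gamma (?c + \<rho>))"
        using Gamma_real_pos[of "?c + \<rho>"] c assms
        by (simp add: abs_mult power_abs algebra_simps)
      moreover have "norm (x ^ k / Gamma ?c) = \<bar>x\<bar> ^ k / Gamma ?c"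
        using Gamma_real_pos[OF c] by (simp add: power_abs)
      ultimately show ?thesis using le by simp
    qed
  qed simp
qed

lemma isCont_mittag_leffler:
  assumes "\<rho> \<ge> 1" "b > 0"
  shows "isCont (mittag_leffler \<rho> b) x"
  unfolding mittag_leffler_def
  using isCont_powser_converges_everywhere[of "\<lambda>k. 1 / Gamma (\<rho> * real k + b)" x]
    summable_mittag_leffler[OF assms] by simp

lemma mittag_leffler_0: "mittag_leffler \<rho> b 0 = 1 / Gamma b"
  unfolding mittag_leffler_def using powser_zero[of "\<lambda>k. 1 / Gamma (\<rho> * real k + b)"] by simp

text \<open>Split off the first term and shift the index. For \<open>b = 1\<close> and x a negative
  multiple of t^\<rho> this is the Volterra equation in closed form.\<close>

lemma mittag_leffler_rec:
  assumes "\<rho> \<ge> 1" "b > 0"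
  shows "mittag_leffler \<rho> b x = 1 / Gamma b + x * mittag_leffler \<rho> (\<rho> + b) x"
proof -
  have "mittag_leffler \<rho> b x = 1 / Gamma b + (\<Sum>k. x ^ Suc k / Gamma (\<rho> * real (Suc k) + b))"
    unfolding mittag_leffler_def
    by (subst suminf_split_head[OF summable_mittag_leffler[OF assms]]) simp
  also have "(\<lambda>k. x ^ Suc k / Gamma (\<rho> * real (Suc k) + b)) =
      (\<lambda>k. x * (x ^ k / Gamma (\<rho> * real k + (\<rho> + b))))"
    by (simp add: fun_eq_iff algebra_simps)
  also have "(\<Sum>k. \<dots> k) = x * mittag_leffler \<rho> (\<rho> + b) x"
    unfolding mittag_leffler_def using assms
    by (intro suminf_mult summable_mittag_leffler) auto
  finally show ?thesis .
qed

text \<open>In the differentiated series the factor k + 1 cancels against Gamma(\<rho> (k + 1) + 1)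
  by the functional equation, leaving 1 / \<rho> and the shifted parameter.\<close>

lemma DERIV_mittag_leffler:
  assumes "\<rho> \<ge> 1"
  shows "(mittag_leffler \<rho> 1 has_real_derivative mittag_leffler \<rho> \<rho> x / \<rho>) (at x)"
proof -
  let ?c = "\<lambda>k. 1 / Gamma (\<rho> * real k + 1)"
  have "((\<lambda>x. \<Sum>k. ?c k * x ^ k) has_real_derivative (\<Sum>k. diffs ?c k * x ^ k)) (at x)"
    using summable_mittag_leffler[OF assms, of 1]
    by (intro termdiffs_strong_converges_everywhere) simp
  moreover have "diffs ?c k * x ^ k = x ^ k / Gamma (\<rho> * real k + \<rho>) / \<rho>" for k
  proof -
    have "\<rho> * real k + \<rho> > 0" using assms by (intro add_nonneg_pos) auto
    then have "Gamma (\<rho> * real (Suc k) + 1) = \<rho> * (real k + 1) * Gamma (\<rho> * real k + \<rho>)"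
      using Gamma_plus1_pos[of "\<rho> * real k + \<rho>"] by (simp add: algebra_simps)
    moreover have "real k + 1 \<noteq> 0" by simp
    ultimately show ?thesis using assms
      by (simp del: of_nat_Suc add: diffs_def) (simp add: add.commute)
  qed
  ultimately show ?thesis
    using suminf_divide[OF summable_mittag_leffler[of \<rho> \<rho> x], of \<rho>] assms
    by (simp add: mittag_leffler_def[abs_def])
qed

section \<open>Fractional integrals of powers and of the Mittag-Leffler series\<close>

lemma frac_kernel_power_integral:
  assumes "a > 0" "b > - 1" "t > 0"
  shows "has_bochner_integral lborel (\<lambda>u. indicator {0..t} u * (frac_kernel a (t - u) * u powr b))
           (t powr (a + b) * Gamma (b + 1) / Gamma (a + b + 1))"
proof -
  let ?f = "\<lambda>x. x powr b * (1 - x) powr (a - 1)"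
  have "set_integrable lborel {0..1} ?f" using integrable_Beta[of "b + 1" a] assms by simp
  moreover have "(LBINT x:{0..1}. ?f x) = Beta (b + 1) a"
    using set_borel_integral_eq_integral(2)[OF \<open>set_integrable lborel {0..1} ?f\<close>]
      has_integral_Beta_real[of "b + 1" a] assms by (simp add: integral_unique)
  ultimately have "has_bochner_integral lborel (\<lambda>x. indicator {0..1} x * ?f x) (Beta (b + 1) a)"
    by (simp add: has_bochner_integral_iff set_integrable_def set_lebesgue_integral_def)
  then have "has_bochner_integral lborel
      (\<lambda>x. t powr (a + b - 1) / Gamma a * (indicator {0..1} x * ?f x))
      (t powr (a + b - 1) / Gamma a * Beta (b + 1) a)"
    by (intro has_bochner_integral_mult_right)
  also have "(\<lambda>x. t powr (a + b - 1) / Gamma a * (indicator {0..1} x * ?f x)) =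
      (\<lambda>x. indicator {0..t} (0 + t * x) * (frac_kernel a (t - (0 + t * x)) * (0 + t * x) powr b))"
  proof
    fix x :: real
    show "t powr (a + b - 1) / Gamma a * (indicator {0..1} x * ?f x) =
      indicator {0..t} (0 + t * x) * (frac_kernel a (t - (0 + t * x)) * (0 + t * x) powr b)"
    proof (cases "0 \<le> x \<and> x \<le> 1")
      case True
      have "t - t * x = t * (1 - x)" by (simp add: algebra_simps)
      moreover have "t powr (a + b - 1) = t powr (a - 1) * t powr b"
        by (simp flip: powr_add add: algebra_simps)
      ultimately show ?thesis
        using True assms by (simp add: frac_kernel_def powr_mult indicator_def mult_le_cancel_left1)
    next
      case False
      then have "t * x \<notin> {0..t}" using assms by (auto simp: zero_le_mult_iff mult_le_cancel_left1)
      then show ?thesis using False by (auto simp: indicator_def)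
    qed
  qed
  also have "t powr (a + b - 1) / Gamma a * Beta (b + 1) a =
      (t powr (a + b) * Gamma (b + 1) / Gamma (a + b + 1)) /\<^sub>R \<bar>t\<bar>"
    using assms Gamma_real_pos[OF assms(1), THEN less_imp_neq]
    by (simp add: Beta_def powr_diff field_simps add_ac)
  finally show ?thesis
    using lborel_has_bochner_integral_real_affine_iff[of t
        "\<lambda>u. indicator {0..t} u * (frac_kernel a (t - u) * u powr b)" _ 0] assms by simp
qed

text \<open>
  The power is written \<open>(u powr \<rho>) ^ k\<close> and not \<open>u powr (\<rho> * k)\<close> because the latter is \<open>0\<close>
  at \<open>u = 0\<close> also for \<open>k = 0\<close>.
\<close>
lemma frac_kernel_powser_integral:
  assumes "a > 0" "\<rho> > 0" "t > 0"
  shows "has_bochner_integral lborel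
           (\<lambda>u. indicator {0..t} u * (frac_kernel a (t - u) * (u powr \<rho>) ^ k))
           (t powr a * (t powr \<rho>) ^ k * Gamma (\<rho> * real k + 1) / Gamma (\<rho> * real k + (a + 1)))"
proof -
  have pw: "(u powr \<rho>) ^ k = u powr (\<rho> * real k)" if "u > 0" for u
    using that powr_realpow[of "u powr \<rho>" k] by (simp add: powr_powr)
  have "\<rho> * real k > -1" using assms by (smt (verit) mult_nonneg_nonneg of_nat_0_le_iff)
  note * = frac_kernel_power_integral[OF assms(1) this assms(3)]
  have "t powr (a + \<rho> * real k) = t powr a * (t powr \<rho>) ^ k"
    using assms by (simp only: pw powr_add)
  then have "has_bochner_integral lborel
           (\<lambda>u. indicator {0..t} u * (frac_kernel a (t - u) * u powr (\<rho> * real k)))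
           (t powr a * (t powr \<rho>) ^ k * Gamma (\<rho> * real k + 1) / Gamma (\<rho> * real k + (a + 1)))"
    using * by (simp only: add_ac)
  moreover have "AE u in lborel. indicator {0..t} u * (frac_kernel a (t - u) * u powr (\<rho> * real k)) =
       indicator {0..t} u * (frac_kernel a (t - u) * (u powr \<rho>) ^ k)"
      using AE_lborel_singleton[of 0]
      by eventually_elim (auto simp: indicator_def pw)
  ultimately show ?thesis
    by (subst (asm) has_bochner_integral_cong_AE) (simp_all add: frac_kernel_def)
qed

text \<open>Termwise integration. The absolute values of the terms form the same kind of series with
  \<open>\<bar>c\<bar>\<close> for \<open>c\<close>, so its convergence justifies the interchange.
  Order \<open>a = \<rho>\<close> yields the Volterra equation, order \<open>a = \<rho> - 1\<close>
  the derivative of the resolvent.\<close>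

lemma frac_integral_mittag_leffler:
  assumes "a > 0" "\<rho> \<ge> 1" "t \<ge> 0"
  shows "set_integrable lborel {0..t} (\<lambda>u. frac_kernel a (t - u) * mittag_leffler \<rho> 1 (c * u powr \<rho>))"
    and "(LBINT u:{0..t}. frac_kernel a (t - u) * mittag_leffler \<rho> 1 (c * u powr \<rho>)) =
           t powr a * mittag_leffler \<rho> (a + 1) (c * t powr \<rho>)"
proof -
  let ?I = "\<lambda>u. frac_kernel a (t - u) * mittag_leffler \<rho> 1 (c * u powr \<rho>)"
  have "set_integrable lborel {0..t} ?I \<and>
    (LBINT u:{0..t}. ?I u) = t powr a * mittag_leffler \<rho> (a + 1) (c * t powr \<rho>)"
  proof (cases "t = 0")
    case True
    have *: "(\<lambda>u::real. indicator {0} u * f u) = (\<lambda>u. f 0 * indicator {0} u)" for f :: "real \<Rightarrow> real"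
      by (auto simp: indicator_def)
    show ?thesis using True assms by (simp add: set_integrable_def set_lebesgue_integral_def *)
  next
    case False
    then have t: "t > 0" using assms by simp
    define f where "f = (\<lambda>k u. c ^ k / Gamma (\<rho> * real k + 1) *
      (indicator {0..t} u * (frac_kernel a (t - u) * (u powr \<rho>) ^ k)))"
    define J where "J k = t powr a * (t powr \<rho>) ^ k / Gamma (\<rho> * real k + (a + 1))" for k
    have G: "Gamma (\<rho> * real k + 1) > 0" "Gamma (\<rho> * real k + (a + 1)) > 0" for k
      using assms by (auto intro!: Gamma_real_pos add_nonneg_pos)
    have fb: "has_bochner_integral lborel (f k) (c ^ k * J k)" for k
      using has_bochner_integral_mult_right[OF frac_kernel_powser_integral[OF assms(1) _ t, of \<rho> k],
          of "c ^ k / Gamma (\<rho> * real k + 1)"] assms G[of k]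
      by (simp add: f_def J_def mult.assoc[symmetric])
    have nf: "norm (f k u) = \<bar>c\<bar> ^ k / Gamma (\<rho> * real k + 1) *
      (indicator {0..t} u * (frac_kernel a (t - u) * (u powr \<rho>) ^ k))" for k u
      using G[of k] Gamma_real_pos[OF assms(1)]
      by (simp add: f_def abs_mult power_abs frac_kernel_def)
    have nfb: "has_bochner_integral lborel (\<lambda>u. norm (f k u)) (\<bar>c\<bar> ^ k * J k)" for k
      unfolding nf
      using has_bochner_integral_mult_right[OF frac_kernel_powser_integral[OF assms(1) _ t, of \<rho> k],
          of "\<bar>c\<bar> ^ k / Gamma (\<rho> * real k + 1)"] assms G[of k]
      by (simp add: J_def mult.assoc[symmetric])
    have sums: "(\<lambda>k. c ^ k * J k) sums (t powr a * mittag_leffler \<rho> (a + 1) (c * t powr \<rho>))" for c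
      using sums_mult[OF summable_sums[OF summable_mittag_leffler[of \<rho> "a + 1" "c * t powr \<rho>"]],
          of "t powr a"] assms
      by (simp add: J_def mittag_leffler_def power_mult_distrib mult_ac)
    have fsum: "(\<lambda>k. f k u) sums (indicator {0..t} u * ?I u)" for u
      using sums_mult[OF summable_sums[OF summable_mittag_leffler[of \<rho> 1 "c * u powr \<rho>"]],
          of "indicator {0..t} u * frac_kernel a (t - u)"] assms
      by (simp add: f_def mittag_leffler_def power_mult_distrib mult_ac)
    have 1: "AE u in lborel. summable (\<lambda>k. norm (f k u))"
    proof (rule AE_I2)
      fix u :: real
      show "summable (\<lambda>k. norm (f k u))"
        using summable_mult[OF summable_mittag_leffler[of \<rho> 1 "\<bar>c\<bar> * u powr \<rho>"],
          of "indicator {0..t} u * frac_kernel a (t - u)"] assms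
        unfolding nf by (simp add: power_mult_distrib mult_ac)
    qed
    have 2: "summable (\<lambda>k. \<integral>u. norm (f k u) \<partial>lborel)"
      using sums[of "\<bar>c\<bar>"] nfb by (simp add: has_bochner_integral_iff sums_iff)
    have 3: "\<And>k. integrable lborel (f k)" using fb by (simp add: has_bochner_integral_iff)
    have "integrable lborel (\<lambda>u. indicator {0..t} u * ?I u)"
      using integrable_suminf[OF 3 1 2] fsum by (simp add: sums_iff)
    moreover have "(\<lambda>k. \<integral>u. f k u \<partial>lborel) sums (\<integral>u. indicator {0..t} u * ?I u \<partial>lborel)"
      using sums_integral[OF 3 1 2] fsum by (simp add: sums_iff)
    then have "(\<lambda>k. c ^ k * J k) sums (\<integral>u. indicator {0..t} u * ?I u \<partial>lborel)"
      using fb by (simp add: has_bochner_integral_iff)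
    ultimately show ?thesis
      using sums[of c] by (simp add: set_integrable_def set_lebesgue_integral_def sums_iff)
  qed
  then show "set_integrable lborel {0..t} ?I" "(LBINT u:{0..t}. ?I u) =
           t powr a * mittag_leffler \<rho> (a + 1) (c * t powr \<rho>)" by blast+
qed

section \<open>The scalar resolvent\<close>

lemma continuous_on_mittag_leffler_powr:
  assumes "\<rho> \<ge> 1" "b > 0"
  shows "continuous_on {0..} (\<lambda>t. mittag_leffler \<rho> b (c * t powr \<rho>))"
proof -
  have "continuous_on UNIV (mittag_leffler \<rho> b)"
    using isCont_mittag_leffler[OF assms] by (simp add: continuous_at_imp_continuous_on)
  then show ?thesis
  proof (rule continuous_on_compose2)
    show "continuous_on {0..} (\<lambda>t. c * t powr \<rho>)"
      using assms by (intro continuous_intros continuous_on_powr') auto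
  qed simp
qed

lemma is_scalar_resolvent_mittag_leffler:
  assumes "\<rho> > 1"
  shows "is_scalar_resolvent \<rho> \<alpha> (\<lambda>t. mittag_leffler \<rho> 1 (- \<alpha> * t powr \<rho>))"
  unfolding is_scalar_resolvent_def
proof (intro conjI allI impI)
  show "continuous_on {0..} (\<lambda>t. mittag_leffler \<rho> 1 (- \<alpha> * t powr \<rho>))"
    using assms by (intro continuous_on_mittag_leffler_powr) auto
  fix t :: real assume "t \<ge> 0"
  then show "mittag_leffler \<rho> 1 (- \<alpha> * t powr \<rho>) +
      \<alpha> * (LBINT \<tau>:{0..t}. frac_kernel \<rho> (t - \<tau>) * mittag_leffler \<rho> 1 (- \<alpha> * \<tau> powr \<rho>)) = 1"
    using frac_integral_mittag_leffler(2)[of \<rho> \<rho> t "- \<alpha>"] assms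
      mittag_leffler_rec[of \<rho> 1 "- \<alpha> * t powr \<rho>"]
    by simp
qed

lemma continuous_on_frac_kernel:
  assumes "\<rho> > 1"
  shows "continuous_on {a..t} (\<lambda>u. frac_kernel \<rho> (t - u))"
  unfolding frac_kernel_def using assms
  by (auto intro!: continuous_intros continuous_on_powr' simp: less_imp_neq[OF Gamma_real_pos, symmetric])

text \<open>Picard iteration: inserting a bound of order t^k / k! into the equation gains one more
  factor t / (k + 1), and the resulting exponential terms tend to 0.\<close>

lemma volterra_homogeneous_eq_0:
  assumes \<rho>: "\<rho> > 1" and d: "continuous_on {0..} d"
    and eq: "\<And>t. t \<ge> 0 \<Longrightarrow> d t = \<alpha> * (LBINT \<tau>:{0..t}. frac_kernel \<rho> (t - \<tau>) * d \<tau>)"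
    and T: "T \<ge> 0"
  shows "d T = 0"
proof -
  \<comment> \<open>For \<rho> > 1 the kernel is increasing, so its value at \<open>T\<close> is its
    maximum on the interval.\<close>
  define M where "M = frac_kernel \<rho> T"
  have G: "Gamma \<rho> > 0" using \<rho> by (intro Gamma_real_pos) auto
  have M0: "M \<ge> 0" using G by (simp add: M_def frac_kernel_def)
  have g: "0 \<le> frac_kernel \<rho> (t - u)" "frac_kernel \<rho> (t - u) \<le> M"
    if "0 \<le> u" "u \<le> t" "t \<le> T" for u t
    using that \<rho> G unfolding M_def frac_kernel_def
    by (auto intro!: divide_right_mono powr_mono2)
  have "bounded (d ` {0..T})"
    by (intro compact_imp_bounded compact_continuous_image continuous_on_subset[OF d]) auto
  then obtain B where B: "\<And>t. 0 \<le> t \<Longrightarrow> t \<le> T \<Longrightarrow> \<bar>d t\<bar> \<le> B" by (force simp: bounded_iff)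
  have bound: "\<bar>d t\<bar> \<le> B * (\<bar>\<alpha>\<bar> * M * t) ^ k / fact k" if "0 \<le> t" "t \<le> T" for t k
    using that
  proof (induction k arbitrary: t)
    case 0
    then show ?case using B by simp
  next
    case (Suc k)
    let ?h = "\<lambda>u. M * (B * (\<bar>\<alpha>\<bar> * M) ^ k / fact k) * u ^ k"
    have "((\<lambda>u. M * (B * (\<bar>\<alpha>\<bar> * M) ^ k / fact k) * u ^ k) has_integral
        M * (B * (\<bar>\<alpha>\<bar> * M) ^ k / fact k) * (t ^ Suc k / (1 + real k))) {0..t}"
    proof (intro has_integral_mult_right)
      have "((\<lambda>u. u ^ k) has_integral t ^ Suc k / (1 + real k) - 0 ^ Suc k / (1 + real k)) {0..t}"
        using Suc.prems
        by (intro fundamental_theorem_of_calculus)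
           (auto intro!: derivative_eq_intros simp del: power_Suc
             simp flip: has_real_derivative_iff_has_vector_derivative)
      then show "((\<lambda>u. u ^ k) has_integral t ^ Suc k / (1 + real k)) {0..t}" by simp
    qed
    then have h: "integral {0..t} ?h = M * (B * (\<bar>\<alpha>\<bar> * M) ^ k / fact k) * (t ^ Suc k / (1 + real k))"
      by (rule integral_unique)
    have "norm (integral {0..t} (\<lambda>u. frac_kernel \<rho> (t - u) * d u)) \<le> integral {0..t} ?h"
    proof (intro integral_norm_bound_integral integrable_continuous_interval continuous_intros
        continuous_on_frac_kernel[OF \<rho>] continuous_on_subset[OF d])
      fix u assume u: "u \<in> {0..t}"
      have "norm (frac_kernel \<rho> (t - u) * d u) = frac_kernel \<rho> (t - u) * \<bar>d u\<bar>"
        using g[of u t] u Suc.prems by (simp add: abs_mult)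
      also have "\<dots> \<le> M * (B * (\<bar>\<alpha>\<bar> * M * u) ^ k / fact k)"
        using g[of u t] u Suc M0 by (intro mult_mono) auto
      also have "\<dots> = ?h u" by (simp add: power_mult_distrib)
      finally show "norm (frac_kernel \<rho> (t - u) * d u) \<le> ?h u" .
    qed auto
    moreover have "(LBINT u:{0..t}. frac_kernel \<rho> (t - u) * d u) =
        integral {0..t} (\<lambda>u. frac_kernel \<rho> (t - u) * d u)"
      by (intro LBINT_eq_integral_continuous continuous_intros continuous_on_frac_kernel[OF \<rho>]
          continuous_on_subset[OF d]) auto
    ultimately have "\<bar>d t\<bar> \<le> \<bar>\<alpha>\<bar> * integral {0..t} ?h"
      using eq[OF Suc.prems(1)] by (simp only: abs_mult real_norm_def mult_left_mono abs_ge_zero)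
    also have "\<dots> = \<bar>\<alpha>\<bar> * (M * (B * (\<bar>\<alpha>\<bar> * M) ^ k / fact k) * (t ^ Suc k / (1 + real k)))"
      by (simp only: h)
    also have "\<dots> = B * (\<bar>\<alpha>\<bar> * M * t) ^ Suc k / fact (Suc k)"
      by (simp add: power_mult_distrib mult_ac)
    finally show ?case .
  qed
  have "(\<lambda>k. B * (inverse (fact k) * (\<bar>\<alpha>\<bar> * M * T) ^ k)) \<longlonglongrightarrow> B * 0"
    by (intro tendsto_mult tendsto_const summable_LIMSEQ_zero summable_exp)
  then have "(\<lambda>k. B * (\<bar>\<alpha>\<bar> * M * T) ^ k / fact k) \<longlonglongrightarrow> 0"
    by (simp add: divide_inverse mult_ac)
  then have "\<bar>d T\<bar> \<le> 0"
    by (rule LIMSEQ_le_const) (use bound[of T] T in auto)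
  then show ?thesis by simp
qed

lemma is_scalar_resolvent_unique:
  assumes \<rho>: "\<rho> > 1" and "is_scalar_resolvent \<rho> \<alpha> s" "is_scalar_resolvent \<rho> \<alpha> s'" and t: "t \<ge> 0"
  shows "s t = s' t"
proof -
  have c: "continuous_on {0..} s" "continuous_on {0..} s'"
    and eq: "\<And>t. t \<ge> 0 \<Longrightarrow> s t + \<alpha> * (LBINT \<tau>:{0..t}. frac_kernel \<rho> (t - \<tau>) * s \<tau>) = 1"
      "\<And>t. t \<ge> 0 \<Longrightarrow> s' t + \<alpha> * (LBINT \<tau>:{0..t}. frac_kernel \<rho> (t - \<tau>) * s' \<tau>) = 1"
    using assms by (auto simp: is_scalar_resolvent_def)
  have si: "set_integrable lborel {0..t} (\<lambda>u. frac_kernel \<rho> (t - u) * f u)"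
    if "continuous_on {0..} f" for f :: "real \<Rightarrow> real" and t
    by (intro borel_integrable_atLeastAtMost' continuous_intros continuous_on_frac_kernel[OF \<rho>]
        continuous_on_subset[OF that]) auto
  have "s t - s' t = 0"
  proof (rule volterra_homogeneous_eq_0[OF \<rho> _ _ t, of _ "- \<alpha>"])
    show "continuous_on {0..} (\<lambda>t. s t - s' t)" by (intro continuous_intros c)
    fix t :: real assume t: "t \<ge> 0"
    let ?I = "\<lambda>f. LBINT u:{0..t}. frac_kernel \<rho> (t - u) * f u"
    have "?I (\<lambda>u. s u - s' u) = ?I s - ?I s'"
      unfolding right_diff_distrib by (intro set_integral_diff si c)
    moreover have "s t = 1 - \<alpha> * ?I s" "s' t = 1 - \<alpha> * ?I s'"
      using eq(1)[OF t] eq(2)[OF t] by linarith+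
    moreover have "x - y = - \<alpha> * i" if "i = a - b" "x = 1 - \<alpha> * a" "y = 1 - \<alpha> * b" for x y i a b :: real
      by (simp add: that right_diff_distrib)
    ultimately show "s t - s' t = - \<alpha> * ?I (\<lambda>u. s u - s' u)" by blast
  qed
  then show ?thesis by simp
qed

lemma scalar_resolvent_eqI:
  assumes "\<rho> > 1" "is_scalar_resolvent \<rho> \<alpha> s" "t \<ge> 0"
  shows "scalar_resolvent \<rho> \<alpha> t = s t"
  unfolding scalar_resolvent_def
proof (rule the_equality)
  show "\<exists>s'. is_scalar_resolvent \<rho> \<alpha> s' \<and> s' t = s t" using assms by blast
  show "y = s t" if "\<exists>s'. is_scalar_resolvent \<rho> \<alpha> s' \<and> s' t = y" for y
    using that is_scalar_resolvent_unique[OF assms(1) _ assms(2,3)] by blast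
qed

lemma scalar_resolvent_eq:
  assumes "\<rho> > 1" "t \<ge> 0"
  shows "scalar_resolvent \<rho> \<alpha> t = mittag_leffler \<rho> 1 (- \<alpha> * t powr \<rho>)"
  by (rule scalar_resolvent_eqI[OF assms(1) is_scalar_resolvent_mittag_leffler[OF assms(1)] assms(2)])

text \<open>The kernel of order 2 is t - u; the cosine is checked against the equation itself, and
  uniqueness does the rest without a comparison of power series.\<close>

lemma scalar_resolvent_2:
  assumes "\<alpha> > 0" "t \<ge> 0"
  shows "scalar_resolvent 2 \<alpha> t = cos (sqrt \<alpha> * t)"
proof (rule scalar_resolvent_eqI)
  show "is_scalar_resolvent 2 \<alpha> (\<lambda>t. cos (sqrt \<alpha> * t))"
    unfolding is_scalar_resolvent_def
  proof (intro conjI allI impI)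
    show "continuous_on {0..} (\<lambda>t. cos (sqrt \<alpha> * t))" by (intro continuous_intros)
    fix t :: real assume t: "t \<ge> 0"
    define a where "a = sqrt \<alpha>"
    have a: "a > 0" "a * a = \<alpha>" using assms by (auto simp: a_def)
    have "(LBINT u:{0..t}. frac_kernel 2 (t - u) * cos (a * u)) = (LBINT u:{0..t}. (t - u) * cos (a * u))"
      by (intro set_lebesgue_integral_cong) (auto simp: frac_kernel_def Gamma_numeral)
    also have "\<dots> = integral {0..t} (\<lambda>u. (t - u) * cos (a * u))"
      by (intro LBINT_eq_integral_continuous continuous_intros)
    \<comment> \<open>The antiderivative comes from one integration by parts.\<close>
    also have "((\<lambda>u. (t - u) * cos (a * u)) has_integral
       ((t - t) * sin (a * t) / a - cos (a * t) / a\<^sup>2) - ((t - 0) * sin (a * 0) / a - cos (a * 0) / a\<^sup>2)) {0..t}"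
      using t a by (intro fundamental_theorem_of_calculus)
         (auto intro!: derivative_eq_intros
             simp: field_simps power2_eq_square simp flip: has_real_derivative_iff_has_vector_derivative)
    then have "integral {0..t} (\<lambda>u. (t - u) * cos (a * u)) = (1 - cos (a * t)) / a\<^sup>2"
      using a by (simp add: integral_unique field_simps)
    finally show "cos (sqrt \<alpha> * t) + \<alpha> * (LBINT u:{0..t}. frac_kernel 2 (t - u) * cos (sqrt \<alpha> * u)) = 1"
      using a assms by (simp add: power2_eq_square flip: a_def)
  qed
qed (use assms in auto)

section \<open>Square integrability of the resolvent for orders below two\<close>

text \<open>Euler's integral after the substitution t = x r. It supplies both the Laplace
  representation of the kernel and the moments of the Gamma density.\<close>

lemma has_bochner_integral_Gamma:
  fixes a x :: real
  assumes "a > 0" "x > 0"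
  shows "has_bochner_integral lborel (\<lambda>r. indicator {0..} r * (r powr (a - 1) * exp (- x * r)))
           (Gamma a * x powr (- a))"
proof -
  define f where "f = (\<lambda>t::real. indicator {0..} t * t powr (a - 1) / exp t)"
  have "has_bochner_integral lborel f (Gamma a)"
    using Gamma_conv_nn_integral_real[OF assms(1)] assms Gamma_real_pos[of a]
    by (intro has_bochner_integral_nn_integral) (auto simp: f_def)
  then have "has_bochner_integral lborel (\<lambda>r. f (0 + x * r)) (Gamma a /\<^sub>R \<bar>x\<bar>)"
    using lborel_has_bochner_integral_real_affine_iff[of x f "Gamma a" 0] assms by simp
  then have "has_bochner_integral lborel (\<lambda>r. x powr (1 - a) * f (0 + x * r))
      (x powr (1 - a) * (Gamma a /\<^sub>R \<bar>x\<bar>))"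
    by (rule has_bochner_integral_mult_right)
  also have "(\<lambda>r. x powr (1 - a) * f (0 + x * r)) =
      (\<lambda>r. indicator {0..} r * (r powr (a - 1) * exp (- x * r)))"
  proof
    fix r :: real
    have "x powr (1 - a) * (x powr (a - 1)) = 1" using assms by (simp flip: powr_add)
    then have "r \<ge> 0 \<Longrightarrow> x powr (1 - a) * (x * r) powr (a - 1) = r powr (a - 1)"
      using assms by (simp add: powr_mult mult.assoc[symmetric])
    then show "x powr (1 - a) * f (0 + x * r) = indicator {0..} r * (r powr (a - 1) * exp (- x * r))"
      using assms by (simp add: f_def indicator_def exp_minus zero_le_mult_iff field_simps)
  qed
  also have "x powr (1 - a) * (Gamma a /\<^sub>R \<bar>x\<bar>) = Gamma a * x powr (- a)"
    using assms by (simp add: powr_diff powr_minus field_simps)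
  finally show ?thesis .
qed

context
  fixes \<rho> :: real
  assumes \<rho>: "1 < \<rho>" "\<rho> < 2"
begin

text \<open>The constant is the one for which \<open>relax_density\<close> has the Laplace transform \<open>frac_kernel (\<rho> - 1)\<close>.\<close>
definition relax_density :: "real \<Rightarrow> real" where
  "relax_density r = indicator {0..} r * (r powr (1 - \<rho>) / (Gamma (\<rho> - 1) * Gamma (2 - \<rho>)))"

lemma relax_density_measurable [measurable]: "relax_density \<in> borel_measurable borel"
  unfolding relax_density_def[abs_def] by measurable

lemma Gammas_pos: "Gamma (\<rho> - 1) > 0" "Gamma (2 - \<rho>) > 0"
  using \<rho> by (auto intro!: Gamma_real_pos)

lemma relax_density_nonneg [simp]: "relax_density r \<ge> 0"
  using Gammas_pos by (simp add: relax_density_def)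

text \<open>Euler's integral with exponent 2 - \<rho>. The rate is written
  \<open>\<bar>r\<bar>\<close>, equal to \<open>r\<close> wherever the density is nonzero, because
  rates have to be nonnegative on the whole line.\<close>

lemma relax_density_exp:
  assumes "x > 0"
  shows "has_bochner_integral lborel (\<lambda>r. relax_density r * exp (- \<bar>r\<bar> * x)) (frac_kernel (\<rho> - 1) x)"
proof -
  have "has_bochner_integral lborel
      (\<lambda>r. indicator {0..} r * (r powr ((2 - \<rho>) - 1) * exp (- x * r)) / (Gamma (\<rho> - 1) * Gamma (2 - \<rho>)))
      (Gamma (2 - \<rho>) * x powr (- (2 - \<rho>)) / (Gamma (\<rho> - 1) * Gamma (2 - \<rho>)))"
    using assms \<rho> by (intro has_bochner_integral_divide_zero has_bochner_integral_Gamma) auto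
  also have "(\<lambda>r. indicator {0..} r * (r powr ((2 - \<rho>) - 1) * exp (- x * r)) / (Gamma (\<rho> - 1) * Gamma (2 - \<rho>)))
     = (\<lambda>r. relax_density r * exp (- \<bar>r\<bar> * x))"
    by (auto simp: fun_eq_iff relax_density_def indicator_def mult.commute)
  also have "Gamma (2 - \<rho>) * x powr (- (2 - \<rho>)) / (Gamma (\<rho> - 1) * Gamma (2 - \<rho>)) = frac_kernel (\<rho> - 1) x"
    using Gammas_pos by (simp add: frac_kernel_def)
  finally show ?thesis .
qed

text \<open>Near 0 the Laplace transform at 1 is a majorant, the factor \<open>exp 1\<close> coming
  from 1 \<le> exp (1 - r) on the unit interval. Beyond 1 the product is at most a multiple of
  r^(-\<rho>), integrable since \<rho> > 1.\<close>

lemma relax_density_integrable: "integrable lborel (\<lambda>r. relax_density r * (1 / (1 + \<bar>r\<bar>)))"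
proof -
  let ?c = "Gamma (\<rho> - 1) * Gamma (2 - \<rho>)"
  have "((\<lambda>r. r powr (- \<rho>)) has_integral - (1 powr (- \<rho> + 1)) / (- \<rho> + 1)) {1..}"
    using \<rho> by (intro has_integral_powr_to_inf) auto
  then have "(\<integral>\<^sup>+r. ennreal (indicator {1..} r * r powr (- \<rho>)) \<partial>lborel) = ennreal (- (1 powr (- \<rho> + 1)) / (- \<rho> + 1))"
    by (intro nn_integral_has_integral_lebesgue) auto
  then have tail: "integrable lborel (\<lambda>r::real. indicator {1..} r * r powr (- \<rho>))"
    by (intro integrableI_nonneg) auto
  have "integrable lborel (\<lambda>r. exp 1 * (relax_density r * exp (- \<bar>r\<bar> * 1)) + indicator {1..} r * r powr (- \<rho>) / ?c)"
    using relax_density_exp[of 1] tail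
    by (intro Bochner_Integration.integrable_add integrable_mult_right integrable_divide)
       (auto dest: integrable.intros)
  then show ?thesis
  proof (rule Bochner_Integration.integrable_bound)
    show "AE r in lborel. norm (relax_density r * (1 / (1 + \<bar>r\<bar>))) \<le>
       norm (exp 1 * (relax_density r * exp (- \<bar>r\<bar> * 1)) + indicator {1..} r * r powr (- \<rho>) / ?c)"
    proof (rule AE_I2)
      fix r :: real
      have "relax_density r * (1 / (1 + \<bar>r\<bar>)) \<le>
          exp 1 * (relax_density r * exp (- \<bar>r\<bar> * 1)) + indicator {1..} r * r powr (- \<rho>) / ?c"
      proof (cases "r \<ge> 1")
        case True
        have "1 / (1 + \<bar>r\<bar>) \<le> 1 / r" using True by (intro divide_left_mono) auto
        then have "relax_density r * (1 / (1 + \<bar>r\<bar>)) \<le> relax_density r * (1 / r)"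
          by (intro mult_left_mono) auto
        also have "\<dots> = indicator {1..} r * r powr (- \<rho>) / ?c"
          using True by (simp add: relax_density_def powr_diff powr_minus field_simps)
        finally show ?thesis by (simp add: add_increasing)
      next
        case False
        show ?thesis
        proof (cases "r \<ge> 0")
          case True
          have "1 / (1 + \<bar>r\<bar>) \<le> exp 1 * exp (- \<bar>r\<bar> * 1)"
          proof -
            have "1 / (1 + \<bar>r\<bar>) \<le> 1" by simp
            also have "1 \<le> exp (1 - r)" using False by simp
            also have "\<dots> = exp 1 * exp (- \<bar>r\<bar> * 1)" using True by (simp flip: exp_add)
            finally show ?thesis .
          qed
          then have "relax_density r * (1 / (1 + \<bar>r\<bar>)) \<le> relax_density r * (exp 1 * exp (- \<bar>r\<bar> * 1))"
            by (intro mult_left_mono) auto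
          then show ?thesis using Gammas_pos by (simp add: mult_ac add_increasing2)
        next
          case False
          then show ?thesis by (simp add: relax_density_def)
        qed
      qed
      then show "norm (relax_density r * (1 / (1 + \<bar>r\<bar>))) \<le>
       norm (exp 1 * (relax_density r * exp (- \<bar>r\<bar> * 1)) + indicator {1..} r * r powr (- \<rho>) / ?c)"
        by simp
    qed
  qed measurable
qed

section \<open>The measure of rates and the relaxation equation of the resolvent\<close>

definition relax_measure :: "real measure" where
  "relax_measure = density lborel (\<lambda>r. ennreal (relax_density r))"

lemma space_relax_measure [simp]: "space relax_measure = UNIV"
  and sets_relax_measure [measurable_cong, simp]: "sets relax_measure = sets borel"
  by (simp_all add: relax_measure_def)

lemma sigma_finite_relax_measure: "sigma_finite_measure relax_measure"
  unfolding relax_measure_def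
  by (subst sigma_finite_measure.sigma_finite_iff_density_finite[OF sigma_finite_lborel]) auto

lemma integrable_relax_measure_iff:
  fixes f :: "real \<Rightarrow> real"
  assumes [measurable]: "f \<in> borel_measurable borel"
  shows "integrable relax_measure f \<longleftrightarrow> integrable lborel (\<lambda>r. relax_density r * f r)"
  unfolding relax_measure_def by (subst integrable_real_density) auto

lemma integral_relax_measure:
  fixes f :: "real \<Rightarrow> real"
  assumes [measurable]: "f \<in> borel_measurable borel"
  shows "integral\<^sup>L relax_measure f = (\<integral>r. relax_density r * f r \<partial>lborel)"
  unfolding relax_measure_def by (subst integral_real_density) auto

text \<open>The density decreases on the positive axis, so on [1, 2] it is at least its value
  \<open>c\<close> at 2.\<close>

lemma relax_measure_band: "measure relax_measure {q \<in> space relax_measure. 1 \<le> \<bar>q\<bar> \<and> \<bar>q\<bar> \<le> 2} > 0"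
proof -
  let ?Z = "{q::real. 1 \<le> \<bar>q\<bar> \<and> \<bar>q\<bar> \<le> 2}"
  define c where "c = 2 powr (1 - \<rho>) / (Gamma (\<rho> - 1) * Gamma (2 - \<rho>))"
  have c: "c > 0" using Gammas_pos by (simp add: c_def)
  have [measurable]: "?Z \<in> sets borel" by measurable
  \<comment> \<open>Finiteness of the mass matters: on a set of infinite mass \<open>measure\<close>
    would return 0.\<close>
  have "integrable lborel (\<lambda>r. relax_density r * indicator ?Z r)"
  proof (rule Bochner_Integration.integrable_bound)
    show "integrable lborel (\<lambda>r. 3 * (relax_density r * (1 / (1 + \<bar>r\<bar>))))"
      using relax_density_integrable by (rule integrable_mult_right)
    show "AE r in lborel. norm (relax_density r * indicator ?Z r) \<le> norm (3 * (relax_density r * (1 / (1 + \<bar>r\<bar>))))"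
    proof (rule AE_I2)
      fix r :: real
      have "indicator ?Z r \<le> 3 * (1 / (1 + \<bar>r\<bar>))" by (auto simp: indicator_def field_simps)
      then have "relax_density r * indicator ?Z r \<le> relax_density r * (3 * (1 / (1 + \<bar>r\<bar>)))"
        by (intro mult_left_mono) auto
      then show "norm (relax_density r * indicator ?Z r) \<le> norm (3 * (relax_density r * (1 / (1 + \<bar>r\<bar>))))"
        by (simp add: mult_ac abs_mult)
    qed
  qed measurable
  then have "(\<integral>r. c * indicator {1..2::real} r \<partial>lborel) \<le> (\<integral>r. relax_density r * indicator ?Z r \<partial>lborel)"
  proof (intro Bochner_Integration.integral_mono)
    fix r :: real
    show "c * indicator {1..2::real} r \<le> relax_density r * indicator ?Z r"
    proof (cases "r \<in> {1..2}")
      case True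
      then have "2 powr (1 - \<rho>) \<le> r powr (1 - \<rho>)" using \<rho> by (intro powr_mono2') auto
      then show ?thesis
        using True Gammas_pos by (auto simp: c_def relax_density_def intro!: divide_right_mono)
    qed simp
  qed auto
  also have "\<dots> = measure relax_measure ?Z"
    using integral_relax_measure[of "indicator ?Z"] by simp
  finally show ?thesis using c by simp
qed

definition ml_fun :: "real \<Rightarrow> real" where "ml_fun t = mittag_leffler \<rho> 1 (- 1 * t powr \<rho>)"

lemma continuous_on_ml_fun: "continuous_on {0..} ml_fun"
  unfolding ml_fun_def[abs_def] using \<rho> by (intro continuous_on_mittag_leffler_powr) auto

lemma ml_fun_measurable [measurable]: "ml_fun \<in> borel_measurable borel"
proof -
  have [measurable]: "mittag_leffler \<rho> 1 \<in> borel_measurable borel"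
    using isCont_mittag_leffler[of \<rho> 1] \<rho>
    by (intro borel_measurable_continuous_onI continuous_at_imp_continuous_on) auto
  show ?thesis unfolding ml_fun_def[abs_def] by measurable
qed

text \<open>Insert the Laplace representation of the kernel and interchange. The exponential does
  not decay in r as u approaches t, and the measure of rates is infinite, so a bound uniform in u is
  of no help; integrating over u beforehand produces the integrable 1 / (1 + r).\<close>

lemma relax_measure_convolution:
  assumes t: "t \<ge> 0"
  shows "(LBINT u:{0..t}. frac_kernel (\<rho> - 1) (t - u) * ml_fun u) = (\<integral>q. relax ml_fun \<bar>q\<bar> t \<partial>relax_measure)"
proof -
  interpret sigma_finite_measure relax_measure by (rule sigma_finite_relax_measure)
  interpret P: pair_sigma_finite relax_measure lborel ..
  define F where "F = (\<lambda>(r::real) u. indicator {0..t} u * (exp (- \<bar>r\<bar> * (t - u)) * ml_fun u))"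
  have F_meas: "case_prod F \<in> borel_measurable (relax_measure \<Otimes>\<^sub>M lborel)"
    unfolding F_def by measurable
  have "bounded (ml_fun ` {0..t})"
    by (intro compact_imp_bounded compact_continuous_image continuous_on_subset[OF continuous_on_ml_fun]) auto
  then obtain B where B: "\<And>u. 0 \<le> u \<Longrightarrow> u \<le> t \<Longrightarrow> \<bar>ml_fun u\<bar> \<le> B" by (force simp: bounded_iff)
  have cabs: "continuous_on {0..} (\<lambda>u. \<bar>ml_fun u\<bar>)"
    by (intro continuous_intros continuous_on_ml_fun)
  have nF: "(\<integral>u. norm (F r u) \<partial>lborel) = relax (\<lambda>u. \<bar>ml_fun u\<bar>) \<bar>r\<bar> t" for r
    unfolding relax_def set_lebesgue_integral_def F_def by (simp add: abs_mult)
  have "integrable (relax_measure \<Otimes>\<^sub>M lborel) (case_prod F)"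
  proof (rule P.Fubini_integrable[OF F_meas])
    have "integrable relax_measure (\<lambda>r. relax (\<lambda>u. \<bar>ml_fun u\<bar>) \<bar>r\<bar> t)"
    proof (rule Bochner_Integration.integrable_bound)
      show "integrable relax_measure (\<lambda>r. B * (t + 1) * (1 / (1 + \<bar>r\<bar>)))"
        using relax_density_integrable by (intro integrable_mult_right) (simp add: integrable_relax_measure_iff)
      show "AE r in relax_measure. norm (relax (\<lambda>u. \<bar>ml_fun u\<bar>) \<bar>r\<bar> t) \<le> norm (B * (t + 1) * (1 / (1 + \<bar>r\<bar>)))"
      proof (rule AE_I2)
        fix r :: real
        have "\<bar>relax (\<lambda>u. \<bar>ml_fun u\<bar>) \<bar>r\<bar> t\<bar> \<le> B * (t + 1) / (1 + \<bar>r\<bar>)"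
          using abs_relax_le(1)[OF cabs _ t order_refl, of "\<bar>r\<bar>" B] B by auto
        then have "\<bar>relax (\<lambda>u. \<bar>ml_fun u\<bar>) \<bar>r\<bar> t\<bar> \<le> B * (t + 1) * (1 / (1 + \<bar>r\<bar>))" by simp
        then show "norm (relax (\<lambda>u. \<bar>ml_fun u\<bar>) \<bar>r\<bar> t) \<le> norm (B * (t + 1) * (1 / (1 + \<bar>r\<bar>)))"
          unfolding real_norm_def using abs_ge_self by (rule order_trans)
      qed
    qed measurable
    then show "integrable relax_measure (\<lambda>x. LINT y|lborel. norm (case (x, y) of (x, y) \<Rightarrow> F x y))"
      by (simp only: prod.case nF)
    have "integrable lborel (F r)" for r
    proof -
      have "set_integrable lborel {0..t} (\<lambda>u. exp (- \<bar>r\<bar> * (t - u)) * ml_fun u)"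
        by (intro borel_integrable_atLeastAtMost' continuous_intros
            continuous_on_subset[OF continuous_on_ml_fun]) auto
      then show ?thesis by (simp add: F_def set_integrable_def)
    qed
    then show "AE x in relax_measure. integrable lborel (\<lambda>y. case (x, y) of (x, y) \<Rightarrow> F x y)"
      by simp
  qed
  then have swap: "(\<integral>u. (\<integral>r. F r u \<partial>relax_measure) \<partial>lborel) = (\<integral>r. (\<integral>u. F r u \<partial>lborel) \<partial>relax_measure)"
    by (rule P.Fubini_integral)
  have inner: "(\<integral>r. (\<integral>u. F r u \<partial>lborel) \<partial>relax_measure) = (\<integral>q. relax ml_fun \<bar>q\<bar> t \<partial>relax_measure)"
    unfolding relax_def set_lebesgue_integral_def F_def by simp
  have outer: "(\<integral>u. (\<integral>r. F r u \<partial>relax_measure) \<partial>lborel) =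
      (LBINT u:{0..t}. frac_kernel (\<rho> - 1) (t - u) * ml_fun u)"
    unfolding set_lebesgue_integral_def
  proof (rule Bochner_Integration.integral_cong_AE)
    show "AE u in lborel. (\<integral>r. F r u \<partial>relax_measure) =
        indicator {0..t} u *\<^sub>R (frac_kernel (\<rho> - 1) (t - u) * ml_fun u)"
      \<comment> \<open>The Laplace representation needs t - u > 0, so the singular time u = t is
        discarded.\<close>
      using AE_lborel_singleton[of t]
    proof eventually_elim
      fix u assume u: "u \<noteq> t"
      show "(\<integral>r. F r u \<partial>relax_measure) = indicator {0..t} u *\<^sub>R (frac_kernel (\<rho> - 1) (t - u) * ml_fun u)"
      proof (cases "u \<in> {0..t}")
        case True
        then have "t - u > 0" using u by simp
        from relax_density_exp[OF this]
        have "(\<integral>r. exp (- \<bar>r\<bar> * (t - u)) \<partial>relax_measure) = frac_kernel (\<rho> - 1) (t - u)"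
          by (subst integral_relax_measure) (auto simp: has_bochner_integral_iff)
        then show ?thesis using True by (simp add: F_def)
      qed (simp add: F_def)
    qed
    have "(\<lambda>u. (\<integral>r. F r u \<partial>relax_measure)) \<in> borel_measurable lborel"
      unfolding F_def by measurable
    then show "(\<lambda>u. (\<integral>r. F r u \<partial>relax_measure)) \<in> borel_measurable lborel" .
    show "(\<lambda>u. indicator {0..t} u *\<^sub>R (frac_kernel (\<rho> - 1) (t - u) * ml_fun u)) \<in> borel_measurable lborel"
      unfolding frac_kernel_def by measurable
  qed
  show ?thesis using swap unfolding inner outer .
qed

text \<open>The closed form of \<open>w\<close> plays two parts: as a fractional integral of the
  resolvent of order \<rho> - 1 it is the average over the rates, and by the chain rule it is minus
  the derivative. Its continuity at 0 is visible from the formula.\<close>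

lemma relaxation_equation_ml_fun:
  "relaxation_equation relax_measure (\<lambda>q. \<bar>q\<bar>) ml_fun (\<lambda>t. t powr (\<rho> - 1) * mittag_leffler \<rho> \<rho> (- 1 * t powr \<rho>))"
proof (intro relaxation_equation.intro relaxation_equation_axioms.intro)
  show "sigma_finite_measure relax_measure" by (rule sigma_finite_relax_measure)
  show "(\<lambda>q. \<bar>q\<bar>) \<in> borel_measurable relax_measure" by simp
  show "integrable relax_measure (\<lambda>q. 1 / (1 + \<bar>q\<bar>))"
    using relax_density_integrable by (simp add: integrable_relax_measure_iff)
  show "measure relax_measure {q \<in> space relax_measure. 1 \<le> \<bar>q\<bar> \<and> \<bar>q\<bar> \<le> 2} > 0"
    by (rule relax_measure_band)
  show "continuous_on {0..} ml_fun" by (rule continuous_on_ml_fun)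
  show "ml_fun 0 = 1" by (simp add: ml_fun_def mittag_leffler_0)
  show "continuous_on {0..} (\<lambda>t. t powr (\<rho> - 1) * mittag_leffler \<rho> \<rho> (- 1 * t powr \<rho>))"
    using \<rho> by (intro continuous_on_mult continuous_on_mittag_leffler_powr continuous_on_powr') auto
  show "t powr (\<rho> - 1) * mittag_leffler \<rho> \<rho> (- 1 * t powr \<rho>) = (\<integral>q. relax ml_fun \<bar>q\<bar> t \<partial>relax_measure)"
    if "t \<ge> 0" for t
    using frac_integral_mittag_leffler(2)[of "\<rho> - 1" \<rho> t "- 1"] relax_measure_convolution[OF that] that \<rho>
    by (simp add: ml_fun_def[abs_def])
  show "(ml_fun has_real_derivative - (t powr (\<rho> - 1) * mittag_leffler \<rho> \<rho> (- 1 * t powr \<rho>))) (at t)"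
    if "t > 0" for t
  proof -
    have "((\<lambda>t. - 1 * t powr \<rho>) has_real_derivative - 1 * (\<rho> * t powr (\<rho> - 1))) (at t)"
      using that by (intro DERIV_cmult has_real_derivative_powr)
    from DERIV_chain2[OF DERIV_mittag_leffler this, of \<rho>] show ?thesis
      using \<rho> by (simp add: ml_fun_def[abs_def] mult_ac)
  qed
qed auto

lemma mittag_leffler_bounded: "\<bar>mittag_leffler \<rho> 1 (- (t powr \<rho>))\<bar> \<le> 1" if "t \<ge> 0"
  using relaxation_equation.abs_s_le_1[OF relaxation_equation_ml_fun that] by (simp add: ml_fun_def)

lemma mittag_leffler_square_integral_bounded:
  "\<exists>C. \<forall>T\<ge>0. integral {0..T} (\<lambda>t. (mittag_leffler \<rho> 1 (- (t powr \<rho>)))\<^sup>2) \<le> C"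
  using relaxation_equation.square_integral_bounded[OF relaxation_equation_ml_fun] by (simp add: ml_fun_def)

end

section \<open>Step functions and their stochastic integrals\<close>

lemma partition_mono:
  fixes p :: "nat \<Rightarrow> real"
  assumes "\<And>i. i < n \<Longrightarrow> p i \<le> p (Suc i)" "i \<le> j" "j \<le> n"
  shows "p i \<le> p j"
  using assms(2,3)
proof (induction j rule: dec_induct)
  case (step j)
  then show ?case using assms(1)[of j] by simp
qed simp

text \<open>The half-open cells are pairwise disjoint, so the mixed terms vanish.\<close>

lemma step_fun_square:
  assumes p: "\<And>i. i < n \<Longrightarrow> p i \<le> p (Suc i)"
  shows "(step_fun n p c x)\<^sup>2 = (\<Sum>i<n. (c i)\<^sup>2 * indicator {p i<..p (Suc i)} x)"
proof -
  let ?I = "\<lambda>i. indicator {p i<..p (Suc i)} x :: real"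
  have disj: "?I i * ?I j = 0" if "i < j" "j < n" for i j
    using partition_mono[of n p "Suc i" j] p that by (auto simp: indicator_def)
  have "(step_fun n p c x)\<^sup>2 = (\<Sum>i<n. \<Sum>j<n. (c i * ?I i) * (c j * ?I j))"
    unfolding step_fun_def power2_eq_square by (rule sum_product)
  also have "\<dots> = (\<Sum>i<n. \<Sum>j<n. if j = i then (c i)\<^sup>2 * ?I i else 0)"
  proof (intro sum.cong refl)
    fix i j assume ij: "i \<in> {..<n}" "j \<in> {..<n}"
    show "(c i * ?I i) * (c j * ?I j) = (if j = i then (c i)\<^sup>2 * ?I i else 0)"
      using disj[of i j] disj[of j i] ij
      by (cases i j rule: linorder_cases) (auto simp: power2_eq_square mult_ac indicator_def)
  qed
  also have "\<dots> = (\<Sum>i<n. (c i)\<^sup>2 * ?I i)" by simp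
  finally show ?thesis .
qed

lemma is_partition_mono: "is_partition t n p \<Longrightarrow> i \<le> j \<Longrightarrow> j \<le> n \<Longrightarrow> p i \<le> p j"
  unfolding is_partition_def by (rule partition_mono[of n p]) auto

lemma is_partition_nonneg: "is_partition t n p \<Longrightarrow> i \<le> n \<Longrightarrow> p i \<ge> 0"
  using is_partition_mono[of t n p 0 i] by (simp add: is_partition_def)

lemma is_partition_le: "is_partition t n p \<Longrightarrow> i \<le> n \<Longrightarrow> p i \<le> t"
  using is_partition_mono[of t n p i n] by (simp add: is_partition_def)

lemma step_fun_measurable [measurable]: "step_fun n p c \<in> borel_measurable borel"
  unfolding step_fun_def[abs_def] by measurable

lemma step_fun_square_integral:
  assumes P: "is_partition t n p"
  shows "has_bochner_integral lborel (\<lambda>x. indicator {0..t} x * (step_fun n p c x)\<^sup>2)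
           (\<Sum>i<n. (c i)\<^sup>2 * (p (Suc i) - p i))"
proof -
  have p: "p i \<le> p (Suc i)" if "i < n" for i using P that by (simp add: is_partition_def)
  have "has_bochner_integral lborel (\<lambda>x. \<Sum>i<n. (c i)\<^sup>2 * indicator {p i<..p (Suc i)} x)
           (\<Sum>i<n. (c i)\<^sup>2 * (p (Suc i) - p i))"
    using p
    by (intro has_bochner_integral_sum has_bochner_integral_mult_right)
       (auto simp: has_bochner_integral_iff)
  also have "(\<lambda>x. \<Sum>i<n. (c i)\<^sup>2 * indicator {p i<..p (Suc i)} x) =
      (\<lambda>x. indicator {0..t} x * (step_fun n p c x)\<^sup>2)"
  proof
    fix x :: real
    have "(\<Sum>i<n. (c i)\<^sup>2 * indicator {p i<..p (Suc i)} x) =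
        (\<Sum>i<n. indicator {0..t} x * ((c i)\<^sup>2 * indicator {p i<..p (Suc i)} x))"
    proof (intro sum.cong refl)
      fix i assume "i \<in> {..<n}"
      then have "p i \<ge> 0" "p (Suc i) \<le> t"
        using is_partition_nonneg[OF P, of i] is_partition_le[OF P, of "Suc i"] by auto
      then show "(c i)\<^sup>2 * indicator {p i<..p (Suc i)} x =
          indicator {0..t} x * ((c i)\<^sup>2 * indicator {p i<..p (Suc i)} x)"
        by (auto simp: indicator_def)
    qed
    then show "(\<Sum>i<n. (c i)\<^sup>2 * indicator {p i<..p (Suc i)} x) =
        indicator {0..t} x * (step_fun n p c x)\<^sup>2"
      by (simp add: step_fun_square[of n p, OF p] sum_distrib_left)
  qed
  finally show ?thesis .
qed

text \<open>Partitions may have empty cells, whereas independence of increments is given for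
  strictly increasing times. An empty cell contributes nothing to either sum and is dropped by
  induction on the number of cells.\<close>

lemma strict_partition:
  fixes p :: "nat \<Rightarrow> real"
  assumes "\<And>i. i < n \<Longrightarrow> p i \<le> p (Suc i)"
  shows "\<exists>m q d. q 0 = p 0 \<and> q m = p n \<and> (\<forall>i<m. q i < q (Suc i)) \<and>
           step_integral W n p c = step_integral W m q d \<and>
           (\<Sum>i<n. (c i)\<^sup>2 * (p (Suc i) - p i)) = (\<Sum>i<m. (d i)\<^sup>2 * (q (Suc i) - q i))"
  using assms
proof (induction n)
  case 0
  show ?case by (rule exI[of _ 0], rule exI[of _ p], rule exI[of _ c]) auto
next
  case (Suc n)
  have "p i \<le> p (Suc i)" if "i < n" for i using Suc.prems[of i] that by simp
  from Suc.IH[OF this] obtain m q d where q: "q 0 = p 0" "q m = p n" "\<forall>i<m. q i < q (Suc i)"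
      "step_integral W n p c = step_integral W m q d"
      "(\<Sum>i<n. (c i)\<^sup>2 * (p (Suc i) - p i)) = (\<Sum>i<m. (d i)\<^sup>2 * (q (Suc i) - q i))"
    by blast
  show ?case
  proof (cases "p (Suc n) = p n")
    case True
    have "step_integral W (Suc n) p c = step_integral W m q d"
      unfolding q(4)[symmetric] by (simp add: step_integral_def[abs_def] True)
    moreover have "(\<Sum>i<Suc n. (c i)\<^sup>2 * (p (Suc i) - p i)) = (\<Sum>i<m. (d i)\<^sup>2 * (q (Suc i) - q i))"
      unfolding q(5)[symmetric] by (simp add: True)
    ultimately have "q 0 = p 0 \<and> q m = p (Suc n) \<and> (\<forall>i<m. q i < q (Suc i)) \<and>
        step_integral W (Suc n) p c = step_integral W m q d \<and>
        (\<Sum>i<Suc n. (c i)\<^sup>2 * (p (Suc i) - p i)) = (\<Sum>i<m. (d i)\<^sup>2 * (q (Suc i) - q i))"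
      using q(1-3) True by (intro conjI) simp_all
    then show ?thesis
      by - (rule exI[of _ m], rule exI[of _ q], rule exI[of _ d], assumption)
  next
    case False
    then have lt: "p n < p (Suc n)" using Suc.prems[of n] by simp
    define q' where "q' = q(Suc m := p (Suc n))"
    define d' where "d' = d(m := c n)"
    have q': "q' i = q i" if "i \<le> m" for i using that by (simp add: q'_def)
    have d': "d' i = d i" if "i < m" for i using that by (simp add: d'_def)
    have last: "q' (Suc m) = p (Suc n)" "d' m = c n" by (simp_all add: q'_def d'_def)
    have "step_integral W (Suc n) p c \<omega> = step_integral W (Suc m) q' d' \<omega>" for \<omega>
    proof -
      have "step_integral W (Suc n) p c \<omega> = step_integral W m q d \<omega> + c n * (W (p (Suc n)) \<omega> - W (p n) \<omega>)"
        unfolding q(4)[symmetric] by (simp add: step_integral_def)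
      also have "step_integral W m q d \<omega> = step_integral W m q' d' \<omega>"
        unfolding step_integral_def by (intro sum.cong) (auto simp: q' d')
      finally show ?thesis by (simp add: step_integral_def last q' q(2))
    qed
    then have "step_integral W (Suc n) p c = step_integral W (Suc m) q' d'" by (rule ext)
    moreover have "(\<Sum>i<Suc n. (c i)\<^sup>2 * (p (Suc i) - p i)) = (\<Sum>i<Suc m. (d' i)\<^sup>2 * (q' (Suc i) - q' i))"
    proof -
      have "(\<Sum>i<m. (d i)\<^sup>2 * (q (Suc i) - q i)) = (\<Sum>i<m. (d' i)\<^sup>2 * (q' (Suc i) - q' i))"
        by (intro sum.cong) (auto simp: q' d')
      then show ?thesis using q(5) by (simp add: last q' q(2))
    qed
    moreover have "\<forall>i<Suc m. q' i < q' (Suc i)"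
      using q(2,3) lt by (auto simp: less_Suc_eq q' last)
    moreover have "q' 0 = p 0" by (simp add: q' q(1))
    ultimately have "q' 0 = p 0 \<and> q' (Suc m) = p (Suc n) \<and> (\<forall>i<Suc m. q' i < q' (Suc i)) \<and>
        step_integral W (Suc n) p c = step_integral W (Suc m) q' d' \<and>
        (\<Sum>i<Suc n. (c i)\<^sup>2 * (p (Suc i) - p i)) = (\<Sum>i<Suc m. (d' i)\<^sup>2 * (q' (Suc i) - q' i))"
      using last(1) by blast
    then show ?thesis
      by - (rule exI[of _ "Suc m"], rule exI[of _ q'], rule exI[of _ d'], assumption)
  qed
qed

lemma (in prob_space) char_normal:
  assumes X: "distributed M lborel X (normal_density 0 \<sigma>)" and \<sigma>: "\<sigma> > 0"
  shows "char (distr M borel X) \<theta> = complex_of_real (exp (- (\<sigma>\<^sup>2 * \<theta>\<^sup>2 / 2)))"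
proof -
  have [measurable]: "X \<in> borel_measurable M" using distributed_measurable[OF X] by simp
  have "distributed M lborel (\<lambda>x. (X x - 0) / \<sigma>) std_normal_density"
    using X normal_standard_normal_convert[OF \<sigma>] by blast
  then have Z: "distr M borel (\<lambda>x. X x / \<sigma>) = std_normal_distribution"
    using distributed_distr_eq_density[of M lborel] by (simp cong: distr_cong)
  have "char (distr M borel X) \<theta> = (CLINT x|M. iexp (\<theta> * X x))"
    unfolding char_def by (subst integral_distr) auto
  also have "\<dots> = (CLINT x|M. iexp ((\<theta> * \<sigma>) * (X x / \<sigma>)))"
    using \<sigma> by (intro Bochner_Integration.integral_cong) auto
  also have "\<dots> = char (distr M borel (\<lambda>x. X x / \<sigma>)) (\<theta> * \<sigma>)"
    unfolding char_def by (subst integral_distr) auto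
  also have "\<dots> = exp (- ((\<theta> * \<sigma>)\<^sup>2) / 2)"
    unfolding Z char_std_normal_distribution by simp
  finally show ?thesis by (simp add: power_mult_distrib mult.commute)
qed

context brownian_motion
begin

lemma step_integral_measurable:
  assumes "is_partition t n p"
  shows "step_integral W n p c \<in> borel_measurable M"
  unfolding step_integral_def[abs_def]
proof (intro borel_measurable_sum)
  fix i assume "i \<in> {..<n}"
  then have [measurable]: "W (p (Suc i)) \<in> borel_measurable M" "W (p i) \<in> borel_measurable M"
    using is_partition_nonneg[OF assms, of i] is_partition_nonneg[OF assms, of "Suc i"]
    by (auto intro!: measurable_BM)
  show "(\<lambda>\<omega>. c i * (W (p (Suc i)) \<omega> - W (p i) \<omega>)) \<in> borel_measurable M"
    by measurable
qed

text \<open>Independent increments turn the characteristic function of the sum into a product of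
  normal ones, and the variances add in the exponent.\<close>

lemma char_step_integral:
  assumes P: "is_partition t n p"
  shows "char (distr M borel (step_integral W n p c)) \<theta> =
           complex_of_real (exp (- ((\<Sum>i<n. (c i)\<^sup>2 * (p (Suc i) - p i)) * \<theta>\<^sup>2 / 2)))"
proof -
  have "p i \<le> p (Suc i)" if "i < n" for i using P that by (simp add: is_partition_def)
  from strict_partition[of n p W c, OF this] obtain m q d where
      "q 0 = p 0 \<and> q m = p n \<and> (\<forall>i<m. q i < q (Suc i)) \<and>
           step_integral W n p c = step_integral W m q d \<and>
           (\<Sum>i<n. (c i)\<^sup>2 * (p (Suc i) - p i)) = (\<Sum>i<m. (d i)\<^sup>2 * (q (Suc i) - q i))"
    by blast
  then have q: "q 0 = 0" "\<And>i. i < m \<Longrightarrow> q i < q (Suc i)"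
      "step_integral W n p c = step_integral W m q d"
      "(\<Sum>i<n. (c i)\<^sup>2 * (p (Suc i) - p i)) = (\<Sum>i<m. (d i)\<^sup>2 * (q (Suc i) - q i))"
    using P unfolding is_partition_def by simp_all
  have q0: "q i \<ge> 0" if "i \<le> m" for i
    using partition_mono[of m q 0 i] q(1,2) that by (auto intro: less_imp_le)
  let ?X = "\<lambda>i \<omega>. W (q (Suc i)) \<omega> - W (q i) \<omega>"
  have "indep_vars (\<lambda>_. borel) ?X {..<m}" using q by (intro indep_increments) auto
  then have ind: "indep_vars (\<lambda>_. borel) (\<lambda>i \<omega>. d i * ?X i \<omega>) {..<m}"
    by (rule indep_vars_compose2[where Y = "\<lambda>i x. d i * x"]) auto
  have "char (distr M borel (\<lambda>\<omega>. d i * ?X i \<omega>)) \<theta> = exp (- ((d i)\<^sup>2 * (q (Suc i) - q i) * \<theta>\<^sup>2 / 2))"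
    if i: "i < m" for i
  proof -
    have [measurable]: "?X i \<in> borel_measurable M"
    proof -
      have [measurable]: "W (q (Suc i)) \<in> borel_measurable M" "W (q i) \<in> borel_measurable M"
        using i q0[of i] q0[of "Suc i"] by (auto intro!: measurable_BM)
      show ?thesis by measurable
    qed
    have "char (distr M borel (\<lambda>\<omega>. d i * ?X i \<omega>)) \<theta> = char (distr M borel (?X i)) (\<theta> * d i)"
      unfolding char_def by (subst (1 2) integral_distr) (auto simp: mult.assoc)
    also have "\<dots> = exp (- ((sqrt (q (Suc i) - q i))\<^sup>2 * (\<theta> * d i)\<^sup>2 / 2))"
      using i q(2)[of i] q0[of i] by (intro char_normal normal_increments) auto
    finally show ?thesis using q(2)[of i] i by (simp add: power_mult_distrib mult_ac)
  qed
  then have "(\<Prod>i<m. char (distr M borel (\<lambda>\<omega>. d i * ?X i \<omega>)) \<theta>) =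
      (\<Prod>i<m. complex_of_real (exp (- ((d i)\<^sup>2 * (q (Suc i) - q i) * \<theta>\<^sup>2 / 2))))"
    by (intro prod.cong) auto
  also have "\<dots> = complex_of_real (exp (\<Sum>i<m. - ((d i)\<^sup>2 * (q (Suc i) - q i) * \<theta>\<^sup>2 / 2)))"
    by (simp only: exp_sum[OF finite_lessThan] of_real_prod)
  also have "(\<Sum>i<m. - ((d i)\<^sup>2 * (q (Suc i) - q i) * \<theta>\<^sup>2 / 2)) =
      - ((\<Sum>i<m. (d i)\<^sup>2 * (q (Suc i) - q i)) * \<theta>\<^sup>2 / 2)"
    by (simp add: sum_negf sum_distrib_right sum_divide_distrib)
  finally show ?thesis
    unfolding q(3,4) unfolding step_integral_def[abs_def] by (rule trans[OF char_distr_sum[OF ind]])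
qed

end

section \<open>Limits of step integrals\<close>

text \<open>By uniqueness of characteristic functions the law is normal, and its second moment can
  be read off. This makes the Ito isometry a consequence of the law of the integral.\<close>

lemma (in prob_space) second_moment_of_char:
  assumes [measurable]: "X \<in> borel_measurable M" and v: "v \<ge> 0"
    and char: "\<And>\<theta>. char (distr M borel X) \<theta> = complex_of_real (exp (- (v * \<theta>\<^sup>2 / 2)))"
  shows "(\<integral>\<^sup>+\<omega>. ennreal ((X \<omega>)\<^sup>2) \<partial>M) = ennreal v"
proof -
  have X: "real_distribution (distr M borel X)" by (rule real_distribution_distr) simp
  have nn: "(\<integral>\<^sup>+\<omega>. ennreal ((X \<omega>)\<^sup>2) \<partial>M) = (\<integral>\<^sup>+x. ennreal (x\<^sup>2) \<partial>distr M borel X)"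
    by (subst nn_integral_distr) auto
  show ?thesis
  proof (cases "v = 0")
    case True
    \<comment> \<open>With variance 0 there is no normal density; the law is the point mass at
      0.\<close>
    have "distr M borel X = return borel 0"
    proof (rule Levy_uniqueness[OF X])
      show "real_distribution (return borel 0)"
        by (intro real_distribution.intro real_distribution_axioms.intro prob_space_return) auto
      show "char (distr M borel X) = char (return borel 0)"
        using char True by (auto simp: char_def fun_eq_iff integral_return)
    qed
    then show ?thesis unfolding nn using True by (simp add: nn_integral_return)
  next
    case False
    define N where "N = density lborel (\<lambda>x. ennreal (normal_density 0 (sqrt v) x))"
    have sv: "sqrt v > 0" using v False by simp
    interpret N: prob_space N unfolding N_def using sv by (rule prob_space_normal_density)
    have N_sets: "sets N = sets borel" by (simp add: N_def)
    have "distr N lborel (\<lambda>x. x) = N"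
      by (rule distr_id2) (simp add: N_def)
    then have dist: "distributed N lborel (\<lambda>x. x) (normal_density 0 (sqrt v))"
      unfolding distributed_def by (simp add: N_def cong: measurable_cong_sets)
    have "distr N borel (\<lambda>x. x) = N" by (rule distr_id2) (simp add: N_def)
    then have char_N: "char N \<theta> = complex_of_real (exp (- (v * \<theta>\<^sup>2 / 2)))" for \<theta>
      using N.char_normal[OF dist sv, of \<theta>] v by simp
    have distr_eq: "distr M borel X = N"
    proof (rule Levy_uniqueness[OF X])
      show "real_distribution N"
        by (intro real_distribution.intro real_distribution_axioms.intro N.prob_space_axioms N_sets)
      show "char (distr M borel X) = char N" by (simp add: fun_eq_iff char char_N)
    qed
    have "(\<integral>\<^sup>+\<omega>. ennreal ((X \<omega>)\<^sup>2) \<partial>M) = (\<integral>\<^sup>+x. ennreal (normal_density 0 (sqrt v) x * x\<^sup>2) \<partial>lborel)"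
      unfolding nn distr_eq N_def by (subst nn_integral_density) (auto simp: ennreal_mult')
    also have "\<dots> = ennreal v"
    proof -
      have "has_bochner_integral lborel (\<lambda>x. normal_density 0 (sqrt v) x * x\<^sup>2) v"
        using normal_moment_even[OF sv, of 0 1] v by (simp add: numeral_2_eq_2)
      then show ?thesis
        by (subst nn_integral_eq_integral) (auto simp: has_bochner_integral_iff)
    qed
    finally show ?thesis .
  qed
qed

lemma norm_iexp_diff_le: "cmod (iexp a - iexp b) \<le> \<bar>a - b\<bar>"
proof -
  have "iexp a - iexp b = iexp b * (iexp (a - b) - 1)"
    by (simp add: right_diff_distrib algebra_simps flip: exp_add)
  then have "cmod (iexp a - iexp b) = cmod (iexp (a - b) - 1)" by (simp add: norm_mult)
  also have "\<dots> = 2 * \<bar>sin ((a - b) / 2)\<bar>" using dist_exp_i_1[of "a - b"] by simp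
  also have "\<dots> \<le> \<bar>a - b\<bar>" using abs_sin_x_le_abs_x[of "(a - b) / 2"] by simp
  finally show ?thesis .
qed

text \<open>If the absolute value exceeds \<delta>, it is at most its square over \<delta>. In
  expectation this passes from L2 bounds to L1 bounds.\<close>

lemma abs_le_add_square_div: "\<bar>x\<bar> \<le> \<delta> + x\<^sup>2 / \<delta>" if "\<delta> > 0" for x \<delta> :: real
proof (cases "\<bar>x\<bar> \<le> \<delta>")
  case False
  then have "\<delta> * \<bar>x\<bar> \<le> \<bar>x\<bar> * \<bar>x\<bar>" by (intro mult_right_mono) auto
  then have "\<bar>x\<bar> \<le> x\<^sup>2 / \<delta>" using that by (simp add: field_simps power2_eq_square)
  then show ?thesis using that by simp
qed (use that in \<open>simp add: add_increasing2\<close>)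

lemma ennreal_integral_le:
  assumes [measurable]: "g \<in> borel_measurable M" and "\<And>x. g x \<ge> 0" "b \<ge> 0"
    and le: "(\<integral>\<^sup>+x. ennreal (g x) \<partial>M) \<le> ennreal b"
  shows "integrable M g" "integral\<^sup>L M g \<le> b"
proof -
  have "(\<integral>\<^sup>+x. ennreal (g x) \<partial>M) < \<infinity>" using le by (rule le_less_trans) simp
  then show i: "integrable M g" using assms by (intro integrableI_nonneg) auto
  then show "integral\<^sup>L M g \<le> b"
    using le assms nn_integral_eq_integral[OF i] by simp
qed

text \<open>The map x to exp(i \<theta> x) is Lipschitz with constant
  \<open>\<bar>\<theta>\<bar>\<close>, so L2 convergence is more than enough.\<close>

lemma (in prob_space) char_L2_limit:
  assumes [measurable]: "I \<in> borel_measurable M" "\<And>k. J k \<in> borel_measurable M"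
    and lim: "(\<lambda>k. \<integral>\<^sup>+\<omega>. ennreal ((I \<omega> - J k \<omega>)\<^sup>2) \<partial>M) \<longlonglongrightarrow> 0"
  shows "(\<lambda>k. char (distr M borel (J k)) \<theta>) \<longlonglongrightarrow> char (distr M borel I) \<theta>"
proof (rule LIMSEQ_I)
  fix e :: real assume e: "e > 0"
  \<comment> \<open>The added 1 keeps the divisor positive at \<theta> = 0 and makes the last
    comparison strict.\<close>
  define C where "C = \<bar>\<theta>\<bar> + 1"
  have C: "C > 0" "\<bar>\<theta>\<bar> < C" by (simp_all add: C_def add_nonneg_pos)
  define \<delta> where "\<delta> = e / C / 2"
  have \<delta>: "\<delta> > 0" using e C by (simp add: \<delta>_def)
  have "eventually (\<lambda>k. (\<integral>\<^sup>+\<omega>. ennreal ((I \<omega> - J k \<omega>)\<^sup>2) \<partial>M) < ennreal (\<delta>\<^sup>2)) sequentially"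
    using \<delta> by (intro order_tendstoD(2)[OF lim]) simp
  then obtain K where K: "\<And>k. k \<ge> K \<Longrightarrow> (\<integral>\<^sup>+\<omega>. ennreal ((I \<omega> - J k \<omega>)\<^sup>2) \<partial>M) < ennreal (\<delta>\<^sup>2)"
    by (auto simp: eventually_sequentially)
  have "cmod (char (distr M borel (J k)) \<theta> - char (distr M borel I) \<theta>) < e" if "k \<ge> K" for k
  proof -
    have i: "integrable M (\<lambda>\<omega>. (I \<omega> - J k \<omega>)\<^sup>2)" "(\<integral>\<omega>. (I \<omega> - J k \<omega>)\<^sup>2 \<partial>M) \<le> \<delta>\<^sup>2"
      using K[OF that] by (intro ennreal_integral_le[where b = "\<delta>\<^sup>2"]; simp add: less_imp_le)+
    have int: "integrable M (\<lambda>\<omega>. iexp (\<theta> * X \<omega>))" if [measurable]: "X \<in> borel_measurable M" for X :: "'a \<Rightarrow> real"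
      by (rule integrable_const_bound[of _ 1]) auto
    have "char (distr M borel (J k)) \<theta> - char (distr M borel I) \<theta> =
        (CLINT \<omega>|M. iexp (\<theta> * J k \<omega>)) - (CLINT \<omega>|M. iexp (\<theta> * I \<omega>))"
      unfolding char_def by (subst (1 2) integral_distr) auto
    also have "\<dots> = (CLINT \<omega>|M. iexp (\<theta> * J k \<omega>) - iexp (\<theta> * I \<omega>))"
      by (rule Bochner_Integration.integral_diff[symmetric]) (rule int, measurable)+
    also have "cmod \<dots> \<le> (\<integral>\<omega>. cmod (iexp (\<theta> * J k \<omega>) - iexp (\<theta> * I \<omega>)) \<partial>M)"
      by (rule integral_norm_bound)
    also have "\<dots> \<le> (\<integral>\<omega>. \<bar>\<theta>\<bar> * (\<delta> + (I \<omega> - J k \<omega>)\<^sup>2 / \<delta>) \<partial>M)"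
    proof (rule Bochner_Integration.integral_mono)
      show "integrable M (\<lambda>\<omega>. cmod (iexp (\<theta> * J k \<omega>) - iexp (\<theta> * I \<omega>)))"
        by (intro integrable_norm Bochner_Integration.integrable_diff int) measurable
      show "integrable M (\<lambda>\<omega>. \<bar>\<theta>\<bar> * (\<delta> + (I \<omega> - J k \<omega>)\<^sup>2 / \<delta>))" using i by simp
      fix \<omega>
      have "cmod (iexp (\<theta> * J k \<omega>) - iexp (\<theta> * I \<omega>)) \<le> \<bar>\<theta> * J k \<omega> - \<theta> * I \<omega>\<bar>"
        by (rule norm_iexp_diff_le)
      also have "\<dots> = \<bar>\<theta>\<bar> * \<bar>I \<omega> - J k \<omega>\<bar>"
        by (metis abs_minus_commute abs_mult right_diff_distrib)
      also have "\<dots> \<le> \<bar>\<theta>\<bar> * (\<delta> + (I \<omega> - J k \<omega>)\<^sup>2 / \<delta>)"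
        by (intro mult_left_mono abs_le_add_square_div \<delta>) auto
      finally show "cmod (iexp (\<theta> * J k \<omega>) - iexp (\<theta> * I \<omega>)) \<le> \<bar>\<theta>\<bar> * (\<delta> + (I \<omega> - J k \<omega>)\<^sup>2 / \<delta>)" .
    qed
    also have "\<dots> = \<bar>\<theta>\<bar> * (\<delta> + (\<integral>\<omega>. (I \<omega> - J k \<omega>)\<^sup>2 \<partial>M) / \<delta>)"
      using i by (simp add: prob_space)
    also have "\<dots> \<le> \<bar>\<theta>\<bar> * (\<delta> + \<delta>\<^sup>2 / \<delta>)"
      using i \<delta> by (intro mult_left_mono add_left_mono divide_right_mono) auto
    also have "\<dots> = \<bar>\<theta>\<bar> * (2 * \<delta>)" using \<delta> by (simp add: power2_eq_square)
    also have "\<dots> < C * (2 * \<delta>)" using \<delta> C by (intro mult_strict_right_mono) auto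
    also have "\<dots> = e" using C by (simp add: \<delta>_def)
    finally show ?thesis .
  qed
  then show "\<exists>K. \<forall>k\<ge>K. cmod (char (distr M borel (J k)) \<theta> - char (distr M borel I) \<theta>) < e" by blast
qed

text \<open>The sums are squared L2 norms of the step functions, and the norm is continuous; the
  proof quantifies this by a weighted estimate of b^2 - a^2.\<close>

lemma step_fun_L2_limit:
  fixes f :: "real \<Rightarrow> real"
  assumes f: "continuous_on {0..t} f"
    and P: "\<And>k. is_partition t (n k) (p k)"
    and lim: "(\<lambda>k. \<integral>\<^sup>+x\<in>{0..t}. ennreal ((f x - step_fun (n k) (p k) (c k) x)\<^sup>2) \<partial>lborel) \<longlonglongrightarrow> 0"
  shows "(\<lambda>k. \<Sum>i<n k. (c k i)\<^sup>2 * (p k (Suc i) - p k i)) \<longlonglongrightarrow> (LBINT x:{0..t}. (f x)\<^sup>2)"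
proof (rule LIMSEQ_I)
  fix e :: real assume e: "e > 0"
  define A where "A = (LBINT x:{0..t}. (f x)\<^sup>2)"
  have A0: "A \<ge> 0" unfolding A_def set_lebesgue_integral_def by (intro integral_nonneg_AE) auto
  \<comment> \<open>The error will be \<delta> (A + 1 + \<delta>) with \<delta> at most 1, hence A +
    2; the further factor 1/2 in \<delta> makes the result strictly less than
    \<open>e\<close>.\<close>
  define B where "B = A + 2"
  have B: "B > 0" using A0 by (simp add: B_def)
  define \<delta> where "\<delta> = min 1 (e / B / 2)"
  have \<delta>: "\<delta> > 0" "\<delta> \<le> 1" using e B by (auto simp: \<delta>_def)
  have g[measurable]: "(\<lambda>x. indicator {0..t} x * f x) \<in> borel_measurable borel"
    using borel_measurable_continuous_on_indicator[OF _ f] by simp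
  have fi: "integrable lborel (\<lambda>x. indicator {0..t} x * (f x)\<^sup>2)"
    using borel_integrable_atLeastAtMost'[of 0 t "\<lambda>x. (f x)\<^sup>2"] f
    by (simp add: set_integrable_def continuous_on_power)
  define D where "D k x = indicator {0..t} x * (f x - step_fun (n k) (p k) (c k) x)\<^sup>2" for k x
  \<comment> \<open>\<open>f\<close> is only known to be measurable on the interval, so it is cut
    off inside the square as well.\<close>
  have D_eq: "D k = (\<lambda>x. indicator {0..t} x * (indicator {0..t} x * f x - step_fun (n k) (p k) (c k) x)\<^sup>2)" for k
    by (auto simp: D_def fun_eq_iff indicator_def)
  have [measurable]: "D k \<in> borel_measurable borel" for k unfolding D_eq by measurable
  have "eventually (\<lambda>k. (\<integral>\<^sup>+x\<in>{0..t}. ennreal ((f x - step_fun (n k) (p k) (c k) x)\<^sup>2) \<partial>lborel) < ennreal (\<delta>\<^sup>2)) sequentially"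
    using \<delta> by (intro order_tendstoD(2)[OF lim]) simp
  moreover have "(\<integral>\<^sup>+x\<in>{0..t}. ennreal ((f x - step_fun (n k) (p k) (c k) x)\<^sup>2) \<partial>lborel) = (\<integral>\<^sup>+x. ennreal (D k x) \<partial>lborel)" for k
    by (intro nn_integral_cong) (auto simp: D_def indicator_def)
  ultimately obtain K where K: "\<And>k. k \<ge> K \<Longrightarrow> (\<integral>\<^sup>+x. ennreal (D k x) \<partial>lborel) < ennreal (\<delta>\<^sup>2)"
    by (auto simp: eventually_sequentially)
  have "norm ((\<Sum>i<n k. (c k i)\<^sup>2 * (p k (Suc i) - p k i)) - A) < e" if "k \<ge> K" for k
  proof -
    have Di: "integrable lborel (D k)" "integral\<^sup>L lborel (D k) \<le> \<delta>\<^sup>2"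
      using K[OF that] by (intro ennreal_integral_le[where b = "\<delta>\<^sup>2"]; simp add: less_imp_le D_def)+
    note S = step_fun_square_integral[OF P[of k], of "c k"]
    have diff: "(\<Sum>i<n k. (c k i)\<^sup>2 * (p k (Suc i) - p k i)) - A =
        (\<integral>x. indicator {0..t} x * (step_fun (n k) (p k) (c k) x)\<^sup>2 - indicator {0..t} x * (f x)\<^sup>2 \<partial>lborel)"
      using S fi by (simp add: has_bochner_integral_iff A_def set_lebesgue_integral_def)
    have "norm ((\<Sum>i<n k. (c k i)\<^sup>2 * (p k (Suc i) - p k i)) - A) \<le>
        (\<integral>x. (1 + 1 / \<delta>) * D k x + \<delta> * (indicator {0..t} x * (f x)\<^sup>2) \<partial>lborel)"
      unfolding diff
    proof (rule Bochner_Integration.integral_norm_bound_integral)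
      show "integrable lborel (\<lambda>x. indicator {0..t} x * (step_fun (n k) (p k) (c k) x)\<^sup>2 - indicator {0..t} x * (f x)\<^sup>2)"
        using S fi by (simp add: has_bochner_integral_iff)
      show "integrable lborel (\<lambda>x. (1 + 1 / \<delta>) * D k x + \<delta> * (indicator {0..t} x * (f x)\<^sup>2))"
        using Di fi by (intro Bochner_Integration.integrable_add integrable_mult_right) auto
      fix x :: real
      have *: "\<bar>b\<^sup>2 - a\<^sup>2\<bar> \<le> (1 + 1 / \<delta>) * (a - b)\<^sup>2 + \<delta> * a\<^sup>2" for a b
      proof -
        have "2 * \<bar>a\<bar> * \<bar>a - b\<bar> \<le> \<delta> * a\<^sup>2 + (a - b)\<^sup>2 / \<delta>"
        proof -
          have "0 \<le> (\<delta> * \<bar>a\<bar> - \<bar>a - b\<bar>)\<^sup>2" by simp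
          also have "\<dots> = \<delta> * (\<delta> * a\<^sup>2) + (a - b)\<^sup>2 - \<delta> * (2 * \<bar>a\<bar> * \<bar>a - b\<bar>)"
            by (simp add: power2_diff power_mult_distrib power2_eq_square[of \<delta>] mult_ac)
          finally have "\<delta> * (2 * \<bar>a\<bar> * \<bar>a - b\<bar>) \<le> \<delta> * (\<delta> * a\<^sup>2 + (a - b)\<^sup>2 / \<delta>)"
            using \<delta> by (simp add: distrib_left)
          then show ?thesis using \<delta> by simp
        qed
        moreover have "\<bar>b\<^sup>2 - a\<^sup>2\<bar> \<le> (a - b)\<^sup>2 + 2 * \<bar>a\<bar> * \<bar>a - b\<bar>"
        proof -
          have "b\<^sup>2 - a\<^sup>2 = (a - b)\<^sup>2 - 2 * a * (a - b)" by (simp add: power2_eq_square algebra_simps)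
          also have "\<bar>\<dots>\<bar> \<le> \<bar>(a - b)\<^sup>2\<bar> + \<bar>2 * a * (a - b)\<bar>" by (rule abs_triangle_ineq4)
          finally show ?thesis by (simp add: abs_mult)
        qed
        ultimately show ?thesis by (simp add: distrib_right)
      qed
      show "norm (indicator {0..t} x * (step_fun (n k) (p k) (c k) x)\<^sup>2 - indicator {0..t} x * (f x)\<^sup>2) \<le>
          (1 + 1 / \<delta>) * D k x + \<delta> * (indicator {0..t} x * (f x)\<^sup>2)"
        using *[of "step_fun (n k) (p k) (c k) x" "f x"] by (auto simp: D_def indicator_def)
    qed
    also have "\<dots> = (\<integral>x. (1 + 1 / \<delta>) * D k x \<partial>lborel) + (\<integral>x. \<delta> * (indicator {0..t} x * (f x)\<^sup>2) \<partial>lborel)"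
      by (rule Bochner_Integration.integral_add[OF integrable_mult_right[OF Di(1)] integrable_mult_right[OF fi]])
    also have "\<dots> = (1 + 1 / \<delta>) * integral\<^sup>L lborel (D k) + \<delta> * A"
      unfolding integral_mult_right_zero A_def set_lebesgue_integral_def real_scaleR_def ..
    also have "\<dots> \<le> (1 + 1 / \<delta>) * \<delta>\<^sup>2 + \<delta> * A"
      using Di \<delta> by (intro add_right_mono mult_left_mono) auto
    also have "\<dots> = \<delta> * (A + 1 + \<delta>)" using \<delta> by (simp add: power2_eq_square algebra_simps)
    also have "\<dots> \<le> \<delta> * B" using \<delta> by (intro mult_left_mono) (auto simp: B_def)
    also have "\<dots> \<le> e / B / 2 * B"
      using B by (intro mult_right_mono) (auto simp: \<delta>_def)
    also have "\<dots> < e" using e B by simp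
    finally show ?thesis .
  qed
  then show "\<exists>K. \<forall>k\<ge>K. norm ((\<Sum>i<n k. (c k i)\<^sup>2 * (p k (Suc i) - p k i)) - (LBINT x:{0..t}. (f x)\<^sup>2)) < e"
    unfolding A_def by blast
qed

text \<open>Both limits run along the sequence that witnesses the integral, so every version has the
  same law, whichever approximation produced it.\<close>

lemma (in brownian_motion) char_wiener_integral:
  assumes f: "continuous_on {0..t} f" and I: "has_wiener_integral M W t f I"
  shows "char (distr M borel I) \<theta> = complex_of_real (exp (- ((LBINT x:{0..t}. (f x)\<^sup>2) * \<theta>\<^sup>2 / 2)))"
proof -
  from I obtain n p c where P: "\<And>k::nat. is_partition t (n k) (p k)"
    and lf: "(\<lambda>k. \<integral>\<^sup>+x\<in>{0..t}. ennreal ((f x - step_fun (n k) (p k) (c k) x)\<^sup>2) \<partial>lborel) \<longlonglongrightarrow> 0"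
    and lI: "(\<lambda>k. \<integral>\<^sup>+\<omega>. ennreal ((I \<omega> - step_integral W (n k) (p k) (c k) \<omega>)\<^sup>2) \<partial>M) \<longlonglongrightarrow> 0"
    and Im: "I \<in> borel_measurable M"
    unfolding has_wiener_integral_def by blast
  have "(\<lambda>k. char (distr M borel (step_integral W (n k) (p k) (c k))) \<theta>) \<longlonglongrightarrow> char (distr M borel I) \<theta>"
    by (rule char_L2_limit[OF Im step_integral_measurable[OF P] lI])
  moreover have "(\<lambda>k. char (distr M borel (step_integral W (n k) (p k) (c k))) \<theta>) \<longlonglongrightarrow>
      complex_of_real (exp (- ((LBINT x:{0..t}. (f x)\<^sup>2) * \<theta>\<^sup>2 / 2)))"
    unfolding char_step_integral[OF P]
    by (intro tendsto_intros step_fun_L2_limit[OF f P lf]) simp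
  ultimately show ?thesis by (rule LIMSEQ_unique)
qed

section \<open>Existence of the Wiener integral\<close>

definition equi_part :: "real \<Rightarrow> nat \<Rightarrow> nat \<Rightarrow> real" where
  "equi_part t N i = t * real i / real N"

lemma is_partition_equi_part: "t \<ge> 0 \<Longrightarrow> N > 0 \<Longrightarrow> is_partition t N (equi_part t N)"
  by (auto simp: is_partition_def equi_part_def intro!: divide_right_mono mult_left_mono)

lemma equi_part_Suc: "equi_part t N (Suc i) - equi_part t N i = t / real N"
  by (simp add: equi_part_def field_simps flip: diff_divide_distrib)

text \<open>Each coarse cell is cut into \<open>d\<close> equal ones and the increments telescope.
  Integrals over nested partitions can thus be subtracted cell by cell.\<close>

lemma step_integral_refine:
  assumes "N > 0" "d > 0"
  shows "step_integral W N (equi_part t N) c \<omega> =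
           step_integral W (N * d) (equi_part t (N * d)) (\<lambda>i. c (i div d)) \<omega>"
proof -
  let ?q = "equi_part t (N * d)"
  have q: "?q (i * d) = equi_part t N i" for i
    using assms by (simp add: equi_part_def)
  have "step_integral W (N * d) ?q (\<lambda>i. c (i div d)) \<omega> =
      (\<Sum>i<N. \<Sum>j\<in>{i * d..<i * d + d}. c (j div d) * (W (?q (Suc j)) \<omega> - W (?q j) \<omega>))"
    unfolding step_integral_def by (rule sum.nat_group[symmetric])
  also have "\<dots> = (\<Sum>i<N. c i * (W (equi_part t N (Suc i)) \<omega> - W (equi_part t N i) \<omega>))"
  proof (intro sum.cong refl)
    fix i
    have "(\<Sum>j\<in>{i * d..<i * d + d}. c (j div d) * (W (?q (Suc j)) \<omega> - W (?q j) \<omega>)) =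
        (\<Sum>j\<in>{i * d..<i * d + d}. c i * (W (?q (Suc j)) \<omega> - W (?q j) \<omega>))"
    proof (intro sum.cong refl)
      fix j assume "j \<in> {i * d..<i * d + d}"
      then have "j div d = i"
        using assms by (intro div_nat_eqI) (auto simp: algebra_simps)
      then show "c (j div d) * (W (?q (Suc j)) \<omega> - W (?q j) \<omega>) = c i * (W (?q (Suc j)) \<omega> - W (?q j) \<omega>)"
        by simp
    qed
    also have "\<dots> = c i * (\<Sum>j\<in>{i * d..<i * d + d}. W (?q (Suc j)) \<omega> - W (?q j) \<omega>)"
      by (simp add: sum_distrib_left)
    also have "(\<Sum>j\<in>{i * d..<i * d + d}. W (?q (Suc j)) \<omega> - W (?q j) \<omega>) =
        W (?q (i * d + d)) \<omega> - W (?q (i * d)) \<omega>"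
      by (rule sum_Suc_diff') simp
    also have "\<dots> = W (?q (Suc i * d)) \<omega> - W (?q (i * d)) \<omega>" by (simp add: add.commute)
    finally show "(\<Sum>j\<in>{i * d..<i * d + d}. c (j div d) * (W (?q (Suc j)) \<omega> - W (?q j) \<omega>)) =
        c i * (W (equi_part t N (Suc i)) \<omega> - W (equi_part t N i) \<omega>)"
      by (simp only: q)
  qed
  finally show ?thesis by (simp add: step_integral_def)
qed

context brownian_motion
begin

text \<open>The Ito isometry for step functions.\<close>

lemma second_moment_step_integral:
  assumes P: "is_partition t n p"
  shows "(\<integral>\<^sup>+\<omega>. ennreal ((step_integral W n p c \<omega>)\<^sup>2) \<partial>M) = ennreal (\<Sum>i<n. (c i)\<^sup>2 * (p (Suc i) - p i))"
proof (rule second_moment_of_char[OF step_integral_measurable[OF P]])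
  show "(\<Sum>i<n. (c i)\<^sup>2 * (p (Suc i) - p i)) \<ge> 0"
    using P by (intro sum_nonneg mult_nonneg_nonneg) (auto simp: is_partition_def)
qed (rule char_step_integral[OF P])

text \<open>On the finer partition the difference is one step integral whose values are oscillations
  of \<open>f\<close> within coarse cells; the isometry bounds its second moment.\<close>

lemma equi_step_integral_dist:
  assumes t: "t \<ge> 0" and N: "N > 0" "N dvd K" "K > 0" and \<epsilon>: "\<epsilon> \<ge> 0"
    and f: "\<And>x y. x \<in> {0..t} \<Longrightarrow> y \<in> {0..t} \<Longrightarrow> \<bar>x - y\<bar> \<le> t / real N \<Longrightarrow> \<bar>f x - f y\<bar> \<le> \<epsilon>"
  defines "J \<equiv> \<lambda>N. step_integral W N (equi_part t N) (\<lambda>i. f (equi_part t N i))"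
  shows "(\<integral>\<^sup>+\<omega>. ennreal ((J K \<omega> - J N \<omega>)\<^sup>2) \<partial>M) \<le> ennreal (t * \<epsilon>\<^sup>2)"
proof -
  obtain d where K: "K = N * d" using N by auto
  then have d: "d > 0" using N by (cases d) auto
  define b where "b i = f (equi_part t K i) - f (equi_part t N (i div d))" for i
  have "J K \<omega> - J N \<omega> = step_integral W K (equi_part t K) b \<omega>" for \<omega>
    unfolding J_def step_integral_refine[OF N(1) d] K
    by (simp add: step_integral_def b_def K left_diff_distrib sum_subtractf)
  then have "(\<integral>\<^sup>+\<omega>. ennreal ((J K \<omega> - J N \<omega>)\<^sup>2) \<partial>M) =
      ennreal (\<Sum>i<K. (b i)\<^sup>2 * (equi_part t K (Suc i) - equi_part t K i))"
    using second_moment_step_integral[OF is_partition_equi_part[OF t N(3)], of b] by simp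
  also have "\<dots> \<le> ennreal (\<Sum>i<K. \<epsilon>\<^sup>2 * (t / real K))"
  proof (intro ennreal_leI sum_mono)
    fix i assume i: "i \<in> {..<K}"
    have iN: "i div d < N" using i d K by (simp add: less_mult_imp_div_less)
    have "real (i div d * d) \<le> real i" by (simp del: of_nat_mult)
    moreover have "real i \<le> real (i div d * d + d)"
      using d mod_less_divisor[of d i] div_mult_mod_eq[of i d] by linarith
    ultimately have *: "real (i div d) * real d \<le> real i" "real i \<le> real (i div d) * real d + real d"
      by simp_all
    have e: "equi_part t N (i div d) = t * (real (i div d) * real d) / real K"
      using d by (simp add: equi_part_def K)
    have "\<bar>equi_part t K i - equi_part t N (i div d)\<bar> = t * (real i - real (i div d) * real d) / real K"
      unfolding e using t * by (simp add: equi_part_def flip: diff_divide_distrib right_diff_distrib)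
    also have "\<dots> \<le> t * real d / real K"
      using t * by (intro divide_right_mono mult_left_mono) auto
    also have "\<dots> = t / real N" using d by (simp add: K)
    finally have "\<bar>b i\<bar> \<le> \<epsilon>"
      unfolding b_def using i iN
        is_partition_nonneg[OF is_partition_equi_part[OF t N(3)], of i]
        is_partition_le[OF is_partition_equi_part[OF t N(3)], of i]
        is_partition_nonneg[OF is_partition_equi_part[OF t N(1)], of "i div d"]
        is_partition_le[OF is_partition_equi_part[OF t N(1)], of "i div d"]
      by (intro f) auto
    then have "(b i)\<^sup>2 \<le> \<epsilon>\<^sup>2" using power_mono[of "\<bar>b i\<bar>" \<epsilon> 2] by simp
    then show "(b i)\<^sup>2 * (equi_part t K (Suc i) - equi_part t K i) \<le> \<epsilon>\<^sup>2 * (t / real K)"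
      unfolding equi_part_Suc using t by (intro mult_right_mono) auto
  qed
  also have "(\<Sum>i<K. \<epsilon>\<^sup>2 * (t / real K)) = t * \<epsilon>\<^sup>2" using N by simp
  finally show ?thesis .
qed

end

lemma equi_step_fun_dist:
  assumes t: "t \<ge> 0" and N: "N > 0"
    and f: "\<And>x y. x \<in> {0..t} \<Longrightarrow> y \<in> {0..t} \<Longrightarrow> \<bar>x - y\<bar> \<le> t / real N \<Longrightarrow> \<bar>f x - f y\<bar> \<le> \<epsilon>"
  shows "(\<integral>\<^sup>+x\<in>{0..t}. ennreal ((f x - step_fun N (equi_part t N) (\<lambda>i. f (equi_part t N i)) x)\<^sup>2) \<partial>lborel)
           \<le> ennreal (t * \<epsilon>\<^sup>2)"
proof -
  let ?p = "equi_part t N"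
  note P = is_partition_equi_part[OF t N]
  have eps: "\<bar>f x - step_fun N ?p (\<lambda>i. f (?p i)) x\<bar> \<le> \<epsilon>" if x: "0 < x" "x \<le> t" for x
  proof -
    let ?I = "\<lambda>i. indicator {?p i<..?p (Suc i)} x :: real"
    have mono: "?p i \<le> ?p (Suc i)" if "i < N" for i using P that by (simp add: is_partition_def)
    \<comment> \<open>Telescoping shows that every x in (0, t] lies in exactly one cell.\<close>
    have "(\<Sum>i<N. ?I i) = (\<Sum>i<N. indicator {..?p (Suc i)} x - indicator {..?p i} x)"
      using mono by (intro sum.cong) (force simp: indicator_def)+
    also have "\<dots> = indicator {..?p N} x - indicator {..?p 0} x"
      by (rule sum_lessThan_telescope)
    also have "\<dots> = 1" using x N by (simp add: equi_part_def)
    finally have one: "(\<Sum>i<N. ?I i) = 1" .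
    have "f x - step_fun N ?p (\<lambda>i. f (?p i)) x = (\<Sum>i<N. f x * ?I i) - (\<Sum>i<N. f (?p i) * ?I i)"
      using one by (simp add: step_fun_def flip: sum_distrib_left)
    also have "\<dots> = (\<Sum>i<N. (f x - f (?p i)) * ?I i)"
      by (simp add: sum_subtractf left_diff_distrib)
    also have "\<bar>\<dots>\<bar> \<le> (\<Sum>i<N. \<bar>(f x - f (?p i)) * ?I i\<bar>)" by (rule sum_abs)
    also have "\<dots> \<le> (\<Sum>i<N. \<epsilon> * ?I i)"
    proof (intro sum_mono)
      fix i assume i: "i \<in> {..<N}"
      show "\<bar>(f x - f (?p i)) * ?I i\<bar> \<le> \<epsilon> * ?I i"
      proof (cases "x \<in> {?p i<..?p (Suc i)}")
        case True
        then have "\<bar>x - ?p i\<bar> \<le> t / real N" using equi_part_Suc[of t N i] by simp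
        then have "\<bar>f x - f (?p i)\<bar> \<le> \<epsilon>"
          using x i is_partition_nonneg[OF P, of i] is_partition_le[OF P, of i] by (intro f) auto
        then show ?thesis using True by simp
      qed simp
    qed
    also have "\<dots> = \<epsilon>" using one by (simp flip: sum_distrib_left)
    finally show ?thesis .
  qed
  have "(\<integral>\<^sup>+x\<in>{0..t}. ennreal ((f x - step_fun N ?p (\<lambda>i. f (?p i)) x)\<^sup>2) \<partial>lborel) \<le>
      (\<integral>\<^sup>+x. ennreal (\<epsilon>\<^sup>2) * indicator {0..t} x \<partial>lborel)"
  proof (rule nn_integral_mono_AE)
    show "AE x in lborel. ennreal ((f x - step_fun N ?p (\<lambda>i. f (?p i)) x)\<^sup>2) * indicator {0..t} x \<le>
        ennreal (\<epsilon>\<^sup>2) * indicator {0..t} x"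
      \<comment> \<open>The point 0 belongs to no cell, the cells being open on the left.\<close>
      using AE_lborel_singleton[of 0]
    proof eventually_elim
      fix x :: real assume "x \<noteq> 0"
      then show "ennreal ((f x - step_fun N ?p (\<lambda>i. f (?p i)) x)\<^sup>2) * indicator {0..t} x \<le>
        ennreal (\<epsilon>\<^sup>2) * indicator {0..t} x"
        using power_mono[OF eps, of x 2] by (auto simp: indicator_def intro!: ennreal_leI)
    qed
  qed
  also have "\<dots> = ennreal (t * \<epsilon>\<^sup>2)"
    using t by (subst nn_integral_cmult_indicator) (auto simp: ennreal_mult'' mult.commute)
  finally show ?thesis .
qed

text \<open>Completeness with an explicit rate: the geometric bound makes the expected absolute
  increments summable, so the sequence converges almost surely, and Fatou's lemma carries the L2
  distances over to the limit.\<close>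

lemma (in prob_space) L2_limit_exists:
  fixes J :: "nat \<Rightarrow> 'a \<Rightarrow> real"
  assumes [measurable]: "\<And>k. J k \<in> borel_measurable M" and t: "t \<ge> 0"
    and dist: "\<And>k j. k \<le> j \<Longrightarrow> (\<integral>\<^sup>+\<omega>. ennreal ((J j \<omega> - J k \<omega>)\<^sup>2) \<partial>M) \<le> ennreal (t * ((1 / 2) ^ k)\<^sup>2)"
  shows "\<exists>I\<in>borel_measurable M. \<forall>k. (\<integral>\<^sup>+\<omega>. ennreal ((I \<omega> - J k \<omega>)\<^sup>2) \<partial>M) \<le> ennreal (t * ((1 / 2) ^ k)\<^sup>2)"
proof -
  have L1: "(\<integral>\<^sup>+\<omega>. ennreal \<bar>J (Suc k) \<omega> - J k \<omega>\<bar> \<partial>M) \<le> ennreal ((1 + t) * (1 / 2) ^ k)" for k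
  proof -
    let ?d = "(1 / 2 :: real) ^ k"
    have i: "integrable M (\<lambda>\<omega>. (J (Suc k) \<omega> - J k \<omega>)\<^sup>2)" "(\<integral>\<omega>. (J (Suc k) \<omega> - J k \<omega>)\<^sup>2 \<partial>M) \<le> t * ?d\<^sup>2"
      using dist[of k "Suc k"] t by (intro ennreal_integral_le[where b = "t * ?d\<^sup>2"]; simp)+
    have "(\<integral>\<^sup>+\<omega>. ennreal \<bar>J (Suc k) \<omega> - J k \<omega>\<bar> \<partial>M) \<le>
        (\<integral>\<^sup>+\<omega>. ennreal (?d + (J (Suc k) \<omega> - J k \<omega>)\<^sup>2 / ?d) \<partial>M)"
      by (intro nn_integral_mono ennreal_leI abs_le_add_square_div) simp
    also have "\<dots> = ennreal (?d + (\<integral>\<omega>. (J (Suc k) \<omega> - J k \<omega>)\<^sup>2 \<partial>M) / ?d)"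
      using i by (subst nn_integral_eq_integral) (auto simp: prob_space)
    also have "\<dots> \<le> ennreal (?d + t * ?d\<^sup>2 / ?d)"
      using i by (intro ennreal_leI add_left_mono divide_right_mono) auto
    also have "?d + t * ?d\<^sup>2 / ?d = (1 + t) * ?d" by (simp add: power2_eq_square distrib_right)
    finally show ?thesis .
  qed
  have "(\<integral>\<^sup>+\<omega>. (\<Sum>k. ennreal \<bar>J (Suc k) \<omega> - J k \<omega>\<bar>) \<partial>M) = (\<Sum>k. \<integral>\<^sup>+\<omega>. ennreal \<bar>J (Suc k) \<omega> - J k \<omega>\<bar> \<partial>M)"
    by (rule nn_integral_suminf) measurable
  also have "\<dots> \<le> (\<Sum>k. ennreal ((1 + t) * (1 / 2) ^ k))"
    by (intro suminf_le L1) auto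
  also have "\<dots> = ennreal (\<Sum>k. (1 + t) * (1 / 2) ^ k)"
    using t by (intro suminf_ennreal2 summable_mult summable_geometric) auto
  also have "\<dots> < \<infinity>" by simp
  finally have "(\<integral>\<^sup>+\<omega>. (\<Sum>k. ennreal \<bar>J (Suc k) \<omega> - J k \<omega>\<bar>) \<partial>M) \<noteq> \<infinity>" by simp
  then have "AE \<omega> in M. (\<Sum>k. ennreal \<bar>J (Suc k) \<omega> - J k \<omega>\<bar>) \<noteq> \<infinity>"
    by (intro nn_integral_PInf_AE) auto
  then have conv: "AE \<omega> in M. convergent (\<lambda>k. J k \<omega>)"
  proof eventually_elim
    fix \<omega> assume "(\<Sum>k. ennreal \<bar>J (Suc k) \<omega> - J k \<omega>\<bar>) \<noteq> \<infinity>"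
    then have "summable (\<lambda>k. \<bar>J (Suc k) \<omega> - J k \<omega>\<bar>)"
      by (intro summable_suminf_not_top) auto
    then have "summable (\<lambda>k. J (Suc k) \<omega> - J k \<omega>)" by (rule summable_rabs_cancel)
    then have "convergent (\<lambda>n. J n \<omega> - J 0 \<omega>)"
      by (simp only: summable_iff_convergent sum_lessThan_telescope[of "\<lambda>k. J k \<omega>"])
    from convergent_add[OF convergent_const[of "J 0 \<omega>"] this]
    show "convergent (\<lambda>k. J k \<omega>)" by simp
  qed
  \<comment> \<open>\<open>lim\<close> is total, so this is measurable everywhere; where the
    sequence diverges, on a null set, the value is arbitrary.\<close>
  define I where "I \<omega> = lim (\<lambda>k. J k \<omega>)" for \<omega>
  have [measurable]: "I \<in> borel_measurable M"
    unfolding I_def[abs_def] by (rule borel_measurable_lim_metric) simp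
  have "(\<integral>\<^sup>+\<omega>. ennreal ((I \<omega> - J k \<omega>)\<^sup>2) \<partial>M) \<le> ennreal (t * ((1 / 2) ^ k)\<^sup>2)" for k
  proof -
    have "(\<integral>\<^sup>+\<omega>. ennreal ((I \<omega> - J k \<omega>)\<^sup>2) \<partial>M) =
        (\<integral>\<^sup>+\<omega>. liminf (\<lambda>j. ennreal ((J j \<omega> - J k \<omega>)\<^sup>2)) \<partial>M)"
    proof (rule nn_integral_cong_AE)
      show "AE \<omega> in M. ennreal ((I \<omega> - J k \<omega>)\<^sup>2) = liminf (\<lambda>j. ennreal ((J j \<omega> - J k \<omega>)\<^sup>2))"
        using conv
      proof eventually_elim
        fix \<omega> assume "convergent (\<lambda>k. J k \<omega>)"
        then have "(\<lambda>j. J j \<omega>) \<longlonglongrightarrow> I \<omega>" by (simp add: I_def convergent_LIMSEQ_iff)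
        then have "(\<lambda>j. ennreal ((J j \<omega> - J k \<omega>)\<^sup>2)) \<longlonglongrightarrow> ennreal ((I \<omega> - J k \<omega>)\<^sup>2)"
          by (intro tendsto_intros)
        then show "ennreal ((I \<omega> - J k \<omega>)\<^sup>2) = liminf (\<lambda>j. ennreal ((J j \<omega> - J k \<omega>)\<^sup>2))"
          by (intro lim_imp_Liminf[symmetric]) auto
      qed
    qed
    also have "\<dots> \<le> liminf (\<lambda>j. \<integral>\<^sup>+\<omega>. ennreal ((J j \<omega> - J k \<omega>)\<^sup>2) \<partial>M)"
      by (rule nn_integral_liminf) measurable
    also have "\<dots> \<le> liminf (\<lambda>j::nat. ennreal (t * ((1 / 2) ^ k)\<^sup>2))"
      using dist by (intro Liminf_mono) (auto simp: eventually_sequentially)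
    also have "\<dots> = ennreal (t * ((1 / 2) ^ k)\<^sup>2)" by (simp add: Liminf_const)
    finally show ?thesis .
  qed
  then show ?thesis by (intro bexI[of _ I]) auto
qed

lemma (in brownian_motion) has_wiener_integral_exists:
  assumes t: "t \<ge> 0" and f: "continuous_on {0..t} f"
  shows "\<exists>I. has_wiener_integral M W t f I"
proof -
  have "\<exists>m. \<forall>x\<in>{0..t}. \<forall>y\<in>{0..t}. \<bar>x - y\<bar> \<le> t / 2 ^ m \<longrightarrow> \<bar>f x - f y\<bar> \<le> (1 / 2) ^ k" for k :: nat
  proof -
    have "uniformly_continuous_on {0..t} f" using f by (intro compact_uniformly_continuous) auto
    moreover have "(1 / 2 :: real) ^ k > 0" by simp
    ultimately obtain d where d: "d > 0" "\<forall>y\<in>{0..t}. \<forall>x\<in>{0..t}. dist x y < d \<longrightarrow> dist (f x) (f y) < (1 / 2) ^ k"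
      unfolding uniformly_continuous_on_def by blast
    have osc: "\<bar>f x - f y\<bar> \<le> (1 / 2) ^ k" if "x \<in> {0..t}" "y \<in> {0..t}" "\<bar>x - y\<bar> < d" for x y
      using d(2)[rule_format, OF that(2,1)] that(3) by (simp add: dist_real_def)
    obtain m :: nat where "t / d < 2 ^ m"
      using real_arch_pow[of 2 "t / d"] by auto
    then have "t / 2 ^ m < d" using d by (simp add: field_simps)
    then show ?thesis using osc by (meson order.strict_trans1)
  qed
  then obtain m where m: "\<And>k x y. x \<in> {0..t} \<Longrightarrow> y \<in> {0..t} \<Longrightarrow> \<bar>x - y\<bar> \<le> t / 2 ^ m k \<Longrightarrow> \<bar>f x - f y\<bar> \<le> (1 / 2) ^ k"
    by metis
  \<comment> \<open>Accumulated exponents make each \<open>N k\<close> divide all later ones, while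
    the summand \<open>m k\<close> alone already makes the mesh fine enough for accuracy
    (1/2)^k.\<close>
  define N where "N k = (2 :: nat) ^ (\<Sum>j\<le>k. m j)" for k
  have N0: "N k > 0" for k by (simp add: N_def)
  have Ndvd: "N k dvd N j" if "k \<le> j" for k j
    unfolding N_def using that by (intro le_imp_power_dvd sum_mono2) auto
  have osc: "\<bar>f x - f y\<bar> \<le> (1 / 2) ^ k"
    if "x \<in> {0..t}" "y \<in> {0..t}" "\<bar>x - y\<bar> \<le> t / real (N k)" for k x y
  proof (rule m[OF that(1,2)])
    have "m k \<le> (\<Sum>j\<le>k. m j)" by (rule member_le_sum) auto
    then have "(2::real) ^ m k \<le> real (N k)" unfolding N_def by simp
    then have "t / real (N k) \<le> t / 2 ^ m k" using t by (intro divide_left_mono) (auto simp: N_def)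
    then show "\<bar>x - y\<bar> \<le> t / 2 ^ m k" using that(3) by simp
  qed
  define p where "p k = equi_part t (N k)" for k
  define c where "c k i = f (p k i)" for k i
  have P: "is_partition t (N k) (p k)" for k
    unfolding p_def using t N0 by (rule is_partition_equi_part)
  have "\<exists>I\<in>borel_measurable M. \<forall>k. (\<integral>\<^sup>+\<omega>. ennreal ((I \<omega> - step_integral W (N k) (p k) (c k) \<omega>)\<^sup>2) \<partial>M)
      \<le> ennreal (t * ((1 / 2) ^ k)\<^sup>2)"
  proof (rule L2_limit_exists[OF step_integral_measurable[OF P] t])
    fix k j :: nat assume "k \<le> j"
    then show "(\<integral>\<^sup>+\<omega>. ennreal ((step_integral W (N j) (p j) (c j) \<omega> - step_integral W (N k) (p k) (c k) \<omega>)\<^sup>2) \<partial>M)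
        \<le> ennreal (t * ((1 / 2) ^ k)\<^sup>2)"
      unfolding p_def c_def[abs_def] by (intro equi_step_integral_dist t N0 Ndvd osc) auto
  qed
  then obtain I where I: "I \<in> borel_measurable M"
    "\<And>k. (\<integral>\<^sup>+\<omega>. ennreal ((I \<omega> - step_integral W (N k) (p k) (c k) \<omega>)\<^sup>2) \<partial>M) \<le> ennreal (t * ((1 / 2) ^ k)\<^sup>2)"
    by blast
  have F: "(\<integral>\<^sup>+x\<in>{0..t}. ennreal ((f x - step_fun (N k) (p k) (c k) x)\<^sup>2) \<partial>lborel) \<le> ennreal (t * ((1 / 2) ^ k)\<^sup>2)" for k
    unfolding p_def c_def[abs_def] by (intro equi_step_fun_dist t N0 osc)
  have "(\<lambda>k. t * ((1 / 2) ^ k)\<^sup>2) \<longlonglongrightarrow> t * 0\<^sup>2"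
    by (intro tendsto_intros LIMSEQ_power_zero) auto
  then have lim: "(\<lambda>k. ennreal (t * ((1 / 2) ^ k)\<^sup>2)) \<longlonglongrightarrow> 0"
    using tendsto_ennrealI by fastforce
  have "(\<lambda>k. \<integral>\<^sup>+x\<in>{0..t}. ennreal ((f x - step_fun (N k) (p k) (c k) x)\<^sup>2) \<partial>lborel) \<longlonglongrightarrow> 0"
    by (rule tendsto_sandwich[OF _ _ tendsto_const lim]) (auto intro!: always_eventually F)
  moreover have "(\<lambda>k. \<integral>\<^sup>+\<omega>. ennreal ((I \<omega> - step_integral W (N k) (p k) (c k) \<omega>)\<^sup>2) \<partial>M) \<longlonglongrightarrow> 0"
    by (rule tendsto_sandwich[OF _ _ tendsto_const lim]) (auto intro!: always_eventually I)
  moreover have "set_borel_measurable lborel {0..t} f"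
    unfolding set_borel_measurable_def using borel_measurable_continuous_on_indicator[OF _ f] by simp
  ultimately show ?thesis
    unfolding has_wiener_integral_def using P I(1) by blast
qed

lemma (in brownian_motion) char_wiener_integral_continuous:
  assumes "t \<ge> 0" "continuous_on {0..t} f"
  shows "wiener_integral M W t f \<in> borel_measurable M"
    and "char (distr M borel (wiener_integral M W t f)) \<theta> =
           complex_of_real (exp (- ((LBINT x:{0..t}. (f x)\<^sup>2) * \<theta>\<^sup>2 / 2)))"
proof -
  have "has_wiener_integral M W t f (wiener_integral M W t f)"
    unfolding wiener_integral_def using has_wiener_integral_exists[OF assms] by (rule someI_ex)
  then show "char (distr M borel (wiener_integral M W t f)) \<theta> =
      complex_of_real (exp (- ((LBINT x:{0..t}. (f x)\<^sup>2) * \<theta>\<^sup>2 / 2)))"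
    and "wiener_integral M W t f \<in> borel_measurable M"
    using char_wiener_integral[OF assms(2)] by (auto simp: has_wiener_integral_def)
qed

section \<open>Square integrability of the mean resolvent\<close>

lemma mittag_leffler_measurable [measurable]:
  assumes "\<rho> \<ge> 1" "b > 0"
  shows "mittag_leffler \<rho> b \<in> borel_measurable borel"
  using isCont_mittag_leffler[OF assms]
  by (intro borel_measurable_continuous_onI continuous_at_imp_continuous_on) auto

text \<open>The nonnegative integral of w (A y - B)^2 expands to A (A C - B^2), and A > 0 can be
  cancelled.\<close>

lemma weighted_Cauchy_Schwarz:
  fixes w y :: "'a \<Rightarrow> real"
  assumes w: "integrable M w" "\<And>x. w x \<ge> 0" "integral\<^sup>L M w > 0"
    and wy: "integrable M (\<lambda>x. w x * y x)" and wyy: "integrable M (\<lambda>x. w x * (y x)\<^sup>2)"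
  shows "(\<integral>x. w x * y x \<partial>M)\<^sup>2 \<le> integral\<^sup>L M w * (\<integral>x. w x * (y x)\<^sup>2 \<partial>M)"
proof -
  define A B C where "A = integral\<^sup>L M w" and "B = (\<integral>x. w x * y x \<partial>M)" and "C = (\<integral>x. w x * (y x)\<^sup>2 \<partial>M)"
  have "0 \<le> (\<integral>x. w x * (A * y x - B)\<^sup>2 \<partial>M)"
    using w by (intro integral_nonneg_AE) auto
  also have "(\<lambda>x. w x * (A * y x - B)\<^sup>2) = (\<lambda>x. A\<^sup>2 * (w x * (y x)\<^sup>2) - 2 * A * B * (w x * y x) + B\<^sup>2 * w x)"
    by (simp add: fun_eq_iff power2_diff algebra_simps power_mult_distrib power2_eq_square)
  also have "integral\<^sup>L M \<dots> = A\<^sup>2 * C - 2 * A * B * B + B\<^sup>2 * A"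
    unfolding A_def[symmetric] B_def C_def using w wy wyy by (simp add: A_def)
  also have "\<dots> = A * (A * C - B\<^sup>2)" by (simp add: algebra_simps power2_eq_square)
  finally have "A * C - B\<^sup>2 \<ge> 0" using w(3) by (simp add: A_def zero_le_mult_iff)
  then show ?thesis by (simp add: A_def B_def C_def)
qed

section \<open>Moments of the Gamma density\<close>

lemma gamma_density_measurable [measurable]: "gamma_density \<mu> lam \<in> borel_measurable borel"
  unfolding gamma_density_def[abs_def] by measurable

lemma gamma_density_eq:
  assumes "lam > 0"
  shows "gamma_density \<mu> lam x = lam powr \<mu> / Gamma \<mu> * (indicator {0..} x * (x powr (\<mu> - 1) * exp (- lam * x)))"
proof (cases "x > 0")
  case True
  have "lam powr \<mu> = lam * lam powr (\<mu> - 1)" using assms by (simp add: powr_mult_base)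
  then show ?thesis using True assms by (simp add: gamma_density_def powr_mult)
qed (auto simp: gamma_density_def indicator_def)

lemma gamma_density_nonneg [simp]: "lam > 0 \<Longrightarrow> \<mu> > 0 \<Longrightarrow> gamma_density \<mu> lam x \<ge> 0"
  using Gamma_real_pos[of \<mu>] by (simp add: gamma_density_def)

lemma gamma_density_moment:
  assumes "lam > 0" "\<mu> + s > 0"
  shows "has_bochner_integral lborel (\<lambda>x. gamma_density \<mu> lam x * x powr s)
           (lam powr (- s) * Gamma (\<mu> + s) / Gamma \<mu>)"
proof -
  have "has_bochner_integral lborel
      (\<lambda>x. lam powr \<mu> / Gamma \<mu> * (indicator {0..} x * (x powr (\<mu> + s - 1) * exp (- lam * x))))
      (lam powr \<mu> / Gamma \<mu> * (Gamma (\<mu> + s) * lam powr (- (\<mu> + s))))"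
    using assms by (intro has_bochner_integral_mult_right has_bochner_integral_Gamma) auto
  also have "(\<lambda>x. lam powr \<mu> / Gamma \<mu> * (indicator {0..} x * (x powr (\<mu> + s - 1) * exp (- lam * x)))) =
      (\<lambda>x. gamma_density \<mu> lam x * x powr s)"
  proof
    fix x :: real
    have "x powr (\<mu> + s - 1) = x powr (\<mu> - 1) * x powr s"
      by (simp flip: powr_add add: algebra_simps)
    then show "lam powr \<mu> / Gamma \<mu> * (indicator {0..} x * (x powr (\<mu> + s - 1) * exp (- lam * x))) =
        gamma_density \<mu> lam x * x powr s"
      by (simp add: gamma_density_eq[OF assms(1)])
  qed
  also have "lam powr \<mu> / Gamma \<mu> * (Gamma (\<mu> + s) * lam powr (- (\<mu> + s))) =
      lam powr (- s) * Gamma (\<mu> + s) / Gamma \<mu>"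
  proof -
    have "lam powr (- s) = lam powr \<mu> * lam powr (- (\<mu> + s))" by (simp flip: powr_add)
    then show ?thesis by simp
  qed
  finally show ?thesis .
qed

lemma gamma_density_integral:
  assumes "lam > 0" "\<mu> > 0"
  shows "has_bochner_integral lborel (gamma_density \<mu> lam) 1"
proof -
  have "(\<lambda>x. gamma_density \<mu> lam x * x powr 0) = gamma_density \<mu> lam"
    by (auto simp: fun_eq_iff gamma_density_def)
  then show ?thesis
    using gamma_density_moment[of lam \<mu> 0] assms Gamma_real_pos[OF assms(2), THEN less_imp_neq] by simp
qed

lemma LBINT_dilation:
  fixes f :: "real \<Rightarrow> real"
  assumes "c > 0"
  shows "(LBINT t:{0..T}. f (c * t)) = (LBINT t:{0..c * T}. f t) / c"
proof -
  have "(\<integral>x. indicator {0..c * T} x *\<^sub>R f x \<partial>lborel) =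
      \<bar>c\<bar> *\<^sub>R (\<integral>x. indicator {0..c * T} (0 + c * x) *\<^sub>R f (0 + c * x) \<partial>lborel)"
    using assms by (intro lborel_integral_real_affine) auto
  also have "(\<lambda>x. indicator {0..c * T} (0 + c * x) *\<^sub>R f (0 + c * x)) = (\<lambda>x. indicator {0..T} x *\<^sub>R f (c * x))"
    using assms by (auto simp: fun_eq_iff indicator_def zero_le_mult_iff)
  finally show ?thesis using assms by (simp add: set_lebesgue_integral_def field_simps)
qed

text \<open>Up to a constant and an exponential the integrand is x to the power 2 \<mu> - 3/2,
  integrable at 0 exactly for \<mu> > 1/4.\<close>

lemma gamma_density_square_sqrt:
  assumes "lam > 0" "\<mu> > 1 / 4"
  shows "\<exists>D\<ge>0. (\<integral>\<^sup>+x. ennreal ((gamma_density \<mu> lam x)\<^sup>2 * sqrt x) \<partial>lborel) = ennreal D"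
proof -
  let ?c = "(lam powr \<mu> / Gamma \<mu>)\<^sup>2"
  have "has_bochner_integral lborel
      (\<lambda>x. ?c * (indicator {0..} x * (x powr (2 * \<mu> - 1 / 2 - 1) * exp (- (2 * lam) * x))))
      (?c * (Gamma (2 * \<mu> - 1 / 2) * (2 * lam) powr (- (2 * \<mu> - 1 / 2))))"
    using assms by (intro has_bochner_integral_mult_right has_bochner_integral_Gamma) auto
  also have "(\<lambda>x. ?c * (indicator {0..} x * (x powr (2 * \<mu> - 1 / 2 - 1) * exp (- (2 * lam) * x)))) =
      (\<lambda>x. (gamma_density \<mu> lam x)\<^sup>2 * sqrt x)"
  proof
    fix x :: real
    show "?c * (indicator {0..} x * (x powr (2 * \<mu> - 1 / 2 - 1) * exp (- (2 * lam) * x))) =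
      (gamma_density \<mu> lam x)\<^sup>2 * sqrt x"
    proof (cases "x > 0")
      case True
      have "x powr (2 * \<mu> - 1 / 2 - 1) = x powr ((\<mu> - 1) + (\<mu> - 1) + 1 / 2)"
        by (rule arg_cong[of _ _ "\<lambda>z. x powr z"]) simp
      also have "\<dots> = (x powr (\<mu> - 1))\<^sup>2 * sqrt x"
        using True by (simp only: powr_add power2_eq_square powr_half_sqrt less_imp_le)
      finally have 1: "x powr (2 * \<mu> - 1 / 2 - 1) = (x powr (\<mu> - 1))\<^sup>2 * sqrt x" .
      have 2: "exp (- (2 * lam) * x) = (exp (- lam * x))\<^sup>2"
        by (simp add: power2_eq_square flip: exp_add)
      show ?thesis
        unfolding gamma_density_eq[OF assms(1)] 1 2 using True by (simp add: power_mult_distrib power_divide)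
    qed (auto simp: gamma_density_def indicator_def)
  qed
  finally have b: "has_bochner_integral lborel (\<lambda>x. (gamma_density \<mu> lam x)\<^sup>2 * sqrt x)
      (?c * (Gamma (2 * \<mu> - 1 / 2) * (2 * lam) powr (- (2 * \<mu> - 1 / 2))))" (is "has_bochner_integral _ _ ?D") .
  have nn: "(gamma_density \<mu> lam x)\<^sup>2 * sqrt x \<ge> 0" for x
    by (cases "x > 0") (auto simp: gamma_density_def)
  have "(\<integral>\<^sup>+x. ennreal ((gamma_density \<mu> lam x)\<^sup>2 * sqrt x) \<partial>lborel) = ennreal ?D"
    using b nn by (subst nn_integral_eq_integral) (auto simp: has_bochner_integral_iff)
  moreover have "?D \<ge> 0" using assms by (simp add: Gamma_real_nonneg)
  ultimately show ?thesis by blast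
qed

lemma exp_cos_integral:
  fixes \<epsilon> c :: real
  assumes \<epsilon>: "\<epsilon> > 0"
  shows "has_bochner_integral lborel (\<lambda>t. indicator {0<..} t * (exp (- \<epsilon> * t) * cos (c * t)))
           (\<epsilon> / (\<epsilon>\<^sup>2 + c\<^sup>2))"
proof -
  \<comment> \<open>The real part of the antiderivative of exp((- \<epsilon> + i c) t).\<close>
  define F where "F t = exp (- \<epsilon> * t) * (c * sin (c * t) - \<epsilon> * cos (c * t)) / (\<epsilon>\<^sup>2 + c\<^sup>2)" for t
  let ?f = "\<lambda>t. exp (- \<epsilon> * t) * cos (c * t)"
  have pos: "\<epsilon>\<^sup>2 + c\<^sup>2 > 0" using \<epsilon> by (intro add_pos_nonneg) auto
  have int: "set_integrable lborel {0<..} ?f"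
  proof (rule set_integrable_bound)
    show "set_integrable lborel {0<..} (\<lambda>x. exp (- (x * \<epsilon>)))"
      by (rule integrable_I0i_exp_mscale[OF \<epsilon>])
    show "AE x in lborel. x \<in> {0<..} \<longrightarrow> norm (exp (- \<epsilon> * x) * cos (c * x)) \<le> norm (exp (- (x * \<epsilon>)))"
      by (intro AE_I2) (auto simp: abs_mult mult.commute intro: mult_left_le)
  qed (simp add: set_borel_measurable_def)
  have "(LBINT t=0..\<infinity>. ?f t) = 0 - F 0"
  proof (rule interval_integral_FTC_integrable)
    show "set_integrable lborel (einterval 0 \<infinity>) ?f"
      using int by (simp add: zero_ereal_def)
    fix x :: real
    have "((\<lambda>t. exp (- \<epsilon> * t) * (c * sin (c * t) - \<epsilon> * cos (c * t))) has_real_derivative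
        ?f x * (\<epsilon>\<^sup>2 + c\<^sup>2)) (at x)"
      by (auto intro!: derivative_eq_intros simp: algebra_simps power2_eq_square)
    from DERIV_cdivide[OF this, of "\<epsilon>\<^sup>2 + c\<^sup>2"] have "(F has_real_derivative ?f x) (at x)"
      unfolding F_def[abs_def] using pos \<epsilon> by simp
    then show "(F has_vector_derivative ?f x) (at x)"
      by (simp add: has_real_derivative_iff_has_vector_derivative)
    show "isCont ?f x" by (intro continuous_intros)
  next
    have "isCont F 0" unfolding F_def using pos by (intro continuous_intros) auto
    then show "((F \<circ> real_of_ereal) \<longlongrightarrow> F 0) (at_right 0)"
      unfolding zero_ereal_def ereal_tendsto_simps by (simp add: isCont_def filterlim_at_split)
    have "(F \<longlongrightarrow> 0) at_top"
    proof (rule Lim_null_comparison)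
      let ?K = "(\<bar>c\<bar> + \<epsilon>) / (\<epsilon>\<^sup>2 + c\<^sup>2)"
      show "\<forall>\<^sub>F t in at_top. norm (F t) \<le> ?K * exp (- \<epsilon> * t)"
      proof (rule always_eventually, rule allI)
        fix t
        have "\<bar>c * sin (c * t) - \<epsilon> * cos (c * t)\<bar> \<le> \<bar>c * sin (c * t)\<bar> + \<bar>\<epsilon> * cos (c * t)\<bar>"
          by (rule abs_triangle_ineq4)
        also have "\<dots> \<le> \<bar>c\<bar> * 1 + \<epsilon> * 1"
          unfolding abs_mult using \<epsilon> by (intro add_mono mult_mono) auto
        finally show "norm (F t) \<le> ?K * exp (- \<epsilon> * t)"
          unfolding F_def using pos
          by (simp add: abs_mult divide_right_mono mult_left_mono mult.commute[of _ "exp _"])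
      qed
      have "((\<lambda>t. exp (- \<epsilon> * t)) \<longlongrightarrow> 0) at_top"
        using \<epsilon>
        by (intro filterlim_compose[OF exp_at_bot] filterlim_tendsto_neg_mult_at_bot[OF tendsto_const _ filterlim_ident]) auto
      then show "((\<lambda>t. ?K * exp (- \<epsilon> * t)) \<longlongrightarrow> 0) at_top" by (rule tendsto_mult_right_zero)
    qed
    then show "((F \<circ> real_of_ereal) \<longlongrightarrow> 0) (at_left \<infinity>)"
      unfolding ereal_tendsto_simps .
  qed simp
  then have "(LBINT t:{0<..}. ?f t) = \<epsilon> / (\<epsilon>\<^sup>2 + c\<^sup>2)"
    by (simp add: interval_lebesgue_integral_0_infty F_def)
  then show ?thesis
    using int by (simp add: has_bochner_integral_iff set_lebesgue_integral_def set_integrable_def)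
qed

text \<open>In the variable z = sqrt y the measure dy / sqrt y is 2 dz, so an arctangent is an
  antiderivative. The bound depends neither on \<open>a\<close> nor on \<epsilon>, which is what
  allows \<epsilon> to vary with the time horizon.\<close>

lemma Poisson_kernel_sqrt_integral:
  fixes \<epsilon> a :: real
  assumes \<epsilon>: "\<epsilon> > 0"
  shows "(\<integral>\<^sup>+y. ennreal (indicator {0<..} y * (\<epsilon> / (\<epsilon>\<^sup>2 + (sqrt y - a)\<^sup>2) / sqrt y)) \<partial>lborel) \<le> ennreal (2 * pi)"
proof -
  let ?f = "\<lambda>y. \<epsilon> / (\<epsilon>\<^sup>2 + (sqrt y - a)\<^sup>2) / sqrt y"
  define F where "F y = 2 * arctan ((sqrt y - a) / \<epsilon>)" for y
  have pos: "\<epsilon>\<^sup>2 + (sqrt y - a)\<^sup>2 > 0" for y using \<epsilon> by (intro add_pos_nonneg) auto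
  have D: "(F has_real_derivative ?f y) (at y)" if "y > 0" for y
  proof -
    have "(F has_real_derivative 2 * (inverse (1 + ((sqrt y - a) / \<epsilon>)\<^sup>2) * (inverse (sqrt y) / 2 / \<epsilon>))) (at y)"
      unfolding F_def using that \<epsilon> by (auto intro!: derivative_eq_intros)
    also have "2 * (inverse (1 + ((sqrt y - a) / \<epsilon>)\<^sup>2) * (inverse (sqrt y) / 2 / \<epsilon>)) = ?f y"
    proof -
      have "1 + ((sqrt y - a) / \<epsilon>)\<^sup>2 = (\<epsilon>\<^sup>2 + (sqrt y - a)\<^sup>2) / \<epsilon>\<^sup>2"
        using \<epsilon> by (simp add: power_divide add_divide_distrib)
      moreover have "2 * (inverse (X / \<epsilon>\<^sup>2) * (inverse z / 2 / \<epsilon>)) = \<epsilon> / X / z" if "X > 0" "z > 0" for X z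
        using that \<epsilon> by (simp add: field_simps power2_eq_square)
      ultimately show ?thesis using that pos[of y] by simp
    qed
    finally show ?thesis .
  qed
  have A: "((F \<circ> real_of_ereal) \<longlongrightarrow> F 0) (at_right 0)"
  proof -
    have "isCont F 0" unfolding F_def using \<epsilon> by (intro continuous_intros) auto
    then show ?thesis
      unfolding zero_ereal_def ereal_tendsto_simps by (simp add: isCont_def filterlim_at_split)
  qed
  have B: "((F \<circ> real_of_ereal) \<longlongrightarrow> pi) (at_left \<infinity>)"
  proof -
    have "filterlim (\<lambda>y. (- a + sqrt y) / \<epsilon>) at_top at_top"
      using \<epsilon> unfolding divide_inverse
      by (intro filterlim_at_top_mult_tendsto_pos[OF tendsto_const _]
          filterlim_tendsto_add_at_top[OF tendsto_const sqrt_at_top]) auto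
    then have "((\<lambda>y. arctan ((sqrt y - a) / \<epsilon>)) \<longlongrightarrow> pi / 2) at_top"
      using filterlim_compose[OF tendsto_arctan_at_top] by fastforce
    then have "(F \<longlongrightarrow> 2 * (pi / 2)) at_top"
      unfolding F_def[abs_def] by (intro tendsto_intros)
    then show ?thesis unfolding ereal_tendsto_simps by simp
  qed
  have cont: "isCont ?f y" if "y > 0" for y
    using that pos[of y] by (intro continuous_intros) auto
  have nonneg: "?f y \<ge> 0" if "y > 0" for y using that \<epsilon> pos[of y] by simp
  have "set_integrable lborel (einterval 0 \<infinity>) ?f" "(LBINT y=0..\<infinity>. ?f y) = pi - F 0"
    using D cont nonneg A B
    by (intro interval_integral_FTC_nonneg[where F = F]; (simp add: zero_ereal_def)?)+
  note FTC = this
  have "integrable lborel (\<lambda>y. indicator {0<..} y * ?f y)"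
    using FTC(1) by (simp add: set_integrable_def zero_ereal_def)
  moreover have "(\<integral>y. indicator {0<..} y * ?f y \<partial>lborel) = pi - F 0"
    using FTC(2) by (simp add: interval_lebesgue_integral_0_infty set_lebesgue_integral_def)
  ultimately have "(\<integral>\<^sup>+y. ennreal (indicator {0<..} y * ?f y) \<partial>lborel) = ennreal (pi - F 0)"
    using nonneg by (subst nn_integral_eq_integral) (auto simp: indicator_def)
  also have "\<dots> \<le> ennreal (2 * pi)"
    using arctan_lbound[of "- a / \<epsilon>"] by (intro ennreal_leI) (simp add: F_def)
  finally show ?thesis .
qed

section \<open>The mean resolvent\<close>

context
  fixes \<rho> lam \<mu> :: real
  assumes \<rho>: "1 < \<rho>" "\<rho> \<le> 2" and lam: "lam > 0" and \<mu>: "\<mu> > 1 / (2 * \<rho>)"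
begin

text \<open>The closed form is used in place of the description by the Volterra equation, since it
  shows joint measurability and the scaling law directly.\<close>

definition resolvent :: "real \<Rightarrow> real \<Rightarrow> real" where
  "resolvent x t = mittag_leffler \<rho> 1 (- x * t powr \<rho>)"

definition mean_resolvent :: "real \<Rightarrow> real" where
  "mean_resolvent t = (\<integral>x. gamma_density \<mu> lam x * resolvent x t \<partial>lborel)"

lemma mu_pos: "\<mu> > 0"
proof -
  have "1 / (2 * \<rho>) > 0" using \<rho> by simp
  then show ?thesis using \<mu> by linarith
qed

lemma resolvent_measurable [measurable]:
  assumes [measurable]: "f \<in> borel_measurable N" "g \<in> borel_measurable N"
  shows "(\<lambda>x. resolvent (f x) (g x)) \<in> borel_measurable N"
proof -
  have [measurable]: "mittag_leffler \<rho> 1 \<in> borel_measurable borel"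
    using \<rho> by (intro mittag_leffler_measurable) auto
  show ?thesis unfolding resolvent_def by measurable
qed

lemma resolvent_scale:
  assumes "x > 0" "t \<ge> 0"
  shows "resolvent x t = resolvent 1 (x powr (1 / \<rho>) * t)"
  using assms \<rho> by (simp add: resolvent_def powr_mult powr_powr)

lemma resolvent_2: "\<rho> = 2 \<Longrightarrow> x > 0 \<Longrightarrow> t \<ge> 0 \<Longrightarrow> resolvent x t = cos (sqrt x * t)"
  unfolding resolvent_def using scalar_resolvent_eq[of 2 t x] scalar_resolvent_2[of x t] by simp

lemma abs_resolvent_le_1:
  assumes "x > 0" "t \<ge> 0"
  shows "\<bar>resolvent x t\<bar> \<le> 1"
proof (cases "\<rho> = 2")
  case True
  then show ?thesis using resolvent_2[OF True assms] by simp
next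
  case False
  then have "\<rho> < 2" using \<rho> by simp
  from mittag_leffler_bounded[OF \<rho>(1) this, of "x powr (1 / \<rho>) * t"] show ?thesis
    unfolding resolvent_scale[OF assms] using assms by (simp add: resolvent_def)
qed

lemma density_resolvent_le: "t \<ge> 0 \<Longrightarrow> \<bar>gamma_density \<mu> lam x * resolvent x t\<bar> \<le> gamma_density \<mu> lam x"
proof (cases "x > 0")
  case True
  assume "t \<ge> 0"
  then have "gamma_density \<mu> lam x * \<bar>resolvent x t\<bar> \<le> gamma_density \<mu> lam x * 1"
    using abs_resolvent_le_1[OF True] lam mu_pos by (intro mult_left_mono) auto
  then show ?thesis using lam mu_pos by (simp add: abs_mult)
qed (simp add: gamma_density_def)

lemma gamma_density_integrable: "integrable lborel (gamma_density \<mu> lam)"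
  using gamma_density_integral[OF lam mu_pos] by (simp add: has_bochner_integral_iff)

lemma density_resolvent_integrable:
  "t \<ge> 0 \<Longrightarrow> integrable lborel (\<lambda>x. gamma_density \<mu> lam x * resolvent x t)"
  by (rule Bochner_Integration.integrable_bound[OF gamma_density_integrable])
     (use density_resolvent_le lam mu_pos in auto)

lemma mean_resolvent_0: "mean_resolvent 0 = 1"
  using gamma_density_integral[OF lam mu_pos]
  by (simp add: mean_resolvent_def resolvent_def mittag_leffler_0 has_bochner_integral_iff)

lemma abs_mean_resolvent_le_1: "t \<ge> 0 \<Longrightarrow> \<bar>mean_resolvent t\<bar> \<le> 1"
proof -
  assume t: "t \<ge> 0"
  have "\<bar>mean_resolvent t\<bar> \<le> (\<integral>x. \<bar>gamma_density \<mu> lam x * resolvent x t\<bar> \<partial>lborel)"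
    unfolding mean_resolvent_def by (rule integral_abs_bound)
  also have "\<dots> \<le> (\<integral>x. gamma_density \<mu> lam x \<partial>lborel)"
    using density_resolvent_integrable[OF t] gamma_density_integrable density_resolvent_le[OF t]
    by (intro Bochner_Integration.integral_mono) auto
  also have "\<dots> = 1" using gamma_density_integral[OF lam mu_pos] by (simp add: has_bochner_integral_iff)
  finally show ?thesis .
qed

lemma continuous_on_mean_resolvent: "continuous_on {0..} mean_resolvent"
proof (rule continuous_on_sequentiallyI)
  fix u :: "nat \<Rightarrow> real" and a assume u: "\<forall>n. u n \<in> {0..}" and a: "a \<in> {0..}" and lim: "u \<longlonglongrightarrow> a"
  show "(\<lambda>n. mean_resolvent (u n)) \<longlonglongrightarrow> mean_resolvent a"
    unfolding mean_resolvent_def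
  proof (rule integral_dominated_convergence[OF _ _ gamma_density_integrable])
    show "AE x in lborel. (\<lambda>n. gamma_density \<mu> lam x * resolvent x (u n)) \<longlonglongrightarrow> gamma_density \<mu> lam x * resolvent x a"
    proof (rule AE_I2)
      fix x :: real
      have "continuous_on {0..} (resolvent x)"
        unfolding resolvent_def[abs_def] using \<rho> by (intro continuous_on_mittag_leffler_powr) auto
      then have "(\<lambda>n. resolvent x (u n)) \<longlonglongrightarrow> resolvent x a"
        using u a lim by (auto simp: continuous_on_sequentially o_def)
      then show "(\<lambda>n. gamma_density \<mu> lam x * resolvent x (u n)) \<longlonglongrightarrow> gamma_density \<mu> lam x * resolvent x a"
        by (intro tendsto_intros)
    qed
    show "AE x in lborel. norm (gamma_density \<mu> lam x * resolvent x (u n)) \<le> gamma_density \<mu> lam x" for n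
      using density_resolvent_le u by (intro AE_I2) auto
  qed measurable
qed

text \<open>Cauchy-Schwarz with weight p(x) x^(-\<kappa>) and function x^\<kappa> times the
  resolvent. Boundedness of the resolvent and \<kappa> < \<mu> make all integrals finite.\<close>

lemma mean_resolvent_square_le:
  fixes \<kappa> :: real
  assumes \<kappa>: "0 < \<kappa>" "\<kappa> < \<mu>" and t: "t \<ge> 0"
  shows "(mean_resolvent t)\<^sup>2 \<le> (\<integral>x. gamma_density \<mu> lam x * x powr (- \<kappa>) \<partial>lborel) *
           (\<integral>x. gamma_density \<mu> lam x * x powr \<kappa> * (resolvent x t)\<^sup>2 \<partial>lborel)"
proof -
  let ?p = "gamma_density \<mu> lam"
  have p0: "?p x = 0" if "x \<le> 0" for x using that by (simp add: gamma_density_def)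
  have eq1: "?p x * x powr (- \<kappa>) * (x powr \<kappa> * resolvent x t) = ?p x * resolvent x t" for x
    by (cases "x > 0") (auto simp: p0 powr_minus)
  have eq2: "?p x * x powr (- \<kappa>) * (x powr \<kappa> * resolvent x t)\<^sup>2 = ?p x * x powr \<kappa> * (resolvent x t)\<^sup>2" for x
    by (cases "x > 0") (auto simp: p0 powr_minus power2_eq_square)
  have m: "has_bochner_integral lborel (\<lambda>x. ?p x * x powr (- \<kappa>)) (lam powr \<kappa> * Gamma (\<mu> - \<kappa>) / Gamma \<mu>)"
    using gamma_density_moment[OF lam, of \<mu> "- \<kappa>"] \<kappa> by simp
  have k: "integrable lborel (\<lambda>x. ?p x * x powr \<kappa>)"
    using gamma_density_moment[OF lam, of \<mu> "\<kappa>"] \<kappa> by (auto simp: has_bochner_integral_iff)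
  have "(\<integral>x. ?p x * x powr (- \<kappa>) * (x powr \<kappa> * resolvent x t) \<partial>lborel)\<^sup>2 \<le>
      (\<integral>x. ?p x * x powr (- \<kappa>) \<partial>lborel) * (\<integral>x. ?p x * x powr (- \<kappa>) * (x powr \<kappa> * resolvent x t)\<^sup>2 \<partial>lborel)"
  proof (rule weighted_Cauchy_Schwarz)
    show "integrable lborel (\<lambda>x. ?p x * x powr (- \<kappa>))" using m by (simp add: has_bochner_integral_iff)
    show "?p x * x powr (- \<kappa>) \<ge> 0" for x using lam mu_pos by simp
    show "(\<integral>x. ?p x * x powr (- \<kappa>) \<partial>lborel) > 0"
      using m \<kappa> mu_pos lam by (simp add: has_bochner_integral_iff Gamma_real_pos)
    show "integrable lborel (\<lambda>x. ?p x * x powr (- \<kappa>) * (x powr \<kappa> * resolvent x t))"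
      unfolding eq1 by (rule density_resolvent_integrable[OF t])
    show "integrable lborel (\<lambda>x. ?p x * x powr (- \<kappa>) * (x powr \<kappa> * resolvent x t)\<^sup>2)"
      unfolding eq2
    proof (rule Bochner_Integration.integrable_bound[OF k])
      show "AE x in lborel. norm (?p x * x powr \<kappa> * (resolvent x t)\<^sup>2) \<le> norm (?p x * x powr \<kappa>)"
      proof (rule AE_I2)
        fix x :: real
        show "norm (?p x * x powr \<kappa> * (resolvent x t)\<^sup>2) \<le> norm (?p x * x powr \<kappa>)"
          using abs_resolvent_le_1[of x t] t
          by (cases "x > 0") (auto simp: p0 abs_mult abs_square_le_1 intro!: mult_left_le)
      qed
    qed measurable
  qed
  then show ?thesis unfolding eq1 eq2 mean_resolvent_def .
qed

lemma mean_resolvent_square_integral_lt_2: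
  assumes "\<rho> < 2"
  shows "\<exists>C. \<forall>T\<ge>0. (LBINT t:{0..T}. (mean_resolvent t)\<^sup>2) \<le> C"
proof -
  let ?p = "gamma_density \<mu> lam"
  \<comment> \<open>Scaling contributes the power -1/\<rho> of x, and \<kappa> - 1/\<rho> = -
    \<kappa>, so the second factor becomes a multiple of the same moment \<open>A\<close>.\<close>
  define \<kappa> where "\<kappa> = 1 / (2 * \<rho>)"
  have \<kappa>: "0 < \<kappa>" "\<kappa> < \<mu>" using \<rho> \<mu> by (auto simp: \<kappa>_def)
  define A where "A = (\<integral>x. ?p x * x powr (- \<kappa>) \<partial>lborel)"
  have A0: "A \<ge> 0" unfolding A_def using lam mu_pos by (intro integral_nonneg_AE) auto
  have Ai: "integrable lborel (\<lambda>x. ?p x * x powr (- \<kappa>))"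
    using gamma_density_moment[OF lam, of \<mu> "- \<kappa>"] \<kappa> by (auto simp: has_bochner_integral_iff)
  have k: "integrable lborel (\<lambda>x. ?p x * x powr \<kappa>)"
    using gamma_density_moment[OF lam, of \<mu> "\<kappa>"] \<kappa> by (auto simp: has_bochner_integral_iff)
  obtain C where C: "\<And>T. T \<ge> 0 \<Longrightarrow> integral {0..T} (\<lambda>t. (mittag_leffler \<rho> 1 (- (t powr \<rho>)))\<^sup>2) \<le> C"
    using mittag_leffler_square_integral_bounded[OF \<rho>(1) assms] by blast
  have cont1: "continuous_on {0..T} (resolvent 1)" for T
    unfolding resolvent_def[abs_def] using \<rho>
    by (intro continuous_on_subset[OF continuous_on_mittag_leffler_powr]) auto
  have C1: "(LBINT t:{0..T}. (resolvent 1 t)\<^sup>2) \<le> C" if "T \<ge> 0" for T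
    using C[OF that] cont1 by (subst LBINT_eq_integral_continuous) (auto simp: resolvent_def intro!: continuous_intros)
  have "(LBINT t:{0..T}. (mean_resolvent t)\<^sup>2) \<le> A * (C * A)" if T: "T \<ge> 0" for T
  proof -
    let ?f = "\<lambda>t x. ?p x * x powr \<kappa> * (resolvent x t)\<^sup>2"
    have m: "(\<lambda>(x, t). ?f t x) \<in> borel_measurable (lborel \<Otimes>\<^sub>M lborel)" by measurable
    have p0: "?p x = 0" if "x \<le> 0" for x using that by (simp add: gamma_density_def)
    have le: "\<bar>?f t x\<bar> \<le> ?p x * x powr \<kappa>" if "0 \<le> t" for x t
      using abs_resolvent_le_1[of x t] that lam mu_pos
      by (cases "x > 0") (auto simp: p0 abs_mult abs_square_le_1 intro!: mult_left_le)
    note F = Fubini_interval[OF sigma_finite_lborel m k le, of T]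
    have cm: "continuous_on {0..T} (\<lambda>t. (mean_resolvent t)\<^sup>2)"
      by (intro continuous_intros continuous_on_subset[OF continuous_on_mean_resolvent]) auto
    have inner: "(LBINT t:{0..T}. ?f t x) \<le> C * (?p x * x powr (- \<kappa>))" for x
    proof (cases "x > 0")
      case True
      have c: "x powr (1 / \<rho>) > 0" using True by simp
      have "(LBINT t:{0..T}. ?f t x) = ?p x * x powr \<kappa> * (LBINT t:{0..T}. (resolvent x t)\<^sup>2)"
        by simp
      also have "(LBINT t:{0..T}. (resolvent x t)\<^sup>2) = (LBINT t:{0..T}. (resolvent 1 (x powr (1 / \<rho>) * t))\<^sup>2)"
        using True by (intro set_lebesgue_integral_cong) (auto simp: resolvent_scale[OF True])
      also have "\<dots> = (LBINT t:{0..x powr (1 / \<rho>) * T}. (resolvent 1 t)\<^sup>2) / x powr (1 / \<rho>)"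
        by (rule LBINT_dilation[OF c])
      also have "?p x * x powr \<kappa> * \<dots> \<le> ?p x * x powr \<kappa> * (C / x powr (1 / \<rho>))"
        using c T lam mu_pos by (intro mult_left_mono divide_right_mono C1) auto
      also have "\<dots> = C * (?p x * (x powr \<kappa> / x powr (1 / \<rho>)))" by simp
      also have "x powr \<kappa> / x powr (1 / \<rho>) = x powr (- \<kappa>)"
        using True by (simp flip: powr_diff add: \<kappa>_def)
      finally show ?thesis .
    qed (simp add: gamma_density_def set_lebesgue_integral_def)
    have "(LBINT t:{0..T}. (mean_resolvent t)\<^sup>2) \<le> (LBINT t:{0..T}. A * (\<integral>x. ?f t x \<partial>lborel))"
      using mean_resolvent_square_le[OF \<kappa>] F(2)
      by (intro set_integral_mono borel_integrable_atLeastAtMost'[OF cm]) (auto simp: A_def)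
    also have "\<dots> = A * (LBINT t:{0..T}. (\<integral>x. ?f t x \<partial>lborel))" by simp
    also have "(LBINT t:{0..T}. (\<integral>x. ?f t x \<partial>lborel)) = (\<integral>x. (LBINT t:{0..T}. ?f t x) \<partial>lborel)"
      using F(3) by simp
    also have "\<dots> \<le> (\<integral>x. C * (?p x * x powr (- \<kappa>)) \<partial>lborel)"
      using F(1) Ai inner by (intro Bochner_Integration.integral_mono) auto
    also have "\<dots> = C * A" by (simp add: A_def)
    finally show ?thesis using A0 by (simp add: mult_left_mono)
  qed
  then show ?thesis by blast
qed

section \<open>Order two: damping and the Poisson kernel\<close>

lemma mean_resolvent_measurable [measurable]: "mean_resolvent \<in> borel_measurable borel"
  unfolding mean_resolvent_def[abs_def] by measurable

text \<open>The cosines give no decay for fixed x. Damping makes the time integral of a product of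
  two cosines finite, and the Poisson kernel that replaces it has an integral bounded uniformly in
  the damping.\<close>

lemma mean_resolvent_square_integral_2:
  assumes "\<rho> = 2"
  shows "\<exists>C. \<forall>T\<ge>0. (LBINT t:{0..T}. (mean_resolvent t)\<^sup>2) \<le> C"
proof -
  let ?p = "gamma_density \<mu> lam" and ?h = mean_resolvent and ?r = resolvent
  have p0: "?p x = 0" if "x \<le> 0" for x using that by (simp add: gamma_density_def)
  have pn: "?p x \<ge> 0" for x using lam mu_pos by simp
  obtain D where D: "D \<ge> 0" "(\<integral>\<^sup>+x. ennreal ((?p x)\<^sup>2 * sqrt x) \<partial>lborel) = ennreal D"
    using gamma_density_square_sqrt[OF lam, of \<mu>] \<mu> assms by auto
  have bound: "(LBINT t:{0..T}. (?h t)\<^sup>2) \<le> exp 1 * (2 * pi * D)" if T: "T > 0" for T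
  proof -
    \<comment> \<open>With this rate the damping factor stays above 1 / e on [0, T], which costs
      only the factor \<open>exp 1\<close> at the end.\<close>
    define \<epsilon> where "\<epsilon> = 1 / T"
    have \<epsilon>: "\<epsilon> > 0" using T by (simp add: \<epsilon>_def)
    define a where "a t = indicator {0<..} t * exp (- \<epsilon> * t)" for t :: real
    have [measurable]: "a \<in> borel_measurable borel" unfolding a_def by measurable
    have a_int: "integrable lborel a"
      using exp_cos_integral[OF \<epsilon>, of 0] by (simp add: a_def[abs_def] has_bochner_integral_iff)
    have a0: "a t = 0" if "t \<le> 0" for t using that by (simp add: a_def)
    have an: "a t \<ge> 0" for t by (simp add: a_def)
    define K where "K x y = (\<integral>t. a t * ?r x t * ?r y t \<partial>lborel)" for x y
    have [measurable]: "(\<lambda>z. K (f z) (g z)) \<in> borel_measurable N"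
      if [measurable]: "f \<in> borel_measurable N" "g \<in> borel_measurable N" for f g and N :: "real measure"
      unfolding K_def by measurable
    have K_eq: "0 \<le> K x y" "K x y \<le> \<epsilon> / (\<epsilon>\<^sup>2 + (sqrt x - sqrt y)\<^sup>2)" if xy: "x > 0" "y > 0" for x y
    proof -
      let ?P = "\<lambda>c. \<epsilon> / (\<epsilon>\<^sup>2 + c\<^sup>2)"
      have prod_eq: "a t * ?r x t * ?r y t = (indicator {0<..} t * (exp (- \<epsilon> * t) * cos ((sqrt x - sqrt y) * t)) +
         indicator {0<..} t * (exp (- \<epsilon> * t) * cos ((sqrt x + sqrt y) * t))) / 2" for t
      proof (cases "t > 0")
        case True
        have "cos (sqrt x * t) * cos (sqrt y * t) =
            (cos ((sqrt x - sqrt y) * t) + cos ((sqrt x + sqrt y) * t)) / 2"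
          unfolding left_diff_distrib distrib_right by (rule cos_times_cos)
        moreover have "a t * ?r x t * ?r y t = exp (- \<epsilon> * t) * (cos (sqrt x * t) * cos (sqrt y * t))"
          using True xy by (simp add: resolvent_2[OF assms] a_def)
        ultimately have "a t * ?r x t * ?r y t =
            exp (- \<epsilon> * t) * ((cos ((sqrt x - sqrt y) * t) + cos ((sqrt x + sqrt y) * t)) / 2)"
          by (simp only:)
        then show ?thesis using True by (simp add: distrib_left add_divide_distrib)
      qed (simp add: a_def)
      have "K x y = (?P (sqrt x - sqrt y) + ?P (sqrt x + sqrt y)) / 2"
        unfolding K_def prod_eq
        using exp_cos_integral[OF \<epsilon>, of "sqrt x - sqrt y"] exp_cos_integral[OF \<epsilon>, of "sqrt x + sqrt y"]
        by (simp add: has_bochner_integral_iff)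
      \<comment> \<open>The term with the sum of the frequencies is the smaller one, so twice the
        difference term dominates the pair.\<close>
      moreover have "?P (sqrt x + sqrt y) \<le> ?P (sqrt x - sqrt y)"
      proof -
        have "(sqrt x - sqrt y)\<^sup>2 \<le> (sqrt x + sqrt y)\<^sup>2"
          using xy by (simp add: power2_diff power2_sum)
        then show ?thesis using \<epsilon> by (intro divide_left_mono mult_pos_pos add_pos_nonneg) auto
      qed
      moreover have "?P (sqrt x - sqrt y) \<ge> 0" "?P (sqrt x + sqrt y) \<ge> 0" using \<epsilon> by simp_all
      moreover have "0 \<le> k \<and> k \<le> b" if "k = (b + c) / 2" "c \<le> b" "0 \<le> b" "0 \<le> c" for k b c :: real
        using that by simp
      ultimately have "0 \<le> K x y \<and> K x y \<le> ?P (sqrt x - sqrt y)" by blast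
      then show "0 \<le> K x y" "K x y \<le> ?P (sqrt x - sqrt y)" by blast+
    qed
    have pr: "\<bar>?p x * ?r x t\<bar> \<le> ?p x" if "t > 0" for x t
      using density_resolvent_le[of t x] that by simp
    have h1: "\<bar>?h t\<bar> \<le> 1" if "t > 0" for t using abs_mean_resolvent_le_1[of t] that by simp
    \<comment> \<open>The square of the mean is opened in two stages: here one factor becomes an
      integral over x, in \<open>F2\<close> the other an integral over y.\<close>
    have F1: "integrable lborel (\<lambda>x. \<integral>t. a t * ?h t * (?p x * ?r x t) \<partial>lborel)"
       "integrable lborel (\<lambda>t. \<integral>x. a t * ?h t * (?p x * ?r x t) \<partial>lborel)"
       "(\<integral>x. (\<integral>t. a t * ?h t * (?p x * ?r x t) \<partial>lborel) \<partial>lborel) =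
        (\<integral>t. (\<integral>x. a t * ?h t * (?p x * ?r x t) \<partial>lborel) \<partial>lborel)"
    proof -
      have m: "(\<lambda>(x, t). a t * ?h t * (?p x * ?r x t)) \<in> borel_measurable (lborel \<Otimes>\<^sub>M lborel)"
        by measurable
      have le: "\<bar>a t * ?h t * (?p x * ?r x t)\<bar> \<le> a t * ?p x" for x t
      proof (cases "t > 0")
        case True
        have "\<bar>a t * ?h t * (?p x * ?r x t)\<bar> = a t * \<bar>?h t\<bar> * \<bar>?p x * ?r x t\<bar>"
          using an[of t] by (simp add: abs_mult)
        also have "\<dots> \<le> a t * 1 * ?p x"
          using an[of t] pn[of x] h1[OF True] pr[OF True] by (intro mult_mono) auto
        finally show ?thesis by simp
      qed (use pn in \<open>simp add: a0\<close>)
      note F = Fubini_dominated[OF sigma_finite_lborel sigma_finite_lborel m a_int gamma_density_integrable le]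
      show "integrable lborel (\<lambda>x. \<integral>t. a t * ?h t * (?p x * ?r x t) \<partial>lborel)"
       "integrable lborel (\<lambda>t. \<integral>x. a t * ?h t * (?p x * ?r x t) \<partial>lborel)"
       "(\<integral>x. (\<integral>t. a t * ?h t * (?p x * ?r x t) \<partial>lborel) \<partial>lborel) =
        (\<integral>t. (\<integral>x. a t * ?h t * (?p x * ?r x t) \<partial>lborel) \<partial>lborel)"
        by (rule F)+
    qed
    have hh: "(\<integral>x. a t * ?h t * (?p x * ?r x t) \<partial>lborel) = a t * (?h t)\<^sup>2" for t
      by (simp add: mean_resolvent_def power2_eq_square)
    have F2: "integrable lborel (\<lambda>y. ?p x * ?p y * K x y)"
       "(\<integral>t. a t * ?h t * (?p x * ?r x t) \<partial>lborel) = (\<integral>y. ?p x * ?p y * K x y \<partial>lborel)" for x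
    proof -
      let ?g = "\<lambda>t y. a t * (?p x * ?r x t) * (?p y * ?r y t)"
      have m: "(\<lambda>(y, t). ?g t y) \<in> borel_measurable (lborel \<Otimes>\<^sub>M lborel)"
        by measurable
      have le: "\<bar>?g t y\<bar> \<le> a t * (?p x * ?p y)" for y t
      proof (cases "t > 0")
        case True
        have "\<bar>?g t y\<bar> = a t * \<bar>?p x * ?r x t\<bar> * \<bar>?p y * ?r y t\<bar>"
          using an[of t] by (simp add: abs_mult)
        also have "\<dots> \<le> a t * ?p x * ?p y"
          using an[of t] pn[of x] pn[of y] pr[OF True] by (intro mult_mono) auto
        finally show ?thesis by (simp add: mult.assoc)
      qed (use pn in \<open>simp add: a0\<close>)
      note F = Fubini_dominated[OF sigma_finite_lborel sigma_finite_lborel m a_int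
          integrable_mult_right[OF gamma_density_integrable] le]
      have e1: "(\<integral>t. ?g t y \<partial>lborel) = ?p x * ?p y * K x y" for y
      proof -
        have "(\<integral>t. ?g t y \<partial>lborel) = (\<integral>t. (?p x * ?p y) * (a t * ?r x t * ?r y t) \<partial>lborel)"
          by (intro Bochner_Integration.integral_cong) auto
        then show ?thesis by (simp add: K_def)
      qed
      have e2: "(\<integral>y. ?g t y \<partial>lborel) = a t * ?h t * (?p x * ?r x t)" for t
        by (simp add: mean_resolvent_def)
      show "integrable lborel (\<lambda>y. ?p x * ?p y * K x y)" using F(1) unfolding e1 .
      show "(\<integral>t. a t * ?h t * (?p x * ?r x t) \<partial>lborel) = (\<integral>y. ?p x * ?p y * K x y \<partial>lborel)"
        using F(3) unfolding e1 e2 by simp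
    qed
    have pK: "?p x * ?p y * K x y \<ge> 0" for x y
      using K_eq(1)[of x y] pn p0 by (cases "x > 0 \<and> y > 0") (auto simp: not_less)
    define Q where "Q = (\<integral>t. a t * (?h t)\<^sup>2 \<partial>lborel)"
    \<comment> \<open>the factors \<open>sqrt x\<close> and \<open>1 / sqrt y\<close> turn \<open>dy\<close> into twice the differential of \<open>sqrt y\<close>,
      in which the Poisson kernel has integral at most \<open>\<pi>\<close>\<close>
    define B where "B x y = (?p x)\<^sup>2 * sqrt x * (indicator {0<..} y * (\<epsilon> / (\<epsilon>\<^sup>2 + (sqrt y - sqrt x)\<^sup>2) / sqrt y))" for x y
    have [measurable]: "(\<lambda>(x, y). B x y) \<in> borel_measurable (borel \<Otimes>\<^sub>M borel)"
      unfolding B_def by measurable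
    have Bn: "B x y \<ge> 0" for x y
      using \<epsilon> by (cases "x > 0") (auto simp: B_def p0 indicator_def intro!: mult_nonneg_nonneg divide_nonneg_nonneg)
    have pB: "?p x * ?p y * K x y \<le> (B x y + B y x) / 2" for x y
    proof (cases "x > 0 \<and> y > 0")
      case True
      \<comment> \<open>This weight in the arithmetic-geometric mean inequality produces exactly
        \<open>B x y\<close> and, with the roles exchanged, \<open>B y x\<close>.\<close>
      define w where "w = sqrt x / sqrt y"
      define k where "k = \<epsilon> / (\<epsilon>\<^sup>2 + (sqrt x - sqrt y)\<^sup>2)"
      have w: "w > 0" using True by (simp add: w_def)
      have k: "k \<ge> 0" using \<epsilon> by (simp add: k_def)
      have "0 \<le> (?p x * w - ?p y)\<^sup>2 / w" using w by simp
      also have "\<dots> = (?p x)\<^sup>2 * w + (?p y)\<^sup>2 / w - 2 * (?p x * ?p y)"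
        using w by (simp add: power2_eq_square field_simps)
      finally have amgm: "?p x * ?p y \<le> ((?p x)\<^sup>2 * w + (?p y)\<^sup>2 / w) / 2" by simp
      have "?p x * ?p y * K x y \<le> ?p x * ?p y * k"
        unfolding k_def using K_eq(2)[of x y] True pn by (intro mult_left_mono) auto
      also have "\<dots> \<le> ((?p x)\<^sup>2 * w + (?p y)\<^sup>2 / w) / 2 * k"
        using amgm k by (rule mult_right_mono)
      also have "\<dots> = (B x y + B y x) / 2"
        using True by (simp add: B_def w_def k_def power2_commute[of "sqrt y" "sqrt x"] algebra_simps add_divide_distrib)
      finally show ?thesis .
    next
      case False
      then have "?p x = 0 \<or> ?p y = 0" using p0 by (auto simp: not_less)
      then have "?p x * ?p y * K x y = 0" by auto
      also have "0 \<le> (B x y + B y x) / 2" using Bn[of x y] Bn[of y x] by simp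
      finally show ?thesis .
    qed
    have BI: "(\<integral>\<^sup>+x. (\<integral>\<^sup>+y. ennreal (B x y) \<partial>lborel) \<partial>lborel) \<le> ennreal (2 * pi * D)"
    proof -
      have "(\<integral>\<^sup>+y. ennreal (B x y) \<partial>lborel) \<le> ennreal (2 * pi) * ennreal ((?p x)\<^sup>2 * sqrt x)" for x
      proof (cases "x > 0")
        case True
        have "(\<integral>\<^sup>+y. ennreal (B x y) \<partial>lborel) = (\<integral>\<^sup>+y. ennreal ((?p x)\<^sup>2 * sqrt x) *
            ennreal (indicator {0<..} y * (\<epsilon> / (\<epsilon>\<^sup>2 + (sqrt y - sqrt x)\<^sup>2) / sqrt y)) \<partial>lborel)"
          unfolding B_def using True by (intro nn_integral_cong ennreal_mult') simp
        also have "\<dots> = ennreal ((?p x)\<^sup>2 * sqrt x) *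
            (\<integral>\<^sup>+y. ennreal (indicator {0<..} y * (\<epsilon> / (\<epsilon>\<^sup>2 + (sqrt y - sqrt x)\<^sup>2) / sqrt y)) \<partial>lborel)"
          by (rule nn_integral_cmult) measurable
        also have "\<dots> \<le> ennreal ((?p x)\<^sup>2 * sqrt x) * ennreal (2 * pi)"
          by (intro mult_left_mono Poisson_kernel_sqrt_integral \<epsilon>) auto
        finally show ?thesis by (simp add: mult.commute)
      qed (simp add: B_def p0)
      then have "(\<integral>\<^sup>+x. (\<integral>\<^sup>+y. ennreal (B x y) \<partial>lborel) \<partial>lborel) \<le>
          (\<integral>\<^sup>+x. ennreal (2 * pi) * ennreal ((?p x)\<^sup>2 * sqrt x) \<partial>lborel)"
        by (intro nn_integral_mono)
      also have "\<dots> = ennreal (2 * pi) * ennreal D"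
        unfolding D(2)[symmetric] by (rule nn_integral_cmult) measurable
      finally show ?thesis using D(1) by (simp add: ennreal_mult')
    qed
    have "ennreal Q = ennreal (\<integral>x. (\<integral>y. ?p x * ?p y * K x y \<partial>lborel) \<partial>lborel)"
      using F1(3) unfolding hh Q_def F2(2) by simp
    also have "\<dots> = (\<integral>\<^sup>+x. ennreal (\<integral>y. ?p x * ?p y * K x y \<partial>lborel) \<partial>lborel)"
      using F1(1) pK unfolding F2(2)
      by (intro nn_integral_eq_integral[symmetric] AE_I2 integral_nonneg_AE) auto
    also have "\<dots> = (\<integral>\<^sup>+x. (\<integral>\<^sup>+y. ennreal (?p x * ?p y * K x y) \<partial>lborel) \<partial>lborel)"
      using F2(1) pK by (intro nn_integral_cong nn_integral_eq_integral[symmetric]) auto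
    also have "\<dots> \<le> (\<integral>\<^sup>+x. (\<integral>\<^sup>+y. ennreal (1/2) * (ennreal (B x y) + ennreal (B y x)) \<partial>lborel) \<partial>lborel)"
    proof (intro nn_integral_mono)
      fix x y :: real
      have "ennreal (?p x * ?p y * K x y) \<le> ennreal (1 / 2 * (B x y + B y x))"
        using pB[of x y] by (intro ennreal_leI) simp
      also have "\<dots> = ennreal (1/2) * (ennreal (B x y) + ennreal (B y x))"
        using Bn by (subst ennreal_mult'') auto
      finally show "ennreal (?p x * ?p y * K x y) \<le> ennreal (1/2) * (ennreal (B x y) + ennreal (B y x))" .
    qed
    also have "\<dots> = ennreal (1/2) * ((\<integral>\<^sup>+x. (\<integral>\<^sup>+y. ennreal (B x y) \<partial>lborel) \<partial>lborel) +
        (\<integral>\<^sup>+x. (\<integral>\<^sup>+y. ennreal (B y x) \<partial>lborel) \<partial>lborel))"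
      by (simp add: nn_integral_cmult nn_integral_add)
    \<comment> \<open>\<open>B\<close> is not symmetric, but Tonelli's theorem makes the two double
      integrals equal, so one bound suffices.\<close>
    also have "(\<integral>\<^sup>+x. (\<integral>\<^sup>+y. ennreal (B y x) \<partial>lborel) \<partial>lborel) = (\<integral>\<^sup>+x. (\<integral>\<^sup>+y. ennreal (B x y) \<partial>lborel) \<partial>lborel)"
      by (rule lborel_pair.Fubini') measurable
    also have "ennreal (1/2) * ((\<integral>\<^sup>+x. (\<integral>\<^sup>+y. ennreal (B x y) \<partial>lborel) \<partial>lborel) +
        (\<integral>\<^sup>+x. (\<integral>\<^sup>+y. ennreal (B x y) \<partial>lborel) \<partial>lborel)) \<le>
        ennreal (1/2) * (ennreal (2 * pi * D) + ennreal (2 * pi * D))"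
      by (intro mult_left_mono add_mono BI) auto
    also have "\<dots> = ennreal (2 * pi * D)"
    proof -
      have "ennreal (1/2) * (ennreal (2 * pi * D) + ennreal (2 * pi * D)) =
          ennreal (1/2) * ennreal (2 * pi * D + 2 * pi * D)"
        using D(1) by (subst ennreal_plus) auto
      also have "\<dots> = ennreal (1/2 * (2 * pi * D + 2 * pi * D))"
        by (rule ennreal_mult'[symmetric]) simp
      also have "1/2 * (2 * pi * D + 2 * pi * D) = 2 * pi * D" by simp
      finally show ?thesis .
    qed
    finally have Q: "Q \<le> 2 * pi * D" using D(1) by (simp add: ennreal_le_iff)
    have "(LBINT t:{0..T}. (?h t)\<^sup>2) \<le> (\<integral>t. exp 1 * (a t * (?h t)\<^sup>2) \<partial>lborel)"
      unfolding set_lebesgue_integral_def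
    proof (rule integral_mono_AE)
      have "set_integrable lborel {0..T} (\<lambda>t. (?h t)\<^sup>2)"
        by (intro borel_integrable_atLeastAtMost' continuous_intros
            continuous_on_subset[OF continuous_on_mean_resolvent]) auto
      then show "integrable lborel (\<lambda>t. indicator {0..T} t *\<^sub>R (?h t)\<^sup>2)"
        by (simp add: set_integrable_def)
      show "integrable lborel (\<lambda>t. exp 1 * (a t * (?h t)\<^sup>2))"
        using F1(2) unfolding hh by (rule integrable_mult_right)
      show "AE t in lborel. indicator {0..T} t *\<^sub>R (?h t)\<^sup>2 \<le> exp 1 * (a t * (?h t)\<^sup>2)"
        using AE_lborel_singleton[of 0]
      proof eventually_elim
        fix t :: real assume "t \<noteq> 0"
        show "indicator {0..T} t *\<^sub>R (?h t)\<^sup>2 \<le> exp 1 * (a t * (?h t)\<^sup>2)"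
        proof (cases "t \<in> {0..T}")
          case True
          then have "\<epsilon> * t \<le> 1" using T by (simp add: \<epsilon>_def)
          then have "1 \<le> exp 1 * a t" using True \<open>t \<noteq> 0\<close> by (simp add: a_def flip: exp_add)
          then have "1 * (?h t)\<^sup>2 \<le> exp 1 * a t * (?h t)\<^sup>2" by (intro mult_right_mono) auto
          then show ?thesis using True by (simp add: mult.assoc)
        qed (use an in simp)
      qed
    qed
    also have "\<dots> = exp 1 * Q" by (simp add: Q_def)
    also have "\<dots> \<le> exp 1 * (2 * pi * D)" using Q by simp
    finally show ?thesis .
  qed
  show ?thesis
  proof (intro exI allI impI)
    fix T :: real assume "T \<ge> 0"
    show "(LBINT t:{0..T}. (?h t)\<^sup>2) \<le> exp 1 * (2 * pi * D)"
    proof (cases "T = 0")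
      case True
      have "(LBINT t:{0..T}. (?h t)\<^sup>2) = integral {0..T} (\<lambda>t. (?h t)\<^sup>2)"
        by (intro LBINT_eq_integral_continuous continuous_intros
            continuous_on_subset[OF continuous_on_mean_resolvent]) auto
      then show ?thesis using True D(1) by simp
    qed (use bound \<open>T \<ge> 0\<close> in auto)
  qed
qed

lemma mean_resolvent_square_integral_bounded:
  "\<exists>C. \<forall>T\<ge>0. (LBINT t:{0..T}. (mean_resolvent t)\<^sup>2) \<le> C"
  using mean_resolvent_square_integral_lt_2 mean_resolvent_square_integral_2 \<rho> by fastforce

end

section \<open>Convergence in law\<close>

lemma LBINT_reflect:
  fixes f :: "real \<Rightarrow> real"
  shows "(LBINT u:{0..t}. f (t - u)) = (LBINT u:{0..t}. f u)"
proof -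
  have "(\<integral>u. indicator {0..t} u *\<^sub>R f u \<partial>lborel) =
      \<bar>- 1\<bar> *\<^sub>R (\<integral>u. indicator {0..t} (t + - 1 * u) *\<^sub>R f (t + - 1 * u) \<partial>lborel)"
    by (rule lborel_integral_real_affine) simp
  also have "(\<lambda>u. indicator {0..t} (t + - 1 * u) *\<^sub>R f (t + - 1 * u)) = (\<lambda>u. indicator {0..t} u *\<^sub>R f (t - u))"
    by (auto simp: fun_eq_iff indicator_def)
  finally show ?thesis by (simp add: set_lebesgue_integral_def)
qed

text \<open>The continuity theorem speaks of sequences, so the limit at infinity is tested along
  arbitrary sequences of times tending to infinity.\<close>

lemma tendsto_in_law_char:
  fixes M :: "'a measure" and Y :: "real \<Rightarrow> 'a \<Rightarrow> real"
  assumes "prob_space M" and Y: "\<And>t. t \<ge> 0 \<Longrightarrow> Y t \<in> borel_measurable M"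
    and \<eta>: "\<eta> \<in> borel_measurable M"
    and lim: "\<And>\<theta>. ((\<lambda>t. char (distr M borel (Y t)) \<theta>) \<longlongrightarrow> char (distr M borel \<eta>) \<theta>) at_top"
  shows "tendsto_in_law M Y \<eta> at_top"
  unfolding tendsto_in_law_def
proof (intro allI impI tendsto_at_topI_sequentially)
  interpret prob_space M by fact
  fix x and X :: "nat \<Rightarrow> real"
  assume x: "isCont (cdf (distr M borel \<eta>)) x" and X: "filterlim X at_top sequentially"
  \<comment> \<open>at negative times \<open>Y\<close> need not be measurable\<close>
  define Z where "Z n = max 0 (X n)" for n
  have "filterlim Z at_top sequentially"
    by (rule filterlim_at_top_mono[OF X]) (simp add: Z_def)
  then have "weak_conv_m (\<lambda>n. distr M borel (Y (Z n))) (distr M borel \<eta>)"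
    by (intro levy_continuity real_distribution_distr \<eta> Y filterlim_compose[OF lim]) (simp add: Z_def)
  then have "(\<lambda>n. cdf (distr M borel (Y (Z n))) x) \<longlonglongrightarrow> cdf (distr M borel \<eta>) x"
    using x by (simp add: weak_conv_m_def weak_conv_def)
  moreover have "\<forall>\<^sub>F n in sequentially. cdf (distr M borel (Y (Z n))) x = cdf (distr M borel (Y (X n))) x"
    using filterlim_at_top_dense[THEN iffD1, OF X, rule_format, of 0]
    by eventually_elim (simp add: Z_def max_def)
  ultimately show "(\<lambda>n. cdf (distr M borel (Y (X n))) x) \<longlonglongrightarrow> cdf (distr M borel \<eta>) x"
    by (rule Lim_transform_eventually)
qed

text \<open>Ensures that the limiting variance is positive, so that the limit law has a
  density.\<close>

lemma LBINT_square_pos: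
  fixes f :: "real \<Rightarrow> real"
  assumes f: "continuous_on {0..} f" and "f 0 \<noteq> 0"
  shows "(LBINT t:{0..1}. (f t)\<^sup>2) > 0"
proof -
  have c: "continuous_on {0..1} (\<lambda>t. (f t)\<^sup>2)"
    by (intro continuous_intros continuous_on_subset[OF f]) auto
  have eq: "(LBINT t:{0..1}. (f t)\<^sup>2) = integral {0..1} (\<lambda>t. (f t)\<^sup>2)"
    by (rule LBINT_eq_integral_continuous[OF c])
  have "integral {0..1} (\<lambda>t. (f t)\<^sup>2) \<ge> 0"
    by (rule Henstock_Kurzweil_Integration.integral_nonneg[OF integrable_continuous_interval[OF c]]) auto
  moreover have "integral {0..1} (\<lambda>t. (f t)\<^sup>2) \<noteq> 0"
    using integral_eq_0_iff[OF c] assms(2) by force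
  ultimately show ?thesis unfolding eq by linarith
qed

text \<open>The integral is monotone in the upper limit. That the limit also bounds every finite
  integral is recorded for the positivity of the limiting variance.\<close>

lemma square_integral_tendsto:
  fixes f :: "real \<Rightarrow> real"
  assumes f: "continuous_on {0..} f" and C: "\<And>T. T \<ge> 0 \<Longrightarrow> (LBINT t:{0..T}. (f t)\<^sup>2) \<le> C"
  shows "\<exists>V. ((\<lambda>T. LBINT t:{0..T}. (f t)\<^sup>2) \<longlongrightarrow> V) at_top \<and> (\<forall>T\<ge>0. (LBINT t:{0..T}. (f t)\<^sup>2) \<le> V)"
proof -
  define v where "v T = (LBINT t:{0..T}. (f t)\<^sup>2)" for T
  have int: "set_integrable lborel {0..T} (\<lambda>t. (f t)\<^sup>2)" for T
    by (intro borel_integrable_atLeastAtMost' continuous_intros continuous_on_subset[OF f]) auto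
  have mono: "mono v"
  proof (rule monoI)
    fix S T :: real assume "S \<le> T"
    then show "v S \<le> v T"
      unfolding v_def set_lebesgue_integral_def
      using int[of S] int[of T]
      by (intro Bochner_Integration.integral_mono) (auto simp: set_integrable_def indicator_def)
  qed
  have "incseq (\<lambda>n. v (real n))" using mono by (auto simp: incseq_def mono_def)
  moreover have "\<forall>n. v (real n) \<le> C" using C by (simp add: v_def)
  ultimately obtain V where V: "(\<lambda>n. v (real n)) \<longlonglongrightarrow> V"
    using incseq_convergent[of "\<lambda>n. v (real n)" C] by blast
  have lim: "(v \<longlongrightarrow> V) at_top" by (rule tendsto_at_topI_sequentially_real[OF mono V])
  have "v T \<le> V" for T
    by (rule tendsto_lowerbound[OF lim]) (auto intro!: eventually_at_top_linorderI[of T] monoD[OF mono])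
  with lim show ?thesis unfolding v_def[abs_def] by auto
qed

theorem theorem4p2:
  fixes \<rho> lam \<mu> :: real
    and N :: "'b measure" and \<alpha> :: "'b \<Rightarrow> real"
    and M :: "'a measure" and W Y :: "real \<Rightarrow> 'a \<Rightarrow> real"
  assumes "1 < \<rho>" and "\<rho> \<le> 2" and "lam > 0" and "\<mu> > 1 / (2 * \<rho>)"
    and "prob_space N"
    and "distributed N lborel \<alpha> (gamma_density \<mu> lam)"
    and "brownian_motion M W"
    and "\<And>t. t \<ge> 0 \<Longrightarrow> Y t \<in> borel_measurable M"
    and "\<And>t. t \<ge> 0 \<Longrightarrow> AE \<omega> in M. Y t \<omega> =
           wiener_integral M W t (\<lambda>\<tau>. LINT \<omega>'|N. scalar_resolvent \<rho> (\<alpha> \<omega>') (t - \<tau>)) \<omega>"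
  shows "\<exists>\<eta> m \<sigma>. \<sigma> > 0 \<and> distributed M lborel \<eta> (normal_density m \<sigma>) \<and>
           tendsto_in_law M Y \<eta> at_top"
proof -
  interpret BM: brownian_motion M W by fact
  have \<rho>: "1 < \<rho>" "\<rho> \<le> 2" and lam: "lam > 0" and \<mu>: "\<mu> > 1 / (2 * \<rho>)" by fact+
  define h where "h = mean_resolvent \<rho> lam \<mu>"
  have cont: "continuous_on {0..} h"
    unfolding h_def by (rule continuous_on_mean_resolvent[OF \<rho> lam \<mu>])
  have h0: "h 0 \<noteq> 0" using mean_resolvent_0[OF \<rho> lam \<mu>] by (simp add: h_def)
  obtain C where C: "\<And>T. T \<ge> 0 \<Longrightarrow> (LBINT t:{0..T}. (h t)\<^sup>2) \<le> C"
    using mean_resolvent_square_integral_bounded[OF \<rho> lam \<mu>] unfolding h_def by blast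
  obtain V where V: "((\<lambda>T. LBINT t:{0..T}. (h t)\<^sup>2) \<longlongrightarrow> V) at_top"
    "\<And>T. T \<ge> 0 \<Longrightarrow> (LBINT t:{0..T}. (h t)\<^sup>2) \<le> V"
    using square_integral_tendsto[OF cont C] by blast
  have V0: "V > 0" using LBINT_square_pos[OF cont h0] V(2)[of 1] by simp
  have mean: "(LINT \<omega>'|N. scalar_resolvent \<rho> (\<alpha> \<omega>') u) = h u" if u: "u \<ge> 0" for u
  proof -
    have eq: "scalar_resolvent \<rho> x u = resolvent \<rho> x u" for x
      using scalar_resolvent_eq[OF \<rho>(1) u] by (simp add: resolvent_def[OF \<rho> lam \<mu>])
    have [measurable]: "(\<lambda>x. resolvent \<rho> x u) \<in> borel_measurable borel"
      by (intro resolvent_measurable[OF \<rho> lam \<mu>]) auto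
    have "(\<integral>x. gamma_density \<mu> lam x * resolvent \<rho> x u \<partial>lborel) = (LINT \<omega>'|N. resolvent \<rho> (\<alpha> \<omega>') u)"
      using assms(6) lam mu_pos[OF \<rho> lam \<mu>] by (intro distributed_integral) auto
    then show ?thesis by (simp add: h_def mean_resolvent_def[OF \<rho> lam \<mu>] eq)
  qed
  have char_Y: "char (distr M borel (Y t)) \<theta> =
      complex_of_real (exp (- ((LBINT u:{0..t}. (h u)\<^sup>2) * \<theta>\<^sup>2 / 2)))" if t: "t \<ge> 0" for t \<theta>
  proof -
    let ?f = "\<lambda>\<tau>. LINT \<omega>'|N. scalar_resolvent \<rho> (\<alpha> \<omega>') (t - \<tau>)"
    \<comment> \<open>The two functions are compared only on [0, t]; beyond it the resolvent would
      be evaluated at negative times.\<close>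
    have f_eq: "?f \<tau> = h (t - \<tau>)" if "\<tau> \<in> {0..t}" for \<tau> using mean[of "t - \<tau>"] that by simp
    have "continuous_on {0..t} (\<lambda>\<tau>. h (t - \<tau>))"
      by (rule continuous_on_compose2[OF cont]) (auto intro!: continuous_intros)
    then have f: "continuous_on {0..t} ?f"
      by (rule continuous_on_cong[THEN iffD2, OF refl, rotated]) (rule f_eq)
    have "(LBINT \<tau>:{0..t}. (?f \<tau>)\<^sup>2) = (LBINT \<tau>:{0..t}. (h (t - \<tau>))\<^sup>2)"
      by (intro set_lebesgue_integral_cong) (auto simp: f_eq)
    also have "\<dots> = (LBINT u:{0..t}. (h u)\<^sup>2)" by (rule LBINT_reflect)
    finally have var: "(LBINT \<tau>:{0..t}. (?f \<tau>)\<^sup>2) = (LBINT u:{0..t}. (h u)\<^sup>2)" .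
    have "distr M borel (Y t) = distr M borel (wiener_integral M W t ?f)"
      using assms(8)[OF t] BM.char_wiener_integral_continuous(1)[OF t f] assms(9)[OF t]
      by (intro distr_cong_AE) auto
    then show ?thesis
      using BM.char_wiener_integral_continuous(2)[OF t f, of \<theta>] by (simp only: var)
  qed
  \<comment> \<open>A normal variable on the same probability space is needed, and the increment of
    \<open>W\<close> over unit time is a standard one. The summand 0 gives the term the shape of an
    affine image.\<close>
  define \<eta> where "\<eta> \<omega> = 0 + sqrt V * (W 1 \<omega> - W 0 \<omega>)" for \<omega>
  have "distributed M lborel (\<lambda>\<omega>. W 1 \<omega> - W 0 \<omega>) (normal_density 0 (sqrt (1 - 0)))"
    by (rule BM.normal_increments) auto
  then have "distributed M lborel \<eta> (normal_density (0 + sqrt V * 0) (\<bar>sqrt V\<bar> * sqrt (1 - 0)))"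
    unfolding \<eta>_def[abs_def] using V0 by (intro BM.normal_density_affine) auto
  then have \<eta>: "distributed M lborel \<eta> (normal_density 0 (sqrt V))" using V0 by simp
  have \<eta>_meas: "\<eta> \<in> borel_measurable M" using distributed_measurable[OF \<eta>] by simp
  have "tendsto_in_law M Y \<eta> at_top"
  proof (rule tendsto_in_law_char[OF BM.prob_space_axioms assms(8) \<eta>_meas])
    fix \<theta> :: real
    have "((\<lambda>t. complex_of_real (exp (- ((LBINT u:{0..t}. (h u)\<^sup>2) * \<theta>\<^sup>2 / 2)))) \<longlongrightarrow>
        complex_of_real (exp (- (V * \<theta>\<^sup>2 / 2)))) at_top"
      by (intro tendsto_intros V(1)) simp
    also have "complex_of_real (exp (- (V * \<theta>\<^sup>2 / 2))) = char (distr M borel \<eta>) \<theta>"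
      using BM.char_normal[OF \<eta>, of \<theta>] V0 by simp
    finally show "((\<lambda>t. char (distr M borel (Y t)) \<theta>) \<longlongrightarrow> char (distr M borel \<eta>) \<theta>) at_top"
      by (rule Lim_transform_eventually)
         (auto simp: char_Y intro!: eventually_at_top_linorderI[of 0])
  qed
  then show ?thesis using \<eta> V0 by (intro exI[of _ \<eta>] exI[of _ 0] exI[of _ "sqrt V"]) auto
qed

end
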